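(* There is an externally sized atomic choice dictionary that, when initialized for universe size $n$, occupies $n+1$ bits in each quiescent state (i.e., between operations) and needs $O(w)$ additional bits of transient space during the execution of each operation.
   Context: Model of computation: a word RAM with word length $w\in\mathbb{N}$ bits, where for a data structure with universe size $n$ it is assumed that $w>\log_2 n$. It has constant-time operations for addition, subtraction and multiplication modulo $2^w$, division with truncation ($(x,y)\mapsto\lfloor x/y\rfloor$ for $y>0$), left shift modulo $2^w$ ($(x,y)\mapsto (x\cdot 2^y)\bmod 2^w$), right shift ($(x,y)\mapsto\lfloor x/2^y\rfloor$), bitwise AND, OR, XOR, and a constant-time operation to load an integer that deviates from $\sqrt{w}$ by at most a constant factor. A choice dictionary is a data structure that can be initialized with an arbitrary integer $n\in\mathbb{N}=\{1,2,\ldots\}$ (the universe size), subsequently maintains an initially empty subset $S$ (the client set) of $U=\{1,\ldots,n\}$, and supports: $\mathit{insert}(\ell)$ for $\ell\in U$ (replace $S$ by $S\cup\{\ell\}$); $\mathit{delete}(\ell)$ for $\ell\in U$ (replace $S$ by $S\setminus\{\ell\}$); $\mathit{contains}(\ell)$ for $\ell\in U$ (return 1 if $\ell\in S$, 0 otherwise); $\mathit{choice}$ (return an arbitrary element of $S$ if $S\neq\emptyset$, and 0 otherwise). A choice dictionary is atomic if it executes all operations, including the initialization, in constant time. It is externally sized if it can operate only when given access to $n$ stored outside of it (the space for storing $n$ is not counted); otherwise it is self-contained. *)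

theory Defs
  imports Complex_Main
begin

text \<open>Registers hold w-bit words (naturals below 2^w). The data structure's persistent
memory is a bit array; the structure owns bit positions 0..n (n+1 bits). Memory is
accessed in aligned w-bit words: word j consists of bit positions j*w .. j*w+w-1
(bit i of the word is bit position j*w+i).\<close>

type_synonym mem = "nat \<Rightarrow> bool"

datatype instr =
    LoadConst nat nat
  | LoadN nat                  \<comment> \<open>dst := n (externally stored universe size)\<close>
  | LoadSqrtW nat              \<comment> \<open>dst := an integer within a constant factor of sqrt w\<close>
  | Add nat nat nat | Sub nat nat nat | Mul nat nat nat | Div nat nat nat
  | Shl nat nat nat | Shr nat nat nat
  | AndI nat nat nat | OrI nat nat nat | XorI nat nat nat
  | Load nat nat
  | Store nat nat
  | Jz nat nat
  | Jmp nat

fun regs_of :: "instr \<Rightarrow> nat list" where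
  "regs_of (LoadConst d k) = [d]"
| "regs_of (LoadN d) = [d]"
| "regs_of (LoadSqrtW d) = [d]"
| "regs_of (Add d a b) = [d, a, b]"
| "regs_of (Sub d a b) = [d, a, b]"
| "regs_of (Mul d a b) = [d, a, b]"
| "regs_of (Div d a b) = [d, a, b]"
| "regs_of (Shl d a b) = [d, a, b]"
| "regs_of (Shr d a b) = [d, a, b]"
| "regs_of (AndI d a b) = [d, a, b]"
| "regs_of (OrI d a b) = [d, a, b]"
| "regs_of (XorI d a b) = [d, a, b]"
| "regs_of (Load d a) = [d, a]"
| "regs_of (Store a b) = [a, b]"
| "regs_of (Jz a t) = [a]"
| "regs_of (Jmp t) = []"

definition word_at :: "nat \<Rightarrow> mem \<Rightarrow> nat \<Rightarrow> nat" where
  "word_at w m j = (\<Sum>i<w. if m (j * w + i) then 2 ^ i else 0)"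

definition store_word :: "nat \<Rightarrow> mem \<Rightarrow> nat \<Rightarrow> nat \<Rightarrow> mem" where
  "store_word w m j v = (\<lambda>p. if j * w \<le> p \<and> p < j * w + w then bit v (p - j * w) else m p)"

type_synonym config = "nat \<times> (nat \<Rightarrow> nat) \<times> mem"

text \<open>Parameters: w = word length, s = the machine's approximation of sqrt w, n = universe size.
Division by 0 yields 0 (the model only needs division for y > 0).\<close>

fun exec_instr :: "nat \<Rightarrow> (nat \<Rightarrow> nat) \<Rightarrow> nat \<Rightarrow> instr \<Rightarrow> nat \<Rightarrow> (nat \<Rightarrow> nat) \<Rightarrow> mem \<Rightarrow> config" where
  "exec_instr w s n (LoadConst d k) pc r m = (Suc pc, r(d := k mod 2 ^ w), m)"
| "exec_instr w s n (LoadN d) pc r m = (Suc pc, r(d := n mod 2 ^ w), m)"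
| "exec_instr w s n (LoadSqrtW d) pc r m = (Suc pc, r(d := s w mod 2 ^ w), m)"
| "exec_instr w s n (Add d a b) pc r m = (Suc pc, r(d := (r a + r b) mod 2 ^ w), m)"
| "exec_instr w s n (Sub d a b) pc r m =
     (Suc pc, r(d := nat ((int (r a) - int (r b)) mod 2 ^ w)), m)"
| "exec_instr w s n (Mul d a b) pc r m = (Suc pc, r(d := (r a * r b) mod 2 ^ w), m)"
| "exec_instr w s n (Div d a b) pc r m = (Suc pc, r(d := r a div r b), m)"
| "exec_instr w s n (Shl d a b) pc r m = (Suc pc, r(d := (r a * 2 ^ r b) mod 2 ^ w), m)"
| "exec_instr w s n (Shr d a b) pc r m = (Suc pc, r(d := r a div 2 ^ r b), m)"
| "exec_instr w s n (AndI d a b) pc r m = (Suc pc, r(d := Bit_Operations.and (r a) (r b)), m)"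
| "exec_instr w s n (OrI d a b) pc r m = (Suc pc, r(d := Bit_Operations.or (r a) (r b)), m)"
| "exec_instr w s n (XorI d a b) pc r m = (Suc pc, r(d := Bit_Operations.xor (r a) (r b)), m)"
| "exec_instr w s n (Load d a) pc r m = (Suc pc, r(d := word_at w m (r a)), m)"
| "exec_instr w s n (Store a b) pc r m = (Suc pc, r, store_word w m (r a) (r b))"
| "exec_instr w s n (Jz a t) pc r m = (if r a = 0 then t else Suc pc, r, m)"
| "exec_instr w s n (Jmp t) pc r m = (t, r, m)"

definition step :: "instr list \<Rightarrow> nat \<Rightarrow> (nat \<Rightarrow> nat) \<Rightarrow> nat \<Rightarrow> config \<Rightarrow> config" where
  "step P w s n c = (case c of (pc, r, m) \<Rightarrow>
     if pc < length P then exec_instr w s n (P ! pc) pc r m else c)"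

definition run_op :: "instr list \<Rightarrow> nat \<Rightarrow> (nat \<Rightarrow> nat) \<Rightarrow> nat \<Rightarrow> nat \<Rightarrow> nat \<Rightarrow> mem \<Rightarrow> config" where
  "run_op P w s n T l m = (step P w s n ^^ T) (0, (\<lambda>_. 0)(1 := l), m)"

definition result_of :: "config \<Rightarrow> nat" where "result_of c = fst (snd c) 0"
definition mem_of :: "config \<Rightarrow> mem" where "mem_of c = snd (snd c)"

definition op_ok :: "instr list \<Rightarrow> nat \<Rightarrow> (nat \<Rightarrow> nat) \<Rightarrow> nat \<Rightarrow> nat \<Rightarrow> nat \<Rightarrow> mem \<Rightarrow> bool" where
  "op_ok P w s n T l m = (let c = run_op P w s n T l m in
      length P \<le> fst c \<and> (\<forall>p. n < p \<longrightarrow> mem_of c p = m p))"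

datatype opk = Init | Ins | Del | Cont | Ch

type_synonym prog = "opk \<Rightarrow> instr list"

definition valid_op :: "nat \<Rightarrow> opk \<Rightarrow> nat \<Rightarrow> bool" where
  "valid_op n k l = ((k \<in> {Ins, Del, Cont} \<and> l \<in> {1..n}) \<or> (k = Ch \<and> l = 0))"

fun abs_update :: "opk \<Rightarrow> nat \<Rightarrow> nat set \<Rightarrow> nat set" where
  "abs_update Ins l S = insert l S"
| "abs_update Del l S = S - {l}"
| "abs_update _ l S = S"

fun correct_result :: "opk \<Rightarrow> nat \<Rightarrow> nat set \<Rightarrow> nat \<Rightarrow> bool" where
  "correct_result Cont l S res = (res = (if l \<in> S then 1 else 0))"
| "correct_result Ch l S res = (if S = {} then res = 0 else res \<in> S)"
| "correct_result _ l S res = True"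

text \<open>Reachable quiescent states (abstract client set, memory). Initialization starts from
arbitrary memory content; between operations the memory outside the owned bits 0..n may be
changed arbitrarily by the environment.\<close>
inductive_set reach :: "prog \<Rightarrow> nat \<Rightarrow> (nat \<Rightarrow> nat) \<Rightarrow> nat \<Rightarrow> nat \<Rightarrow> (nat set \<times> mem) set"
  for P w s n T where
  init: "({}, mem_of (run_op (P Init) w s n T 0 m0)) \<in> reach P w s n T"
| upd: "(S, m) \<in> reach P w s n T \<Longrightarrow> (\<forall>p\<le>n. m' p = m p) \<Longrightarrow> valid_op n k l \<Longrightarrow>
        (abs_update k l S, mem_of (run_op (P k) w s n T l m')) \<in> reach P w s n T"

definition choice_dict_ok :: "prog \<Rightarrow> nat \<Rightarrow> nat \<Rightarrow> (nat \<Rightarrow> nat) \<Rightarrow> nat \<Rightarrow> bool" where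
  "choice_dict_ok P T w s n =
     ((\<forall>m0. op_ok (P Init) w s n T 0 m0) \<and>
      (\<forall>S m. (S, m) \<in> reach P w s n T \<longrightarrow>
         (\<forall>m' k l. (\<forall>p\<le>n. m' p = m p) \<longrightarrow> valid_op n k l \<longrightarrow>
            op_ok (P k) w s n T l m' \<and>
            correct_result k l S (result_of (run_op (P k) w s n T l m')))))"

text \<open>Transient space: all programs use only registers 0..R-1, i.e. at most R*w bits.\<close>
definition uses_regs_below :: "prog \<Rightarrow> nat \<Rightarrow> bool" where
  "uses_regs_below P R = (\<forall>k. \<forall>ins \<in> set (P k). \<forall>x \<in> set (regs_of ins). x < R)"

end

theory Submission
  imports Defs "HOL-Library.Nat_Bijection"
begin

text \<open>The bit vector of S is cut into N blocks of three words. With k the number of nonempty blocks,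
the k blocks to the left of the barrier would all be nonempty if the nonempty blocks came first; in
general, every empty left block is matched with a nonempty right block. The six words of such a pair
hold two pointers, the three words of the nonempty block and one free word. Right blocks may hold
arbitrary junk, so initialization just sets k = 0, and block 0 or its mate is nonempty as soon as
k > 0. The barrier k itself lives in the free word of the last block, and the one extra bit tells
whether k < N. An element of a nonempty block is located by isolating the lowest bit 2 ^ i of a word
and computing i by divisions by 2 ^ g - 1 with g proportional to the square root of w. Every
operation is built from the constant-time word operations by composition and case distinction,
hence is computed by jump-free code.\<close>

text \<open>A pair of m-word blocks spends two words on pointers and m on content, so m = 3 is the
  least size that leaves a word for the barrier. For k = N there is no right block and hence no free
  word; this is the case that the extra bit singles out. Tolerating junk makes initialization cheap,
  but it is also the main hazard: stale words may look like pointers, and moving the barrier or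
  overwriting a block can turn them into an apparent match. Much of the work on blocks shows that no
  match arises or vanishes by accident. The second obstacle is uniformity: one program must serve
  all w and n, and w itself cannot be loaded. The index computation therefore refers only to g;
  applied to the highest bit of a word it also yields w. It needs g to be small compared with w and
  2 ^ g to be large, which is guaranteed only from some word length on. That threshold depends only
  on the constant c, so the finitely many smaller word lengths can be served by tables inside the
  same program.\<close>

section \<open>Words and bits\<close>

lemma bit_sum_pow2:
  assumes "finite A"
  shows "bit (\<Sum>i\<in>A. 2 ^ i :: nat) k \<longleftrightarrow> k \<in> A"
proof -
  have "k \<in> set_decode (set_encode A) \<longleftrightarrow> k \<in> A"
    using assms by simp
  then show ?thesis
    by (simp add: set_decode_def set_encode_def bit_iff_odd)
qed

lemma word_at_eq_sum: "word_at w m j = (\<Sum>i | i < w \<and> m (j * w + i). 2 ^ i)"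
  unfolding word_at_def by (rule sum.inter_filter[symmetric, of "{..<w}", simplified])

lemma bit_word_at: "bit (word_at w m j) i \<longleftrightarrow> i < w \<and> m (j * w + i)"
  unfolding word_at_eq_sum by (subst bit_sum_pow2) auto

lemma less_pow2_iff_bits: "x < 2 ^ w \<longleftrightarrow> (\<forall>i\<ge>w. \<not> bit (x::nat) i)"
proof
  assume "x < 2 ^ w"
  then have "take_bit w x = x" by (simp add: take_bit_eq_mod)
  then show "\<forall>i\<ge>w. \<not> bit x i" by (metis bit_take_bit_iff not_le)
next
  assume "\<forall>i\<ge>w. \<not> bit x i"
  then have "take_bit w x = x" by (intro bit_eqI) (auto simp: bit_take_bit_iff, meson not_le)
  then show "x < 2 ^ w" by (metis take_bit_nat_less_exp)
qed

lemma word_at_less: "word_at w m j < 2 ^ w"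
  by (simp add: less_pow2_iff_bits bit_word_at)

text \<open>Links the bit memory to the view used from here on: a sequence of words in which a store
  is a function update. A store keeps only the \<open>w\<close> low bits, hence the bound on
  \<open>v\<close>.\<close>

lemma word_at_store_word:
  assumes "v < 2 ^ w"
  shows "word_at w (store_word w m j v) = (word_at w m)(j := v)"
proof (rule ext, rule bit_eqI)
  fix i k
  have "j * w \<le> i * w + k \<and> i * w + k < j * w + w \<longleftrightarrow> i = j" if "k < w"
  proof
    assume *: "j * w \<le> i * w + k \<and> i * w + k < j * w + w"
    have "(i * w + k) div w = i" using that by simp
    moreover have "(i * w + k) div w = j"
      by (rule div_nat_eqI) (use * in \<open>auto simp: algebra_simps\<close>)
    ultimately show "i = j" by simp
  qed (use that in auto)
  then show "bit (word_at w (store_word w m j v) i) k = bit (((word_at w m)(j := v)) i) k"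
    using assms by (auto simp: bit_word_at store_word_def less_pow2_iff_bits not_less)
qed

section \<open>Jump-free code\<close>

datatype bop = BAdd | BSub | BMul | BDiv | BShl | BShr | BAnd | BOr | BXor

datatype exp = Arg | NE | Sq | Const nat | Ld exp | Bin bop exp exp

text \<open>The input of an operation: word length, approximation of its square root, universe size,
argument, and the memory as a sequence of words.\<close>

datatype ctx = Ctx (cw: nat) (cs: nat) (cn: nat) (cl: nat) (cW: "nat \<Rightarrow> nat")

fun bop_val :: "bop \<Rightarrow> nat \<Rightarrow> nat \<Rightarrow> nat \<Rightarrow> nat" where
  "bop_val BAdd w x y = (x + y) mod 2 ^ w"
| "bop_val BSub w x y = nat ((int x - int y) mod 2 ^ w)"
| "bop_val BMul w x y = (x * y) mod 2 ^ w"
| "bop_val BDiv w x y = x div y"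
| "bop_val BShl w x y = (x * 2 ^ y) mod 2 ^ w"
| "bop_val BShr w x y = x div 2 ^ y"
| "bop_val BAnd w x y = Bit_Operations.and x y"
| "bop_val BOr w x y = Bit_Operations.or x y"
| "bop_val BXor w x y = Bit_Operations.xor x y"

fun bop_instr :: "bop \<Rightarrow> nat \<Rightarrow> nat \<Rightarrow> nat \<Rightarrow> instr" where
  "bop_instr BAdd = Add"
| "bop_instr BSub = Sub"
| "bop_instr BMul = Mul"
| "bop_instr BDiv = Div"
| "bop_instr BShl = Shl"
| "bop_instr BShr = Shr"
| "bop_instr BAnd = AndI"
| "bop_instr BOr = OrI"
| "bop_instr BXor = XorI"

fun eval :: "exp \<Rightarrow> ctx \<Rightarrow> nat" where
  "eval Arg c = cl c"
| "eval NE c = cn c mod 2 ^ cw c"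
| "eval Sq c = cs c mod 2 ^ cw c"
| "eval (Const k) c = k mod 2 ^ cw c"
| "eval (Ld e) c = cW c (eval e c)"
| "eval (Bin b e f) c = bop_val b (cw c) (eval e c) (eval f c)"

text \<open>Stack discipline: the value ends up in register \<open>d\<close>, temporaries lie above
  \<open>d\<close>, and everything below survives. Register 1 holds the argument;
  \<open>OrI d 1 1\<close> serves as a move instruction.\<close>

fun compile_exp :: "exp \<Rightarrow> nat \<Rightarrow> instr list" where
  "compile_exp Arg d = [OrI d 1 1]"
| "compile_exp NE d = [LoadN d]"
| "compile_exp Sq d = [LoadSqrtW d]"
| "compile_exp (Const k) d = [LoadConst d k]"
| "compile_exp (Ld e) d = compile_exp e d @ [Load d d]"
| "compile_exp (Bin b e f) d = compile_exp e d @ compile_exp f (Suc d) @ [bop_instr b d d (Suc d)]"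

fun straight :: "instr \<Rightarrow> bool" where
  "straight (Jz _ _) = False"
| "straight (Jmp _) = False"
| "straight _ = True"

lemma straight_bop [simp]: "straight (bop_instr b x y z)"
  by (cases b) auto

text \<open>The program counter 0 is a dummy, since jump-free instructions only increment the
  counter.\<close>

definition run1 :: "nat \<Rightarrow> (nat \<Rightarrow> nat) \<Rightarrow> nat \<Rightarrow> instr \<Rightarrow> (nat \<Rightarrow> nat) \<times> mem \<Rightarrow> (nat \<Rightarrow> nat) \<times> mem" where
  "run1 w s n i = (\<lambda>(r, m). snd (exec_instr w s n i 0 r m))"

definition run_code :: "nat \<Rightarrow> (nat \<Rightarrow> nat) \<Rightarrow> nat \<Rightarrow> instr list \<Rightarrow> (nat \<Rightarrow> nat) \<times> mem \<Rightarrow> (nat \<Rightarrow> nat) \<times> mem" where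
  "run_code w s n is = fold (run1 w s n) is"

lemma run_code_append [simp]:
  "run_code w s n (is @ js) rm = run_code w s n js (run_code w s n is rm)"
  by (simp add: run_code_def)

lemma run_code_Nil [simp]: "run_code w s n [] rm = rm"
  by (simp add: run_code_def)

lemma run_code_Cons: "run_code w s n (i # is) rm = run_code w s n is (run1 w s n i rm)"
  by (simp add: run_code_def)

lemma exec_straight:
  assumes "straight i"
  shows "exec_instr w s n i pc r m = (Suc pc, run1 w s n i (r, m))"
  using assms by (cases i) (auto simp: run1_def)

lemma step_straight:
  assumes "list_all straight P"
  shows "k \<le> length P \<Longrightarrow> (step P w s n ^^ k) (0, rm) = (k, run_code w s n (take k P) rm)"
proof (induction k)
  case (Suc k)
  obtain r m where rm: "run_code w s n (take k P) rm = (r, m)" by fastforce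
  have "straight (P ! k)" using assms Suc.prems by (simp add: list_all_length)
  then show ?case using Suc rm
    by (simp add: step_def take_Suc_conv_app_nth exec_straight run_code_Cons)
qed simp

lemma step_halted: "length P \<le> pc \<Longrightarrow> (step P w s n ^^ k) (pc, rm) = (pc, rm)"
  by (induction k) (auto simp: step_def split: prod.splits)

lemma run_op_straight:
  assumes "list_all straight P" "length P \<le> T"
  shows "run_op P w s n T l m = (length P, run_code w s n P ((\<lambda>_. 0)(1 := l), m))"
proof -
  obtain k where T: "T = k + length P" using assms(2) by (metis le_add_diff_inverse2)
  show ?thesis
    unfolding run_op_def T funpow_add o_apply
    by (simp add: step_straight[OF assms(1)] step_halted)
qed

definition ctx_of :: "nat \<Rightarrow> (nat \<Rightarrow> nat) \<Rightarrow> nat \<Rightarrow> nat \<Rightarrow> mem \<Rightarrow> ctx" where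
  "ctx_of w s n l m = Ctx w (s w) n l (word_at w m)"

lemma straight_compile_exp: "list_all straight (compile_exp e d)"
  by (induction e arbitrary: d) auto

lemma run_compile_exp:
  assumes "1 < d" "r 1 = l"
  shows "\<exists>r'. run_code w s n (compile_exp e d) (r, m) = (r', m) \<and>
           r' d = eval e (ctx_of w s n l m) \<and> (\<forall>x<d. r' x = r x)"
  using assms
proof (induction e arbitrary: d r)
  case (Ld e)
  from Ld.IH[of d r, OF Ld.prems] show ?case
    by (fastforce simp: run_code_Cons run1_def ctx_of_def)
next
  case (Bin b e f)
  from Bin.IH(1)[of d r, OF Bin.prems] obtain r1 where r1:
    "run_code w s n (compile_exp e d) (r, m) = (r1, m)" "r1 d = eval e (ctx_of w s n l m)"
    "\<forall>x<d. r1 x = r x" by blast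
  with Bin.prems have "1 < Suc d" "r1 1 = l" by auto
  from Bin.IH(2)[of "Suc d" r1, OF this] obtain r2 where r2:
    "run_code w s n (compile_exp f (Suc d)) (r1, m) = (r2, m)"
    "r2 (Suc d) = eval f (ctx_of w s n l m)"
    "\<forall>x<Suc d. r2 x = r1 x" by blast
  have "\<exists>r'. run1 w s n (bop_instr b d d (Suc d)) (r2, m) = (r', m) \<and>
          r' d = bop_val b w (r2 d) (r2 (Suc d)) \<and> (\<forall>x<d. r' x = r2 x)"
    by (cases b) (auto simp: run1_def)
  with r1 r2 show ?case by (fastforce simp: run_code_Cons ctx_of_def)
qed (auto simp: run_code_Cons run1_def ctx_of_def)

text \<open>Every operation maps words to words, including division by 0, which yields 0. This
  supplies the bound that \<open>word_at_store_word\<close> asks for.\<close>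

lemma eval_less:
  assumes "0 < cw c" "cl c < 2 ^ cw c" "\<And>j. cW c j < 2 ^ cw c"
  shows "eval e c < 2 ^ cw c"
proof (induction e)
  case (Bin b e f)
  have "x div y < 2 ^ cw c" if "x < 2 ^ cw c" for x y :: nat
    using that by (meson div_le_dividend le_less_trans)
  moreover have "nat (x mod 2 ^ cw c) < 2 ^ cw c" for x
    by (simp add: nat_less_iff)
  ultimately show ?case using Bin
    by (cases b) (simp_all, simp_all add: less_pow2_iff_bits bit_simps)
qed (use assms in auto)

text \<open>All addresses and values of a list of stores refer to the memory before the first store;
the last element of the list is stored first.\<close>

fun stored :: "(exp \<times> exp) list \<Rightarrow> ctx \<Rightarrow> nat \<Rightarrow> nat" where
  "stored [] c = cW c"
| "stored ((a, v) # ps) c = (stored ps c)(eval a c := eval v c)"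

text \<open>All addresses and values are computed into consecutive registers before the first store
  is executed; this is why they may refer to the old memory throughout.\<close>

fun compile_args :: "(exp \<times> exp) list \<Rightarrow> nat \<Rightarrow> instr list" where
  "compile_args [] d = []"
| "compile_args ((a, v) # ps) d = compile_exp a d @ compile_exp v (Suc d) @ compile_args ps (Suc (Suc d))"

fun compile_stores :: "(exp \<times> exp) list \<Rightarrow> nat \<Rightarrow> instr list" where
  "compile_stores [] d = []"
| "compile_stores (p # ps) d = compile_stores ps (Suc (Suc d)) @ [Store d (Suc d)]"

text \<open>The result is moved to register 0, where it is expected, because the arguments of the
  stores reuse the registers from 2 on.\<close>

definition compile_op :: "exp \<Rightarrow> (exp \<times> exp) list \<Rightarrow> instr list" where
  "compile_op e ps = compile_exp e 2 @ [OrI 0 2 2] @ compile_args ps 2 @ compile_stores ps 2"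

lemma straight_compile_op: "list_all straight (compile_op e ps)"
proof -
  have "list_all straight (compile_args ps d)" for d
    by (induction ps d rule: compile_args.induct) (auto simp: straight_compile_exp)
  moreover have "list_all straight (compile_stores ps d)" for d
    by (induction ps arbitrary: d) auto
  ultimately show ?thesis by (auto simp: compile_op_def straight_compile_exp)
qed

definition args_at :: "(exp \<times> exp) list \<Rightarrow> nat \<Rightarrow> (nat \<Rightarrow> nat) \<Rightarrow> ctx \<Rightarrow> bool" where
  "args_at ps d r c \<longleftrightarrow>
     (\<forall>i<length ps. r (d + 2 * i) = eval (fst (ps ! i)) c \<and> r (Suc (d + 2 * i)) = eval (snd (ps ! i)) c)"

lemma args_at_Cons:
  "args_at ((a, v) # ps) d r c \<longleftrightarrow>
     r d = eval a c \<and> r (Suc d) = eval v c \<and> args_at ps (Suc (Suc d)) r c"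
  unfolding args_at_def by (auto simp: less_Suc_eq_0_disj)

lemma run_compile_args:
  assumes "1 < d" "r 1 = l"
  shows "\<exists>r'. run_code w s n (compile_args ps d) (r, m) = (r', m) \<and>
           args_at ps d r' (ctx_of w s n l m) \<and> (\<forall>x<d. r' x = r x)"
  using assms
proof (induction ps d arbitrary: r rule: compile_args.induct)
  case (1 d)
  then show ?case by (simp add: args_at_def)
next
  case (2 a v ps d)
  from run_compile_exp[of d r l, OF "2.prems"] obtain r1 where r1:
    "run_code w s n (compile_exp a d) (r, m) = (r1, m)" "r1 d = eval a (ctx_of w s n l m)"
    "\<forall>x<d. r1 x = r x" by blast
  with 2 have "1 < Suc d" "r1 1 = l" by auto
  from run_compile_exp[of "Suc d" r1 l, OF this] obtain r2 where r2:
    "run_code w s n (compile_exp v (Suc d)) (r1, m) = (r2, m)"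
    "r2 (Suc d) = eval v (ctx_of w s n l m)"
    "\<forall>x<Suc d. r2 x = r1 x" by blast
  with 2 r1 have "1 < Suc (Suc d)" "r2 1 = l" by auto
  from "2.IH"[of r2, OF this] obtain r3 where r3:
    "run_code w s n (compile_args ps (Suc (Suc d))) (r2, m) = (r3, m)"
    "args_at ps (Suc (Suc d)) r3 (ctx_of w s n l m)"
    "\<forall>x<Suc (Suc d). r3 x = r2 x" by blast
  show ?case
    by (rule exI[of _ r3]) (use r1 r2 r3 in \<open>auto simp: args_at_Cons\<close>)
qed

lemma run_compile_stores:
  assumes "args_at ps d r (ctx_of w s n l m)" "0 < w" "l < 2 ^ w"
  shows "\<exists>m'. run_code w s n (compile_stores ps d) (r, m) = (r, m') \<and>
           word_at w m' = stored ps (ctx_of w s n l m)"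
  using assms(1)
proof (induction ps arbitrary: d)
  case Nil
  then show ?case by (simp add: ctx_of_def)
next
  case (Cons p ps)
  obtain a v where p: "p = (a, v)" by fastforce
  from Cons obtain m' where m': "run_code w s n (compile_stores ps (Suc (Suc d))) (r, m) = (r, m')"
    "word_at w m' = stored ps (ctx_of w s n l m)"
    unfolding p args_at_Cons by blast
  have "eval v (ctx_of w s n l m) < 2 ^ w"
    using eval_less[of "ctx_of w s n l m" v] assms(2,3) by (simp add: ctx_of_def word_at_less)
  then show ?case
    using m' Cons.prems unfolding p args_at_Cons
    by (auto simp: run_code_Cons run1_def word_at_store_word)
qed

lemma run_compile_op:
  fixes m :: mem and s :: "nat \<Rightarrow> nat" and n :: nat
  assumes "length (compile_op e ps) \<le> T" "0 < w" "l < 2 ^ w"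
  defines "c \<equiv> run_op (compile_op e ps) w s n T l m"
  shows "fst c = length (compile_op e ps)"
    "result_of c = eval e (ctx_of w s n l m)"
    "word_at w (mem_of c) = stored ps (ctx_of w s n l m)"
proof -
  let ?r = "(\<lambda>_. 0)(1 := l) :: nat \<Rightarrow> nat"
  have "1 < (2::nat)" "?r 1 = l" by auto
  from run_compile_exp[of 2 ?r l, OF this] obtain r1 where r1:
    "run_code w s n (compile_exp e 2) (?r, m) = (r1, m)" "r1 2 = eval e (ctx_of w s n l m)"
    "\<forall>x<2. r1 x = ?r x" by blast
  have "1 < (2::nat)" "(r1(0 := r1 2)) 1 = l" using r1 by auto
  from run_compile_args[of 2 "r1(0 := r1 2)" l, OF this] obtain r2 where r2:
    "run_code w s n (compile_args ps 2) (r1(0 := r1 2), m) = (r2, m)"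
    "args_at ps 2 r2 (ctx_of w s n l m)" "\<forall>x<2. r2 x = (r1(0 := r1 2)) x" by blast
  from run_compile_stores[OF r2(2) assms(2,3)] obtain m' where
    "run_code w s n (compile_stores ps 2) (r2, m) = (r2, m')"
    "word_at w m' = stored ps (ctx_of w s n l m)" by blast
  then have "c = (length (compile_op e ps), r2, m')"
    "word_at w m' = stored ps (ctx_of w s n l m)" "r2 0 = r1 2"
    unfolding c_def run_op_straight[OF straight_compile_op assms(1)] using r1 r2
    by (auto simp: compile_op_def run_code_Cons run1_def)
  then show "fst c = length (compile_op e ps)" "result_of c = eval e (ctx_of w s n l m)"
    "word_at w (mem_of c) = stored ps (ctx_of w s n l m)"
    using r1 by (auto simp: result_of_def mem_of_def)
qed

section \<open>Functions computable by jump-free code\<close>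

definition ok_ctx :: "ctx set" where
  "ok_ctx = {c. 0 < cw c \<and> cn c < 2 ^ cw c \<and> cl c < 2 ^ cw c \<and>
                (\<forall>j. cW c j < 2 ^ cw c)}"

text \<open>A single expression has to serve all of \<open>D\<close>, uniformly in the word length
  and the universe size. Its code has a fixed length, so computability means constant time.\<close>

definition computable :: "ctx set \<Rightarrow> (ctx \<Rightarrow> nat) \<Rightarrow> bool" where
  "computable D f \<longleftrightarrow> D \<subseteq> ok_ctx \<and> (\<exists>e. \<forall>c\<in>D. eval e c = f c)"

definition computableP :: "ctx set \<Rightarrow> (ctx \<Rightarrow> bool) \<Rightarrow> bool" where
  "computableP D P \<longleftrightarrow> computable D (\<lambda>c. of_bool (P c))"

lemma compI: "D \<subseteq> ok_ctx \<Longrightarrow> (\<And>c. c \<in> D \<Longrightarrow> eval e c = f c) \<Longrightarrow> computable D f"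
  unfolding computable_def by blast

lemma comp_cong: "computable D f \<Longrightarrow> (\<And>c. c \<in> D \<Longrightarrow> f c = g c) \<Longrightarrow> computable D g"
  unfolding computable_def by auto

lemma compP_cong: "computableP D f \<Longrightarrow> (\<And>c. c \<in> D \<Longrightarrow> f c = g c) \<Longrightarrow> computableP D g"
  unfolding computableP_def by (erule comp_cong) simp

lemma comp_less: "computable D f \<Longrightarrow> c \<in> D \<Longrightarrow> f c < 2 ^ cw c"
proof -
  assume *: "computable D f" "c \<in> D"
  then obtain e where e: "eval e c = f c" by (auto simp: computable_def)
  from * have "c \<in> ok_ctx" by (auto simp: computable_def)
  then have "0 < cw c" "cl c < 2 ^ cw c" "\<And>j. cW c j < 2 ^ cw c" by (simp_all add: ok_ctx_def)
  from eval_less[OF this, of e] e show "f c < 2 ^ cw c" by simp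
qed

lemma comp_ok: "computable D f \<Longrightarrow> D \<subseteq> ok_ctx"
  unfolding computable_def by blast

lemma comp_bin:
  assumes "computable D f" "computable D g"
  shows "computable D (\<lambda>c. bop_val b (cw c) (f c) (g c))"
proof -
  from assms obtain e e' where "\<forall>c\<in>D. eval e c = f c" "\<forall>c\<in>D. eval e' c = g c"
    unfolding computable_def by blast
  then show ?thesis using comp_ok[OF assms(1)] by (intro compI[of D "Bin b e e'"]) auto
qed

lemma comp_const: "D \<subseteq> ok_ctx \<Longrightarrow> computable D (\<lambda>c. k mod 2 ^ cw c)"
  by (rule compI[of _ "Const k"]) auto

lemma ok_ctx_pos: "D \<subseteq> ok_ctx \<Longrightarrow> c \<in> D \<Longrightarrow> 0 < cw c"
  by (auto simp: ok_ctx_def)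

lemma comp_const_less:
  "D \<subseteq> ok_ctx \<Longrightarrow> (\<And>c. c \<in> D \<Longrightarrow> k < 2 ^ cw c) \<Longrightarrow> computable D (\<lambda>c. k)"
  by (rule comp_cong[OF comp_const[of D k]]) auto

lemma comp_0: "D \<subseteq> ok_ctx \<Longrightarrow> computable D (\<lambda>c. 0)"
  by (rule comp_const_less) auto

lemma comp_1: "D \<subseteq> ok_ctx \<Longrightarrow> computable D (\<lambda>c. 1)"
  by (rule comp_const_less, assumption) (rule one_less_power, simp, rule ok_ctx_pos)

lemma comp_Suc_0: "D \<subseteq> ok_ctx \<Longrightarrow> computable D (\<lambda>c. Suc 0)"
  using comp_1 by simp

lemma comp_cs: "D \<subseteq> ok_ctx \<Longrightarrow> computable D (\<lambda>c. cs c mod 2 ^ cw c)"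
  by (rule compI[of _ "Sq"]) (auto simp: ok_ctx_def subset_iff)

lemma comp_cn: "D \<subseteq> ok_ctx \<Longrightarrow> computable D cn"
  by (rule compI[of _ "NE"]) (auto simp: ok_ctx_def subset_iff)

lemma comp_cl: "D \<subseteq> ok_ctx \<Longrightarrow> computable D cl"
  by (rule compI[of _ "Arg"]) (auto simp: ok_ctx_def subset_iff)

lemma comp_add: "computable D f \<Longrightarrow> computable D g \<Longrightarrow> computable D (\<lambda>c. (f c + g c) mod 2 ^ cw c)"
  using comp_bin[of D f g BAdd] by simp

lemma comp_mult: "computable D f \<Longrightarrow> computable D g \<Longrightarrow> computable D (\<lambda>c. (f c * g c) mod 2 ^ cw c)"
  using comp_bin[of D f g BMul] by simp

lemma comp_shl: "computable D f \<Longrightarrow> computable D g \<Longrightarrow> computable D (\<lambda>c. (f c * 2 ^ g c) mod 2 ^ cw c)"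
  using comp_bin[of D f g BShl] by simp

lemma comp_shr: "computable D f \<Longrightarrow> computable D g \<Longrightarrow> computable D (\<lambda>c. f c div 2 ^ g c)"
  using comp_bin[of D f g BShr] by simp

lemma comp_and: "computable D f \<Longrightarrow> computable D g \<Longrightarrow> computable D (\<lambda>c. Bit_Operations.and (f c) (g c))"
  using comp_bin[of D f g BAnd] by simp

lemma comp_or: "computable D f \<Longrightarrow> computable D g \<Longrightarrow> computable D (\<lambda>c. Bit_Operations.or (f c) (g c))"
  using comp_bin[of D f g BOr] by simp

lemma comp_xor: "computable D f \<Longrightarrow> computable D g \<Longrightarrow> computable D (\<lambda>c. Bit_Operations.xor (f c) (g c))"
  using comp_bin[of D f g BXor] by simp

lemma comp_pow2: "computable D f \<Longrightarrow> computable D (\<lambda>c. 2 ^ f c mod 2 ^ cw c)"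
  using comp_shl[OF comp_1[OF comp_ok], of D f f] by simp

lemma compP_eq_0: "computable D f \<Longrightarrow> computableP D (\<lambda>c. f c = 0)"
  unfolding computableP_def
  by (rule comp_cong[OF comp_shr[OF comp_1[OF comp_ok]]]) (auto simp: div_eq_0_iff simp flip: One_nat_def intro: one_less_power)

lemma compP_not: "computableP D P \<Longrightarrow> computableP D (\<lambda>c. \<not> P c)"
  unfolding computableP_def[of D P]
  by (drule compP_eq_0, erule compP_cong) auto

text \<open>Instead of branching, the code evaluates both alternatives and masks one of them; the
condition x = 0 is computed as the right shift of 1 by x.\<close>

lemma comp_if:
  assumes "computableP D P" "computable D f" "computable D g"
  shows "computable D (\<lambda>c. if P c then f c else g c)"
proof -
  have "computable D (\<lambda>c. of_bool (\<not> P c))" "computable D (\<lambda>c. of_bool (P c))"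
    using assms(1) compP_not[OF assms(1)] by (simp_all add: computableP_def)
  from comp_add[OF comp_mult[OF this(2) assms(2)] comp_mult[OF this(1) assms(3)]]
  show ?thesis by (rule comp_cong) (use assms comp_less in auto)
qed

lemma compP_if: "computableP D P \<Longrightarrow> computableP D f \<Longrightarrow> computableP D g \<Longrightarrow> computableP D (\<lambda>c. if P c then f c else g c)"
  unfolding computableP_def[of D f] computableP_def[of D g] computableP_def[of D "\<lambda>c. if P c then f c else g c"]
  by (drule (2) comp_if, erule comp_cong) auto

lemma compP_False: "D \<subseteq> ok_ctx \<Longrightarrow> computableP D (\<lambda>_. False)"
  by (simp add: computableP_def comp_0)

lemma compP_True: "D \<subseteq> ok_ctx \<Longrightarrow> computableP D (\<lambda>_. True)"
  using comp_1 by (simp add: computableP_def)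

lemma compP_D: "computableP D P \<Longrightarrow> D \<subseteq> ok_ctx"
  by (simp add: computableP_def comp_ok)

lemma compP_conj: "computableP D P \<Longrightarrow> computableP D Q \<Longrightarrow> computableP D (\<lambda>c. P c \<and> Q c)"
  by (rule compP_cong[OF compP_if[OF _ _ compP_False[OF compP_D], of D P Q P]]) auto

lemma compP_disj: "computableP D P \<Longrightarrow> computableP D Q \<Longrightarrow> computableP D (\<lambda>c. P c \<or> Q c)"
  by (rule compP_cong[OF compP_if[OF _ compP_True[OF compP_D], of D P P Q]]) auto

lemma comp_of_bool: "computableP D P \<Longrightarrow> computable D (\<lambda>c. of_bool (P c))"
  by (simp add: computableP_def)

text \<open>The divisor is replaced by 1 if it is 0, so that the code never divides by 0.\<close>

lemma comp_div:
  assumes "computable D f" "computable D g"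
  shows "computable D (\<lambda>c. f c div g c)"
proof -
  have ok: "D \<subseteq> ok_ctx" using assms comp_ok by blast
  have "computable D (\<lambda>c. f c div (if g c = 0 then 1 else g c))"
    using comp_bin[OF assms(1) comp_if[OF compP_eq_0[OF assms(2)] comp_1[OF ok] assms(2)], of BDiv]
    by simp
  from comp_if[OF compP_eq_0[OF assms(2)] comp_0[OF ok] this]
  show ?thesis by (rule comp_cong) auto
qed

text \<open>The machine has no comparison instruction, but a quotient by a nonzero divisor vanishes
  exactly if the dividend is smaller.\<close>

lemma compP_less:
  assumes "computable D f" "computable D g"
  shows "computableP D (\<lambda>c. f c < g c)"
  by (rule compP_cong[OF compP_conj[OF compP_not[OF compP_eq_0[OF assms(2)]]
        compP_eq_0[OF comp_div[OF assms]]]]) (auto simp: div_eq_0_iff)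

lemma compP_le: "computable D f \<Longrightarrow> computable D g \<Longrightarrow> computableP D (\<lambda>c. f c \<le> g c)"
  using compP_not[OF compP_less[of D g f]] by (simp add: not_less)

lemma compP_eq:
  assumes "computable D f" "computable D g"
  shows "computableP D (\<lambda>c. f c = g c)"
  by (rule compP_cong[OF compP_conj[OF compP_le[OF assms] compP_le[OF assms(2,1)]]]) auto

lemma comp_diff:
  assumes "computable D f" "computable D g"
  shows "computable D (\<lambda>c. f c - g c)"
proof -
  have "computable D (\<lambda>c. nat ((int (f c) - int (g c)) mod 2 ^ cw c))"
    using comp_bin[OF assms, of BSub] by simp
  from comp_if[OF compP_less[OF assms] comp_0[OF comp_ok[OF assms(1)]] this]
  show ?thesis
  proof (rule comp_cong)
    fix c assume "c \<in> D"
    with comp_less[OF assms(1)] have "f c < 2 ^ cw c" .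
    then have "int (f c - g c) < int (2 ^ cw c)" unfolding of_nat_less_iff by simp
    then have "int (f c - g c) mod 2 ^ cw c = int (f c - g c)" by simp
    then show "(if f c < g c then 0 else nat ((int (f c) - int (g c)) mod 2 ^ cw c)) = f c - g c"
      by (auto simp flip: of_nat_diff)
  qed
qed

lemma comp_mod:
  assumes "computable D f" "computable D g"
  shows "computable D (\<lambda>c. f c mod g c)"
proof -
  from comp_diff[OF assms(1) comp_mult[OF assms(2) comp_div[OF assms]]]
  show ?thesis
  proof (rule comp_cong)
    fix c assume "c \<in> D"
    with comp_less[OF assms(1)] have "f c < 2 ^ cw c" .
    then have "g c * (f c div g c) < 2 ^ cw c" by (meson le_less_trans times_div_less_eq_dividend)
    then show "f c - g c * (f c div g c) mod 2 ^ cw c = f c mod g c"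
      by (simp add: minus_mult_div_eq_mod)
  qed
qed

text \<open>Asking for the body with an arbitrary computable \<open>F\<close> keeps the bound term
  opaque, so that it is analysed once and not at each of its occurrences.\<close>

lemma comp_let:
  assumes "computable D f" "\<And>F. computable D F \<Longrightarrow> computable D (\<lambda>c. G c (F c))"
  shows "computable D (\<lambda>c. let x = f c in G c x)"
  using assms by (simp add: Let_def)

lemma compP_bit:
  assumes "computable D f" "computable D g"
  shows "computableP D (\<lambda>c. bit (f c) (g c))"
  unfolding computableP_def
  using comp_and[OF comp_shr[OF assms] comp_1[OF comp_ok[OF assms(1)]]]
  by (rule comp_cong) (auto simp: bit_iff_odd and_one_eq mod_2_eq_odd)

text \<open>Named constants for reading and updating give the computability rules a head symbol to
  match.\<close>

definition get :: "(nat \<Rightarrow> nat) \<Rightarrow> nat \<Rightarrow> nat" where "get W a = W a"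

definition put :: "(nat \<Rightarrow> nat) \<Rightarrow> nat \<Rightarrow> nat \<Rightarrow> nat \<Rightarrow> nat" where "put W a v = W(a := v)"

definition computableM :: "ctx set \<Rightarrow> (ctx \<Rightarrow> nat \<Rightarrow> nat) \<Rightarrow> bool" where
  "computableM D M \<longleftrightarrow> D \<subseteq> ok_ctx \<and> (\<exists>ps. \<forall>c\<in>D. stored ps c = M c)"

lemma compM_cong: "computableM D f \<Longrightarrow> (\<And>c. c \<in> D \<Longrightarrow> f c = g c) \<Longrightarrow> computableM D g"
  unfolding computableM_def by auto

lemma compM_ok: "computableM D f \<Longrightarrow> D \<subseteq> ok_ctx"
  by (auto simp: computableM_def)

text \<open>The stores in \<open>ps\<close> are still pending when the value is needed, so the read
  compares its address with each pending address and falls back to the original memory.\<close>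

lemma comp_get:
  assumes "computableM D M" "computable D f"
  shows "computable D (\<lambda>c. get (M c) (f c))"
proof -
  from assms(1) obtain ps where ps: "\<forall>c\<in>D. stored ps c = M c" by (auto simp: computableM_def)
  have ok: "D \<subseteq> ok_ctx" using assms comp_ok by blast
  have "computable D (\<lambda>c. stored ps c (f c))"
  proof (induction ps)
    case Nil
    from assms(2) obtain e where "\<forall>c\<in>D. eval e c = f c" by (auto simp: computable_def)
    then show ?case by (intro compI[of _ "Ld e"]) (use ok in auto)
  next
    case (Cons p ps)
    obtain a v where [simp]: "p = (a, v)" by fastforce
    have "computable D (eval a)" "computable D (eval v)" using ok by (auto intro: compI)
    from comp_if[OF compP_eq[OF assms(2) this(1)] this(2) Cons]
    show ?case by (rule comp_cong) auto
  qed
  then show ?thesis by (rule comp_cong) (use ps in \<open>auto simp: get_def\<close>)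
qed

lemma compM_cW: "D \<subseteq> ok_ctx \<Longrightarrow> computableM D cW"
  unfolding computableM_def by (auto intro!: exI[of _ "[]"])

lemma compM_put:
  assumes "computableM D M" "computable D f" "computable D g"
  shows "computableM D (\<lambda>c. put (M c) (f c) (g c))"
proof -
  from assms obtain ps a v where "\<forall>c\<in>D. stored ps c = M c"
    "\<forall>c\<in>D. eval a c = f c" "\<forall>c\<in>D. eval v c = g c" by (auto simp: computableM_def computable_def)
  then have "\<forall>c\<in>D. stored ((a, v) # ps) c = put (M c) (f c) (g c)" by (auto simp: put_def)
  then show ?thesis unfolding computableM_def using compM_ok[OF assms(1)] by blast
qed

lemma eval_select:
  assumes "D \<subseteq> ok_ctx"
  shows "\<exists>e. \<forall>c\<in>D. eval e c = (if eval b c = 0 then eval x c else eval y c)"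
proof -
  have "computable D (eval b)" "computable D (eval x)" "computable D (eval y)"
    using assms by (auto intro: compI)
  from comp_if[OF compP_eq_0[OF this(1)] this(2,3)] show ?thesis by (auto simp: computable_def)
qed

text \<open>Jump-free code cannot skip a store. A disabled store instead writes back the value that
  its address would hold at that moment.\<close>

lemma stored_guarded:
  assumes "D \<subseteq> ok_ctx"
  shows "\<exists>ps'. \<forall>c\<in>D. stored ps' c = (if eval b c = 0 then stored (ps @ qs) c else stored qs c)"
proof (induction ps)
  case Nil
  show ?case by auto
next
  case (Cons p ps)
  then obtain ps' where ps':
    "\<forall>c\<in>D. stored ps' c = (if eval b c = 0 then stored (ps @ qs) c else stored qs c)" by blast
  obtain a v where [simp]: "p = (a, v)" by fastforce
  have "computableM D (stored ps')" "computable D (eval a)"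
    using assms by (auto simp: computableM_def intro: compI)
  from comp_get[OF this] obtain rd where "\<forall>c\<in>D. eval rd c = stored ps' c (eval a c)"
    by (auto simp: computable_def get_def)
  moreover obtain v' where "\<forall>c\<in>D. eval v' c = (if eval b c = 0 then eval v c else eval rd c)"
    using eval_select[OF assms] by blast
  ultimately show ?case using ps' by (intro exI[of _ "(a, v') # ps'"]) auto
qed

lemma compM_if:
  assumes "computableP D P" "computableM D M1" "computableM D M2"
  shows "computableM D (\<lambda>c. if P c then M1 c else M2 c)"
proof -
  have ok: "D \<subseteq> ok_ctx" using assms compM_ok by blast
  obtain ps1 ps2 where ps: "\<forall>c\<in>D. stored ps1 c = M1 c" "\<forall>c\<in>D. stored ps2 c = M2 c"
    using assms(2,3) by (auto simp: computableM_def)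
  obtain b b' where b: "\<forall>c\<in>D. eval b c = of_bool (\<not> P c)" "\<forall>c\<in>D. eval b' c = of_bool (P c)"
    using assms(1) compP_not[OF assms(1)] by (auto simp: computable_def computableP_def)
  obtain qs where qs: "\<forall>c\<in>D. stored qs c = (if eval b c = 0 then stored (ps1 @ []) c else stored [] c)"
    using stored_guarded[OF ok] by blast
  obtain rs where rs: "\<forall>c\<in>D. stored rs c = (if eval b' c = 0 then stored (ps2 @ qs) c else stored qs c)"
    using stored_guarded[OF ok] by blast
  have "stored (ps2 @ qs) c = stored ps2 c" if "stored qs c = stored [] c" for c
    using that by (induction ps2) auto
  then have "\<forall>c\<in>D. stored rs c = (if P c then M1 c else M2 c)"
    using ps b qs rs by auto
  then show ?thesis using ok unfolding computableM_def by blast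
qed

lemma compM_let:
  assumes "computable D f" "\<And>F. computable D F \<Longrightarrow> computableM D (\<lambda>c. G c (F c))"
  shows "computableM D (\<lambda>c. let x = f c in G c x)"
  using assms by (simp add: Let_def)

lemma compM_letM:
  assumes "computableM D f" "\<And>F. computableM D F \<Longrightarrow> computableM D (\<lambda>c. G c (F c))"
  shows "computableM D (\<lambda>c. let x = f c in G c x)"
  using assms by (simp add: Let_def)

text \<open>\<open>V\<close> does not depend on the input, so a chain of that many nested
  conditionals selects the right \<open>F v\<close>. The induction peels off the value 0 and shifts
  the others down.\<close>

lemma comp_case_bounded:
  assumes "\<And>v. computable D (F v)" "computable D g" "\<And>c. c \<in> D \<Longrightarrow> g c < V"
  shows "computable D (\<lambda>c. F (g c) c)"
  using assms
proof (induction V arbitrary: F g)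
  case 0
  then have "D = {}" by auto
  then show ?case by (auto simp: computable_def)
next
  case (Suc V)
  have ok: "D \<subseteq> ok_ctx" using Suc.prems comp_ok by blast
  show ?case
  proof (cases "V = 0")
    case True
    show ?thesis
      by (rule comp_cong[OF Suc.prems(1)[of 0]]) (use Suc.prems(3) True in force)
  next
    case False
    have "computable D (\<lambda>c. F (Suc (g c - 1)) c)"
    proof (rule Suc.IH[of "\<lambda>v. F (Suc v)" "\<lambda>c. g c - 1"])
      show "g c - 1 < V" if "c \<in> D" for c using Suc.prems(3)[OF that] False by auto
    qed (intro Suc.prems comp_diff comp_1[OF ok])+
    then have "computable D (\<lambda>c. if g c = 0 then F 0 c else F (Suc (g c - 1)) c)"
      by (intro comp_if compP_eq_0 Suc.prems)
    then show ?thesis by (rule comp_cong) auto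
  qed
qed

text \<open>Table lookup: an arbitrary, even non-constructive, \<open>h\<close> becomes computable
  because a fixed number of arguments with a fixed bound leaves finitely many cases.\<close>

lemma comp_finite_info:
  assumes "D \<subseteq> ok_ctx" "\<And>g. g \<in> set gs \<Longrightarrow> computable D g" "\<And>g c. g \<in> set gs \<Longrightarrow> c \<in> D \<Longrightarrow> g c < V"
  shows "computable D (\<lambda>c. h (map (\<lambda>g. g c) gs) mod 2 ^ cw c)"
  using assms(2,3)
proof (induction gs arbitrary: h)
  case Nil
  then show ?case using comp_const[OF assms(1)] by simp
next
  case (Cons g gs)
  have "computable D (\<lambda>c. h (g c # map (\<lambda>g. g c) gs) mod 2 ^ cw c)"
    by (rule comp_case_bounded[where F = "\<lambda>v c. h (v # map (\<lambda>g. g c) gs) mod 2 ^ cw c"])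
       (rule Cons.IH[where h = "\<lambda>xs. h (v # xs)" for v] Cons.prems; simp add: Cons.prems)+
  then show ?case by simp
qed

section \<open>Chained blocks\<close>

text \<open>Block i consists of the words A i, B i, E i; blocks below the barrier k are called left. An
unmatched left block is nonempty and stores its content verbatim, an unmatched right block is empty
and holds junk. A left i and a right j are matched if they point to each other via A; then i is
empty and the three words of j are B i, E i, E j. The word B j of a right block is thus free.\<close>

definition matched :: "nat \<Rightarrow> nat \<Rightarrow> (nat \<Rightarrow> nat) \<Rightarrow> nat \<Rightarrow> bool" where
  "matched N k A i \<longleftrightarrow> A i < N \<and> A (A i) = i \<and> (A i < k \<longleftrightarrow> \<not> i < k)"

definition mate :: "nat \<Rightarrow> nat \<Rightarrow> (nat \<Rightarrow> nat) \<Rightarrow> nat \<Rightarrow> nat" where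
  "mate N k A i = (if matched N k A i then A i else i)"

definition empty3 :: "nat \<times> nat \<times> nat" where "empty3 = (0, 0, 0)"

definition content :: "nat \<Rightarrow> nat \<Rightarrow> (nat \<Rightarrow> nat) \<Rightarrow> (nat \<Rightarrow> nat) \<Rightarrow> (nat \<Rightarrow> nat) \<Rightarrow> nat \<Rightarrow> nat \<times> nat \<times> nat" where
  "content N k A B E i =
     (if i < k then if matched N k A i then empty3 else (A i, B i, E i)
      else if matched N k A i then (B (A i), E (A i), E i) else empty3)"

text \<open>The equivalence only excludes zero content where \<open>content\<close> reads stored
  words. Matches pair left with right blocks, so \<open>k\<close> is then forced to be the number of
  nonempty blocks.\<close>

definition chain_inv where
  "chain_inv N k A B E \<longleftrightarrow> k \<le> N \<and>
     (\<forall>i<N. content N k A B E i \<noteq> empty3 \<longleftrightarrow> (matched N k A i \<longleftrightarrow> \<not> i < k))"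

lemma mate_less: "i < N \<Longrightarrow> mate N k A i < N"
  by (auto simp: mate_def matched_def)

lemma matched_sym:
  assumes "matched N k A i" "i < N"
  shows "matched N k A (A i)" "A (A i) = i" "A i \<noteq> i" "A i < N" "A i < k \<longleftrightarrow> \<not> i < k"
  using assms by (auto simp: matched_def)

text \<open>A left block x overwritten with new content may point, by accident, to a right block that
points back to x. Making that right block point to itself removes the accidental match.\<close>

definition break_link :: "nat \<Rightarrow> nat \<Rightarrow> nat \<Rightarrow> (nat \<Rightarrow> nat) \<Rightarrow> nat \<Rightarrow> nat" where
  "break_link N k x A = (if A x < N \<and> k \<le> A x \<and> A (A x) = x then A(A x := A x) else A)"

text \<open>A block that points to itself is unmatched, because partners lie on opposite sides of
  the barrier. The redirected block pointed to \<open>x\<close>, so \<open>x\<close> was its only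
  possible partner and no other match is lost.\<close>

lemma matched_break_link:
  fixes A :: "nat \<Rightarrow> nat" and v :: nat
  assumes "x < k" "j < N" "x < N"
  defines "A' \<equiv> break_link N k x (A(x := v))"
  shows "matched N k A' j \<longleftrightarrow> j \<noteq> x \<and> matched N k A j \<and> A j \<noteq> x" "A' x = v"
    "matched N k A' j \<Longrightarrow> A' j = A j" "j < k \<Longrightarrow> j \<noteq> x \<Longrightarrow> A' j = A j"
proof -
  consider "v < N" "k \<le> v" "A v = x" "A' = A(x := v, v := v)"
    | "\<not> (v < N \<and> k \<le> v \<and> A v = x)" "A' = A(x := v)"
    using assms by (force simp: A'_def break_link_def)
  then show "matched N k A' j \<longleftrightarrow> j \<noteq> x \<and> matched N k A j \<and> A j \<noteq> x" "A' x = v"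
    "matched N k A' j \<Longrightarrow> A' j = A j" "j < k \<Longrightarrow> j \<noteq> x \<Longrightarrow> A' j = A j"
  proof (atomize(full), cases)
    case 1
    with assms(1-3) show "((matched N k A' j \<longleftrightarrow> j \<noteq> x \<and> matched N k A j \<and> A j \<noteq> x) \<and> A' x = v) \<and>
       (matched N k A' j \<longrightarrow> A' j = A j) \<and> (j < k \<longrightarrow> j \<noteq> x \<longrightarrow> A' j = A j)"
      unfolding matched_def by (cases "j = x"; cases "j = v"; cases "A j = x"; cases "A j = v") auto
  next
    case 2
    with assms(1-3) show "((matched N k A' j \<longleftrightarrow> j \<noteq> x \<and> matched N k A j \<and> A j \<noteq> x) \<and> A' x = v) \<and>
       (matched N k A' j \<longrightarrow> A' j = A j) \<and> (j < k \<longrightarrow> j \<noteq> x \<longrightarrow> A' j = A j)"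
      unfolding matched_def by (cases "j = x"; cases "A j = x"; cases "v = x") auto
  qed
qed

lemma matched_self:
  assumes "j < N"
  shows "matched N k (A(x := x)) j \<longleftrightarrow> j \<noteq> x \<and> matched N k A j \<and> A j \<noteq> x"
  unfolding matched_def by (cases "j = x"; cases "A j = x") auto

lemma matched_pair:
  assumes "e < k \<longleftrightarrow> \<not> g < k" "g < N" "e < N" "j < N"
  shows "matched N k (A(e := g, g := e)) j \<longleftrightarrow> j = e \<or> j = g \<or> matched N k A j \<and> A j \<noteq> e \<and> A j \<noteq> g"
proof -
  have eg: "e \<noteq> g" using assms by auto
  consider "j = e" | "j = g" | "j \<noteq> e" "j \<noteq> g" by blast
  then show ?thesis
  proof cases
    case 3
    consider "A j = e" | "A j = g" | "A j \<noteq> e" "A j \<noteq> g" by blast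
    then show ?thesis using 3 eg by cases (auto simp: matched_def)
  qed (use assms eg in \<open>auto simp: matched_def\<close>)
qed

lemma matched_Suc:
  "j \<noteq> k \<Longrightarrow> A j \<noteq> k \<Longrightarrow> matched N (Suc k) A j \<longleftrightarrow> matched N k A j"
  unfolding matched_def by (auto simp: less_Suc_eq)

text \<open>To empty block i, the barrier moves to k - 1. After that, block k - 1 or its former mate is
a nonempty right block e and block i or its former mate is an empty left block g, unless e = i.\<close>

definition clearA where
  "clearA N k A i = (let e = mate N k A (k - 1); g = mate N k A i; A1 = A(k - 1 := k - 1)
     in if e \<noteq> i then A1(g := e, e := g) else A1)"
definition clearB where
  "clearB N k A B E i = (let e = mate N k A (k - 1); g = mate N k A i
     in if e \<noteq> i then B(g := fst (content N k A B E e)) else B)"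
definition clearE where
  "clearE N k A B E i = (let e = mate N k A (k - 1); g = mate N k A i; y = content N k A B E e
     in if e \<noteq> i then E(g := fst (snd y), e := snd (snd y)) else E)"

text \<open>Block \<open>k - 1\<close> becomes right. If it was nonempty, it now needs a partner
  itself (\<open>e = k - 1\<close>); otherwise its mate \<open>e\<close> has lost one. Likewise
  emptying \<open>i\<close> leaves exactly one empty left block \<open>g\<close> without partner,
  \<open>i\<close> itself or its old mate. Matching \<open>e\<close> with \<open>g\<close> repairs
  both, and the content of \<open>e\<close> is copied into the words of the new pair. If
  \<open>e = i\<close>, the block in need of a partner is the one being emptied.\<close>

lemma clear_correct:
  assumes chain_inv: "chain_inv N k A B E" and i: "i < N" "content N k A B E i \<noteq> empty3"
  defines "A' \<equiv> clearA N k A i" and "B' \<equiv> clearB N k A B E i" and "E' \<equiv> clearE N k A B E i"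
  shows "0 < k" "\<forall>j<N. content N (k - 1) A' B' E' j = (if j = i then empty3 else content N k A B E j)"
    "chain_inv N (k - 1) A' B' E'"
proof -
  let ?c = "content N k A B E"
  have k: "k \<le> N" and nz: "\<And>j. j < N \<Longrightarrow> ?c j \<noteq> empty3 \<longleftrightarrow> (matched N k A j \<longleftrightarrow> \<not> j < k)"
    using chain_inv by (auto simp: chain_inv_def)
  have mi: "matched N k A i \<longleftrightarrow> \<not> i < k" using nz i by blast
  show k0: "0 < k" using mi by (auto simp: matched_def)
  obtain q where q: "k = Suc q" using k0 by (cases k) auto
  have qN: "q < N" using q k by simp
  define e where "e = mate N k A q"
  define g where "g = mate N k A i"
  have eN: "e < N" and gN: "g < N" using qN i mate_less by (auto simp: e_def g_def)
  have e: "(if matched N k A q then e = A q \<and> A e = q \<and> matched N k A e \<and> k \<le> e else e = q)" "q \<le> e"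
    using matched_sym[of N k A q] qN q by (auto simp: e_def mate_def)
  have g: "(if matched N k A i then g = A i \<and> A g = i \<and> matched N k A g else g = i)" "g < k"
    using matched_sym[of N k A i] i mi by (auto simp: g_def mate_def)
  have *: "content N q A' B' E' j = (if j = i then empty3 else ?c j) \<and>
        (matched N q A' j \<longleftrightarrow> (j < q \<longleftrightarrow> j = i \<or> ?c j = empty3))" if j: "j < N" for j
  proof (cases "e = i")
    case True
    have A': "A' = A(q := q)" "B' = B" "E' = E"
      using True by (auto simp: A'_def B'_def E'_def clearA_def clearB_def clearE_def q Let_def e_def)
    have m': "matched N q A' j \<longleftrightarrow> matched N k A j \<and> j \<noteq> i \<and> j \<noteq> q"
      using matched_self[OF j, of q A q] matched_Suc[of j q A N] matched_sym[of N k A j] e j True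
      unfolding A' q by (metis (no_types, lifting))
    consider "j = i" | "j = q" "j \<noteq> i" | "j \<noteq> q" "j \<noteq> i" by blast
    then have "content N q A' B' E' j = (if j = i then empty3 else ?c j)"
    proof cases
      case 1
      then show ?thesis using m' e True by (simp add: content_def)
    next
      case 2
      then show ?thesis using m' e True q by (simp add: content_def split: if_splits)
    next
      case 3
      then show ?thesis using m' q by (simp add: content_def A' less_Suc_eq)
    qed
    moreover have "j < k \<longleftrightarrow> j < q \<or> j = q" using q by auto
    ultimately show ?thesis using m' e g True mi nz[OF j] nz[OF qN] by (auto split: if_splits)
  next
    case False
    obtain y0 y1 y2 where y: "?c e = (y0, y1, y2)" by (metis prod_cases3)
    have A': "A' = (A(q := q))(g := e, e := g)" "B' = B(g := y0)" "E' = E(g := y1, e := y2)"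
      using False y by (auto simp: A'_def B'_def E'_def clearA_def clearB_def clearE_def q Let_def e_def g_def)
    \<comment> \<open>\<open>g = q\<close> would mean that \<open>i\<close> is \<open>q\<close> or
      its mate, and then \<open>e = i\<close>.\<close>
    have gq: "g < q" using False e g mi q by (auto simp: less_Suc_eq split: if_splits)
    have "matched N q A' j \<longleftrightarrow> j = e \<or> j = g \<or> matched N q (A(q := q)) j \<and> (A(q := q)) j \<noteq> e \<and> (A(q := q)) j \<noteq> g"
      unfolding A' using matched_pair[of g q e N j "A(q := q)"] gq e(2) eN gN j by auto
    also have "\<dots> \<longleftrightarrow> j = e \<or> j = g \<or> j \<noteq> q \<and> matched N k A j \<and> A j \<noteq> q \<and> A j \<noteq> e \<and> A j \<noteq> g"
      using matched_self[OF j, of q A q] matched_Suc[of j q A N] q by auto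
    also have "\<dots> \<longleftrightarrow> j = e \<or> j = g \<or> matched N k A j \<and> j \<noteq> i \<and> j \<noteq> q"
      using matched_sym[of N k A j] j e g by (metis (full_types))
    finally have m': "matched N q A' j \<longleftrightarrow> j = e \<or> j = g \<or> matched N k A j \<and> j \<noteq> i \<and> j \<noteq> q" .
    consider "j = e" | "j = g" "j \<noteq> e" | "j = q" "j \<noteq> e" "j \<noteq> g" | "j = i" "j \<noteq> e" "j \<noteq> g" "j \<noteq> q"
      | "j \<notin> {e, g, q, i}" by blast
    then have "content N q A' B' E' j = (if j = i then empty3 else ?c j)"
    proof cases
      case 1
      then show ?thesis using m' gq e(2) y False by (simp add: content_def[of N q] A')
    next
      case 2
      then show ?thesis using m' gq g mi q by (auto simp: content_def split: if_splits)
    next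
      case 3
      then show ?thesis using m' e q by (auto simp: content_def split: if_splits)
    next
      case 4
      then show ?thesis using m' g mi q by (auto simp: content_def split: if_splits)
    next
      case 5
      then have "matched N q A' j = matched N k A j" "A' j = A j" "B' j = B j" "E' j = E j"
        using m' by (auto simp: A')
      moreover have "A j \<noteq> g" "A j \<noteq> e" if "matched N k A j"
        using matched_sym[of N k A j] j g e 5 that by (metis (full_types) insert_iff)+
      ultimately show ?thesis using 5 q by (auto simp: content_def A' less_Suc_eq)
    qed
    moreover have "j < k \<longleftrightarrow> j < q \<or> j = q" using q by auto
    ultimately show ?thesis using m' e g False mi nz[OF j] nz[OF qN] nz[OF eN] nz[OF gN] q gq i
      by (auto split: if_splits)
  qed
  show "\<forall>j<N. content N (k - 1) A' B' E' j = (if j = i then empty3 else ?c j)"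
    using * q by simp
  show "chain_inv N (k - 1) A' B' E'"
    using * q k i unfolding chain_inv_def by auto
qed

text \<open>Filling the empty block i reverses this: the barrier moves to k + 1, and the empty left
block e is matched with the nonempty right block g, unless g = k.\<close>

definition fillA where
  "fillA N k A B E i v = (let e = mate N k A k; g = mate N k A i; x = content N k A B E k;
     A1 = if e \<noteq> k then break_link N (Suc k) k (A(k := fst x)) else A;
     A2 = if i \<le> k then break_link N (Suc k) i (A1(i := fst v)) else A1
     in if g \<noteq> k then A2(e := g, g := e) else A2)"
definition fillB where
  "fillB N k A B E i v = (let e = mate N k A k; g = mate N k A i; x = content N k A B E k;
     y = if i < k then content N k A B E g else v;
     B1 = if e \<noteq> k then B(k := fst (snd x)) else B;
     B2 = if i \<le> k then B1(i := fst (snd v)) else B1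
     in if g \<noteq> k then B2(e := fst y) else B2)"
definition fillE where
  "fillE N k A B E i v = (let e = mate N k A k; g = mate N k A i; x = content N k A B E k;
     y = if i < k then content N k A B E g else v;
     E1 = if e \<noteq> k then E(k := snd (snd x)) else E;
     E2 = if i \<le> k then E1(i := snd (snd v)) else E1
     in if g \<noteq> k then E2(e := fst (snd y), g := snd (snd y)) else E2)"

text \<open>Block \<open>k\<close> becomes left. If it was nonempty, its content must be written out
  verbatim and its old mate \<open>e\<close> lacks a partner; if it was empty, it lacks one itself.
  A block \<open>i\<close> on the left is written verbatim as well, which frees its nonempty mate
  \<open>g\<close>; an \<open>i\<close> beyond \<open>k\<close> is itself the new \<open>g\<close>.
  Stray links are broken with respect to the new barrier \<open>Suc k\<close>, for which the
  overwritten blocks are left.\<close>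

lemma fill_correct:
  assumes chain_inv: "chain_inv N k A B E" and i: "i < N" "content N k A B E i = empty3" and v: "v \<noteq> empty3"
  defines "A' \<equiv> fillA N k A B E i v" and "B' \<equiv> fillB N k A B E i v" and "E' \<equiv> fillE N k A B E i v"
  shows "k < N" "\<forall>j<N. content N (Suc k) A' B' E' j = (if j = i then v else content N k A B E j)"
    "chain_inv N (Suc k) A' B' E'"
proof -
  let ?c = "content N k A B E"
  have nz: "\<And>j. j < N \<Longrightarrow> ?c j \<noteq> empty3 \<longleftrightarrow> (matched N k A j \<longleftrightarrow> \<not> j < k)"
    using chain_inv by (auto simp: chain_inv_def)
  have mi: "matched N k A i \<longleftrightarrow> i < k" using nz i by blast
  show kN: "k < N" using mi i by (cases "i < k") (auto simp: matched_def)
  define e where "e = mate N k A k"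
  define g where "g = mate N k A i"
  have eN: "e < N" and gN: "g < N" using kN i mate_less by (auto simp: e_def g_def)
  have e: "(if matched N k A k then e = A k \<and> A e = k \<and> matched N k A e \<and> e < k else e = k)"
    using matched_sym[of N k A k] kN by (auto simp: e_def mate_def)
  have g: "(if i < k then g = A i \<and> A g = i \<and> matched N k A g else g = i)" "k \<le> g"
    using matched_sym[of N k A i] i mi by (auto simp: g_def mate_def)
  define A1 where "A1 = (if e \<noteq> k then break_link N (Suc k) k (A(k := fst (?c k))) else A)"
  define A2 where "A2 = (if i \<le> k then break_link N (Suc k) i (A1(i := fst v)) else A1)"
  define y where "y = (if i < k then ?c g else v)"
  have A': "A' = (if g \<noteq> k then A2(e := g, g := e) else A2)"
    by (simp add: A'_def fillA_def Let_def e_def g_def A1_def A2_def)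
  have B': "B' j = (if g \<noteq> k \<and> j = e then fst y else if j = i \<and> i \<le> k then fst (snd v)
      else if e \<noteq> k \<and> j = k then fst (snd (?c k)) else B j)" for j
    by (auto simp: B'_def fillB_def Let_def e_def g_def y_def)
  have E': "E' j = (if g \<noteq> k \<and> j = g then snd (snd y) else if g \<noteq> k \<and> j = e then fst (snd y)
      else if j = i \<and> i \<le> k then snd (snd v)
      else if e \<noteq> k \<and> j = k then snd (snd (?c k)) else E j)" for j
    by (auto simp: E'_def fillE_def Let_def e_def g_def y_def)
  have m1: "matched N (Suc k) A1 j \<longleftrightarrow> (e \<noteq> k \<longrightarrow> j \<noteq> k \<and> A j \<noteq> k) \<and> matched N (Suc k) A j"
      "matched N (Suc k) A1 j \<Longrightarrow> A1 j = A j" if "j < N" for j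
    using matched_break_link[of k "Suc k" j N A "fst (?c k)"] that kN by (auto simp: A1_def)
  have m2: "matched N (Suc k) A2 j \<longleftrightarrow> (i \<le> k \<longrightarrow> j \<noteq> i \<and> A j \<noteq> i) \<and> matched N (Suc k) A1 j"
      "matched N (Suc k) A2 j \<Longrightarrow> A2 j = A j" if "j < N" for j
    using matched_break_link[of i "Suc k" j N A1 "fst v"] m1[OF that] that i by (auto simp: A2_def)
  \<comment> \<open>\<open>mate\<close> is an involution: both sides say that \<open>i\<close> and
    \<open>k\<close> are equal or matched, which is the case where no partner is missing.\<close>
  have eig: "e = i \<longleftrightarrow> g = k"
    using e g mi matched_sym[of N k A k] kN by (auto split: if_splits)
  have *: "content N (Suc k) A' B' E' j = (if j = i then v else ?c j) \<and>
        (matched N (Suc k) A' j \<longleftrightarrow> (j \<le> k \<longleftrightarrow> (if j = i then v else ?c j) = empty3))" if j: "j < N" for j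
  proof -
    have "matched N (Suc k) A' j \<longleftrightarrow> g \<noteq> k \<and> (j = e \<or> j = g) \<or>
      matched N (Suc k) A2 j \<and> (g \<noteq> k \<longrightarrow> A2 j \<noteq> e \<and> A2 j \<noteq> g)"
      unfolding A' using matched_pair[of e "Suc k" g N j A2] e g(2) eN gN j by (auto split: if_splits)
    also have "\<dots> \<longleftrightarrow> g \<noteq> k \<and> (j = e \<or> j = g) \<or>
      matched N (Suc k) A j \<and> (e \<noteq> k \<longrightarrow> j \<noteq> k \<and> A j \<noteq> k) \<and> (i \<le> k \<longrightarrow> j \<noteq> i \<and> A j \<noteq> i)
        \<and> (g \<noteq> k \<longrightarrow> A j \<noteq> e \<and> A j \<noteq> g)" (is "_ \<longleftrightarrow> ?L")
      using m1[OF j] m2[OF j] by metis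
    also have "\<dots> \<longleftrightarrow> g \<noteq> k \<and> (j = e \<or> j = g) \<or> matched N k A j \<and> j \<notin> {i, k, e, g}" (is "_ \<longleftrightarrow> ?R")
    proof
      assume L: ?L
      show ?R
      proof (cases "g \<noteq> k \<and> (j = e \<or> j = g)")
        case False
        then have "j \<noteq> k" "A j \<noteq> k" "j \<noteq> i" "j \<noteq> e" "j \<noteq> g"
          using L eig g(1) by (auto split: if_splits)
        then show ?thesis using L matched_Suc[of j k A N] by blast
      qed blast
    next
      assume R: ?R
      show ?L
      proof (cases "g \<noteq> k \<and> (j = e \<or> j = g)")
        case False
        with R have M: "matched N k A j" "j \<noteq> i" "j \<noteq> k" "j \<noteq> e" "j \<noteq> g" by auto
        have "A j \<noteq> k" "A j \<noteq> i" "A j \<noteq> e" "A j \<noteq> g"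
          using matched_sym[OF M(1) j] M e g mi by (metis (full_types))+
        then show ?thesis using M matched_Suc[of j k A N] by blast
      qed blast
    qed
    finally have m': "matched N (Suc k) A' j \<longleftrightarrow> g \<noteq> k \<and> (j = e \<or> j = g) \<or> matched N k A j \<and> j \<notin> {i, k, e, g}" .
    consider "j = g" "g \<noteq> k" | "j = e" "g \<noteq> k" | "j = i" "i \<le> k" | "j = k" "j \<noteq> i" "e \<noteq> k"
      | "j \<notin> {e, g, i, k}"
    proof -
      have "i \<le> k \<or> g = i" "g = k \<longrightarrow> i \<le> k" using g(1) by (auto split: if_splits)
      then show thesis using eig that by blast
    qed
    then have "content N (Suc k) A' B' E' j = (if j = i then v else ?c j)"
    proof cases
      case 1
      then have "A' j = e" "g \<noteq> e" using eig g(2) e by (auto simp: A' split: if_splits)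
      then have "content N (Suc k) A' B' E' j = y"
        using 1 m' g(2) by (auto simp: content_def B' E')
      then show ?thesis using 1 g by (auto simp: y_def split: if_splits)
    next
      case 2
      then have "j \<noteq> i" "j \<le> k" using eig e by (auto split: if_splits)
      then show ?thesis using 2 m' e by (auto simp: content_def split: if_splits)
    next
      case 3
      have "j \<noteq> e" "j \<noteq> g" if "g \<noteq> k"
        using 3 that eig g by (auto split: if_splits)
      moreover have "A2 j = fst v" using 3 matched_break_link(2)[of i "Suc k" j N A1 "fst v"] j by (simp add: A2_def)
      ultimately show ?thesis using 3 m' by (auto simp: content_def A' B' E')
    next
      case 4
      have "j \<noteq> g" if "g \<noteq> k" using 4 that by auto
      moreover have "A1 k = fst (?c k)"
        using 4 matched_break_link(2)[of k "Suc k" k N A "fst (?c k)"] kN by (simp add: A1_def)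
      moreover have "A2 k = A1 k"
        using 4 matched_break_link(4)[of i "Suc k" k N A1 "fst v"] kN i by (simp add: A2_def)
      ultimately show ?thesis using 4 m' by (auto simp: content_def A' B' E')
    next
      case 5
      then have m: "matched N (Suc k) A' j \<longleftrightarrow> matched N k A j" using m' by auto
      have BE: "E' j = E j" "B' j = B j" using 5 by (auto simp: B' E')
      show ?thesis
      proof (cases "matched N k A j")
        case True
        have "A' j = A2 j" using 5 by (simp add: A')
        moreover have "matched N (Suc k) A2 j"
          using True 5 m matched_pair[of e "Suc k" g N j A2] e g(2) eN gN j by (auto simp: A' split: if_splits)
        ultimately have "A' j = A j" using m2[OF j] by auto
        moreover have "A j \<noteq> k" "A j \<noteq> i" "A j \<noteq> e" "A j \<noteq> g"
          using matched_sym[OF True j] 5 e g mi by (metis (full_types) insert_iff)+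
        ultimately show ?thesis using 5 True m BE by (auto simp: content_def B' E')
      next
        case False
        have "A' j = A j" if "j < k"
          using 5 that matched_break_link(4)[of k "Suc k" j N A "fst (?c k)"] matched_break_link(4)[of i "Suc k" j N A1 "fst v"] j kN i
          by (simp add: A' A1_def A2_def)
        then show ?thesis using False 5 m BE by (auto simp: content_def)
      qed
    qed
    moreover have "j \<le> k \<longleftrightarrow> j < k \<or> j = k" by auto
    ultimately show ?thesis using m' eig e g mi nz[OF j] nz[OF kN] nz[OF eN] nz[OF gN] i v
      by (auto split: if_splits)
  qed
  show "\<forall>j<N. content N (Suc k) A' B' E' j = (if j = i then v else ?c j)"
    using * by simp
  show "chain_inv N (Suc k) A' B' E'"
    using * kN unfolding chain_inv_def by (auto simp: less_Suc_eq_le)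
qed

section \<open>The block structure in memory\<close>

text \<open>This and the following definitions imitate the machine, with explicit reductions modulo
  \<open>2 ^ w\<close> and with \<open>get\<close> and \<open>put\<close>, so that computability
  follows from their form. Under the size bounds fixed below the reductions disappear.\<close>

definition adr :: "nat \<Rightarrow> nat \<Rightarrow> nat \<Rightarrow> nat" where
  "adr w t i = (3 * i + t) mod 2 ^ w"

definition matchedW where
  "matchedW w N k W i = (let j = get W (adr w 0 i) in
     j < N \<and> get W (adr w 0 j) = i \<and> (if j < k then \<not> i < k else i < k))"

definition mateW where
  "mateW w N k W i = (if matchedW w N k W i then get W (adr w 0 i) else i)"

definition cnt0 where
  "cnt0 w N k W i = (if i < k then if matchedW w N k W i then 0 else get W (adr w 0 i)
     else if matchedW w N k W i then get W (adr w 1 (get W (adr w 0 i))) else 0)"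

definition cnt1 where
  "cnt1 w N k W i = (if i < k then if matchedW w N k W i then 0 else get W (adr w 1 i)
     else if matchedW w N k W i then get W (adr w 2 (get W (adr w 0 i))) else 0)"

definition cnt2 where
  "cnt2 w N k W i = (if i < k then if matchedW w N k W i then 0 else get W (adr w 2 i)
     else if matchedW w N k W i then get W (adr w 2 i) else 0)"

definition clearW where
  "clearW w N k W i =
    (let e = mateW w N k W (k - 1); g = mateW w N k W i;
         y0 = cnt0 w N k W e; y1 = cnt1 w N k W e; y2 = cnt2 w N k W e;
         W1 = put W (adr w 0 (k - 1)) (k - 1)
     in if e \<noteq> i
        then put (put (put (put (put W1 (adr w 0 g) e) (adr w 0 e) g) (adr w 1 g) y0) (adr w 2 g) y1) (adr w 2 e) y2
        else W1)"

definition break_linkW where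
  "break_linkW w N k x W = (let z = get W (adr w 0 x) in
     if z < N \<and> k \<le> z \<and> get W (adr w 0 z) = x then put W (adr w 0 z) z else W)"

definition plainW where
  "plainW w N k x v0 v1 v2 W =
     break_linkW w N k x (put (put (put W (adr w 0 x) v0) (adr w 1 x) v1) (adr w 2 x) v2)"

definition fillW where
  "fillW w N k W i v0 v1 v2 =
    (let e = mateW w N k W k; g = mateW w N k W i;
         x0 = cnt0 w N k W k; x1 = cnt1 w N k W k; x2 = cnt2 w N k W k;
         y0 = (if i < k then cnt0 w N k W g else v0);
         y1 = (if i < k then cnt1 w N k W g else v1);
         y2 = (if i < k then cnt2 w N k W g else v2);
         k' = (k + 1) mod 2 ^ w;
         W1 = (if e \<noteq> k then plainW w N k' k x0 x1 x2 W else W);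
         W2 = (if i \<le> k then plainW w N k' i v0 v1 v2 W1 else W1)
     in if g \<noteq> k
        then put (put (put (put (put W2 (adr w 0 e) g) (adr w 0 g) e) (adr w 1 e) y0) (adr w 2 e) y1) (adr w 2 g) y2
        else W2)"

text \<open>Without a complement instruction, a bit is cleared by first setting it and then flipping
  it.\<close>

definition setb :: "nat \<Rightarrow> bool \<Rightarrow> nat \<Rightarrow> nat \<Rightarrow> nat" where
  "setb w v b x = (let z = 2 ^ b mod 2 ^ w; y = Bit_Operations.or x z
     in if v then y else Bit_Operations.xor y z)"

text \<open>Bit n tells whether k < N; if so, k is stored in the free word of block N - 1, which is
then a right block.\<close>

definition readK where
  "readK w n N W = (if bit (get W (n div w)) (n mod w) then get W (adr w 1 (N - 1)) else N)"

definition writeK where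
  "writeK w n N k W = (let W1 = (if k < N then put W (adr w 1 (N - 1)) k else W)
     in put W1 (n div w) (setb w (k < N) (n mod w) (get W1 (n div w))))"

text \<open>Every change of a block is a clearing followed by a filling, each skipped where it does
  not apply. Replacing one nonempty content by another thus moves the barrier down and up again, and
  only two kinds of transition need proof.\<close>

definition updW where
  "updW w n N i v0 v1 v2 W = (let k = readK w n N W;
     b = of_bool (cnt0 w N k W i \<noteq> 0 \<or> cnt1 w N k W i \<noteq> 0 \<or> cnt2 w N k W i \<noteq> 0);
     k1 = k - b;
     W1 = (if b \<noteq> 0 then writeK w n N k1 (clearW w N k W i) else W)
     in if v0 \<noteq> 0 \<or> v1 \<noteq> 0 \<or> v2 \<noteq> 0
        then writeK w n N ((k1 + 1) mod 2 ^ w) (fillW w N k1 W1 i v0 v1 v2) else W1)"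

text \<open>Word j of the bit vector representing S, in which element l is bit l - 1: for j < 3 * N it
comes from a block, the remaining words are stored verbatim.\<close>

definition lword where
  "lword w n N W j = (if j div 3 < N then let k = readK w n N W in
     if j mod 3 = 0 then cnt0 w N k W (j div 3) else if j mod 3 = 1 then cnt1 w N k W (j div 3)
     else cnt2 w N k W (j div 3) else get W j)"

definition editW where
  "editW w n N v l W = (let j = (l - 1) div w; i = j div 3;
     x = setb w v ((l - 1) mod w) (lword w n N W j); k = readK w n N W
     in if i < N then updW w n N i (if j mod 3 = 0 then x else cnt0 w N k W i)
          (if j mod 3 = 1 then x else cnt1 w N k W i) (if j mod 3 = 2 then x else cnt2 w N k W i) W
        else put W j x)"

definition containsW where
  "containsW w n N l W = bit (lword w n N W ((l - 1) div w)) ((l - 1) mod w)"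

definition clear_rest where
  "clear_rest w n j W = (if j < n div w then put W j 0
     else if j = n div w then put W j (get W j - get W j mod (2 ^ (n mod w) mod 2 ^ w)) else W)"

text \<open>Since \<open>n div w\<close> is at most \<open>3 * N + 2\<close>, three words cover all
  of the vector that lies outside the blocks. Clearing must spare the bits from \<open>n\<close> on,
  which include foreign ones.\<close>

definition initW where
  "initW w n N W = writeK w n N 0 (clear_rest w n (adr w 0 N) (clear_rest w n (adr w 1 N)
     (clear_rest w n (adr w 2 N) W)))"

definition elem where
  "elem w L j x = ((j * w) mod 2 ^ w + (L x + 1) mod 2 ^ w) mod 2 ^ w"

definition rest_word where
  "rest_word w n j W = (if j < n div w then get W j
     else if j = n div w then get W j mod (2 ^ (n mod w) mod 2 ^ w) else 0)"

definition choiceW where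
  "choiceW w n N L W = (let k = readK w n N W in
     if k \<noteq> 0 then let i = mateW w N k W 0 in
       if cnt0 w N k W i \<noteq> 0 then elem w L (adr w 0 i) (cnt0 w N k W i)
       else if cnt1 w N k W i \<noteq> 0 then elem w L (adr w 1 i) (cnt1 w N k W i)
       else elem w L (adr w 2 i) (cnt2 w N k W i)
     else let x0 = rest_word w n (adr w 0 N) W; x1 = rest_word w n (adr w 1 N) W;
              x2 = rest_word w n (adr w 2 N) W in
       if x0 \<noteq> 0 then elem w L (adr w 0 N) x0
       else if x1 \<noteq> 0 then elem w L (adr w 1 N) x1
       else if x2 \<noteq> 0 then elem w L (adr w 2 N) x2 else 0)"

section \<open>The word-level operations carry out the block operations\<close>

definition aW where "aW W = (\<lambda>i. W (3 * i) :: nat)"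
definition bW where "bW W = (\<lambda>i. W (3 * i + 1) :: nat)"
definition eW where "eW W = (\<lambda>i. W (3 * i + 2) :: nat)"

lemma blocks_upd:
  fixes i v :: nat
  shows
  "aW (W(3 * i := v)) = (aW W)(i := v)" "bW (W(3 * i := v)) = bW W" "eW (W(3 * i := v)) = eW W"
  "aW (W(3 * i + 1 := v)) = aW W" "bW (W(3 * i + 1 := v)) = (bW W)(i := v)" "eW (W(3 * i + 1 := v)) = eW W"
  "aW (W(3 * i + 2 := v)) = aW W" "bW (W(3 * i + 2 := v)) = bW W" "eW (W(3 * i + 2 := v)) = (eW W)(i := v)"
proof -
  have *: "3 * j \<noteq> 3 * i + 1" "3 * j \<noteq> 3 * i + 2" "3 * j + 1 \<noteq> 3 * i" "3 * j + 2 \<noteq> 3 * i"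
     "3 * j + 1 \<noteq> 3 * i + 2" "3 * j + 2 \<noteq> 3 * i + 1" for j i :: nat
    by presburger+
  show "aW (W(3 * i := v)) = (aW W)(i := v)" "bW (W(3 * i := v)) = bW W" "eW (W(3 * i := v)) = eW W"
  "aW (W(3 * i + 1 := v)) = aW W" "bW (W(3 * i + 1 := v)) = (bW W)(i := v)" "eW (W(3 * i + 1 := v)) = eW W"
  "aW (W(3 * i + 2 := v)) = aW W" "bW (W(3 * i + 2 := v)) = bW W" "eW (W(3 * i + 2 := v)) = (eW W)(i := v)"
    unfolding fun_eq_iff aW_def bW_def eW_def fun_upd_apply
    using * by auto
qed

lemma matched_cong:
  assumes "\<And>i. i < N \<Longrightarrow> A i = A' i" "i < N"
  shows "matched N k A i \<longleftrightarrow> matched N k A' i"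
  using assms unfolding matched_def by metis

text \<open>\<open>B\<close> has to agree on left blocks only, because a matched right block reads
  \<open>B\<close> at its left partner. This is what makes room for the barrier in a right
  block.\<close>

lemma content_cong:
  assumes "\<And>i. i < N \<Longrightarrow> A i = A' i" "\<And>i. i < N \<Longrightarrow> i < k \<Longrightarrow> B i = B' i" "\<And>i. i < N \<Longrightarrow> E i = E' i" "i < N"
  shows "content N k A B E i = content N k A' B' E' i"
  using matched_cong[of N A A', OF assms(1,4)] assms matched_sym[of N k A' i] by (simp add: content_def)

lemma chain_inv_cong:
  assumes "\<And>i. i < N \<Longrightarrow> A i = A' i" "\<And>i. i < N \<Longrightarrow> i < k \<Longrightarrow> B i = B' i" "\<And>i. i < N \<Longrightarrow> E i = E' i"
    "chain_inv N k A B E"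
  shows "chain_inv N k A' B' E'"
  using assms(4) content_cong[of N A A' k B B' E E', OF assms(1-3)] matched_cong[of N A A', OF assms(1)]
  by (simp add: chain_inv_def)

definition block where
  "block N k W i = content N k (aW W) (bW W) (eW W) i"

definition barrier_at where
  "barrier_at w n N k W \<longleftrightarrow> (bit (W (n div w)) (n mod w) \<longleftrightarrow> k < N) \<and> (k < N \<longrightarrow> W (3 * (N - 1) + 1) = k) \<and>
     chain_inv N k (aW W) (bW W) (eW W)"

lemma bit_setb: "b < w \<Longrightarrow> bit (setb w v b x) q \<longleftrightarrow> (if q = b then v else bit x q)"
  by (auto simp: setb_def Let_def bit_or_iff bit_xor_iff bit_exp_iff)

definition sel :: "nat \<Rightarrow> nat \<times> nat \<times> nat \<Rightarrow> nat" where
  "sel t v = (if t = 0 then fst v else if t = 1 then fst (snd v) else snd (snd v))"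

text \<open>Because \<open>3 * N\<close> is at most \<open>n div w\<close>, this frame condition
  covers all foreign bits, and it leaves out only the flag at position \<open>n\<close>.\<close>

definition same_bits_beyond where
  "same_bits_beyond w n N W W' \<longleftrightarrow>
     (\<forall>j b. 3 * N \<le> j \<longrightarrow> (j, b) \<noteq> (n div w, n mod w) \<longrightarrow> bit (W' j :: nat) b = bit (W j :: nat) b)"

context
  fixes w n N :: nat
  assumes w: "0 < w" and N: "N = n div w div 3" and n: "n < 2 ^ w" and small: "3 * N + 2 < 2 ^ w"
begin

lemma adr: "i \<le> N \<Longrightarrow> t < 3 \<Longrightarrow> adr w t i = 3 * i + t"
proof -
  assume "i \<le> N" "t < 3"
  then have "3 * i + t < 2 ^ w" using small by linarith
  then show ?thesis by (simp add: adr_def)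
qed

lemma adr_N: "i < N \<Longrightarrow> adr w 0 i = 3 * i" "i < N \<Longrightarrow> adr w 1 i = 3 * i + 1"
  "i < N \<Longrightarrow> adr w (Suc 0) i = 3 * i + 1" "i < N \<Longrightarrow> adr w 2 i = 3 * i + 2"
  using adr[of i 0] adr[of i 1] adr[of i 2] by simp_all

lemma matchedW: "i < N \<Longrightarrow> matchedW w N k W i \<longleftrightarrow> matched N k (aW W) i"
  by (auto simp: matchedW_def matched_def get_def adr_N aW_def Let_def)

lemma mateW: "i < N \<Longrightarrow> mateW w N k W i = mate N k (aW W) i"
  by (simp add: mateW_def mate_def matchedW get_def adr_N aW_def)

lemma cntW: "i < N \<Longrightarrow> (cnt0 w N k W i, cnt1 w N k W i, cnt2 w N k W i) = content N k (aW W) (bW W) (eW W) i"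
  using matched_sym(4)[of N k "aW W" i]
  by (auto simp: cnt0_def cnt1_def cnt2_def content_def matchedW get_def adr_N aW_def bW_def eW_def empty3_def)

lemma cntW_sel: "i < N \<Longrightarrow> cnt0 w N k W i = fst (content N k (aW W) (bW W) (eW W) i)"
  "i < N \<Longrightarrow> cnt1 w N k W i = fst (snd (content N k (aW W) (bW W) (eW W) i))"
  "i < N \<Longrightarrow> cnt2 w N k W i = snd (snd (content N k (aW W) (bW W) (eW W) i))"
  using cntW[of i k W] by (metis fst_conv snd_conv)+

lemma clearW:
  assumes "0 < k" "k \<le> N" "i < N"
  shows "aW (clearW w N k W i) = clearA N k (aW W) i"
    "bW (clearW w N k W i) = clearB N k (aW W) (bW W) (eW W) i"
    "eW (clearW w N k W i) = clearE N k (aW W) (bW W) (eW W) i"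
    "3 * N \<le> p \<Longrightarrow> clearW w N k W i p = W p"
proof -
  have k: "k - 1 < N" using assms by simp
  define e g where "e = mate N k (aW W) (k - 1)" and "g = mate N k (aW W) i"
  have eg: "e < N" "g < N" using k assms mate_less by (auto simp: e_def g_def)
  have *: "clearW w N k W i = (let W1 = W(3 * (k - 1) := k - 1); y = content N k (aW W) (bW W) (eW W) e
     in if e \<noteq> i then (((((W1(3 * g := e))(3 * e := g))(3 * g + 1 := fst y))(3 * g + 2 := fst (snd y)))(3 * e + 2 := snd (snd y)))
        else W1)"
    using eg k assms unfolding clearW_def Let_def
    by (simp only: mateW flip: e_def g_def) (simp add: cntW_sel adr_N put_def)
  show "aW (clearW w N k W i) = clearA N k (aW W) i"
    "bW (clearW w N k W i) = clearB N k (aW W) (bW W) (eW W) i"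
    "eW (clearW w N k W i) = clearE N k (aW W) (bW W) (eW W) i"
    unfolding * clearA_def clearB_def clearE_def Let_def
    by (auto simp only: blocks_upd e_def[symmetric] g_def[symmetric] split: if_splits)
  show "3 * N \<le> p \<Longrightarrow> clearW w N k W i p = W p"
    unfolding * Let_def using eg k by auto
qed

lemma plainW:
  assumes "x < N"
  shows "aW (plainW w N k x v0 v1 v2 W) = break_link N k x ((aW W)(x := v0))"
    "bW (plainW w N k x v0 v1 v2 W) = (bW W)(x := v1)"
    "eW (plainW w N k x v0 v1 v2 W) = (eW W)(x := v2)"
    "3 * N \<le> p \<Longrightarrow> plainW w N k x v0 v1 v2 W p = W p"
proof -
  define W1 where "W1 = W(3 * x := v0, 3 * x + 1 := v1, 3 * x + 2 := v2)"
  have a: "aW W1 = (aW W)(x := v0)" "bW W1 = (bW W)(x := v1)" "eW W1 = (eW W)(x := v2)"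
    by (simp_all only: W1_def blocks_upd)
  define z where "z = aW W1 x"
  define q where "q \<longleftrightarrow> z < N \<and> k \<le> z \<and> aW W1 z = x"
  have *: "plainW w N k x v0 v1 v2 W = (if q then W1(3 * z := z) else W1)"
  proof -
    have "put (put (put W (adr w 0 x) v0) (adr w 1 x) v1) (adr w 2 x) v2 = W1"
      using assms by (simp only: put_def adr_N W1_def)
    then show ?thesis
      using assms by (auto simp: plainW_def break_linkW_def Let_def get_def put_def adr_N aW_def z_def q_def)
  qed
  have break_link: "break_link N k x ((aW W)(x := v0)) = (if q then (aW W1)(z := z) else aW W1)"
    unfolding break_link_def q_def z_def a(1)[symmetric] by simp
  show "aW (plainW w N k x v0 v1 v2 W) = break_link N k x ((aW W)(x := v0))"
    "bW (plainW w N k x v0 v1 v2 W) = (bW W)(x := v1)"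
    "eW (plainW w N k x v0 v1 v2 W) = (eW W)(x := v2)"
    unfolding * break_link by (simp_all only: blocks_upd a if_distrib[of aW] if_distrib[of bW] if_distrib[of eW] if_cancel)
  show "3 * N \<le> p \<Longrightarrow> plainW w N k x v0 v1 v2 W p = W p"
    unfolding * using assms by (auto simp: W1_def q_def)
qed

lemma fillW:
  fixes v0 v1 v2 :: nat
  assumes "k < N" "i < N"
  defines "v \<equiv> (v0, v1, v2)"
  shows "aW (fillW w N k W i v0 v1 v2) = fillA N k (aW W) (bW W) (eW W) i v"
    "bW (fillW w N k W i v0 v1 v2) = fillB N k (aW W) (bW W) (eW W) i v"
    "eW (fillW w N k W i v0 v1 v2) = fillE N k (aW W) (bW W) (eW W) i v"
    "3 * N \<le> p \<Longrightarrow> fillW w N k W i v0 v1 v2 p = W p"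
proof -
  have k: "(k + 1) mod 2 ^ w = Suc k" using assms small by simp
  define e g where "e = mate N k (aW W) k" and "g = mate N k (aW W) i"
  have eg: "e < N" "g < N" using assms mate_less by (auto simp: e_def g_def)
  define x where "x = content N k (aW W) (bW W) (eW W) k"
  define y where "y = (if i < k then content N k (aW W) (bW W) (eW W) g else v)"
  define W1 where "W1 = (if e \<noteq> k then plainW w N (Suc k) k (fst x) (fst (snd x)) (snd (snd x)) W else W)"
  define W2 where "W2 = (if i \<le> k then plainW w N (Suc k) i v0 v1 v2 W1 else W1)"
  have *: "fillW w N k W i v0 v1 v2 = (if g \<noteq> k
     then ((((W2(3 * e := g))(3 * g := e))(3 * e + 1 := fst y))(3 * e + 2 := fst (snd y)))(3 * g + 2 := snd (snd y))
     else W2)"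
    using eg assms(1,2) unfolding fillW_def Let_def k W1_def W2_def x_def y_def
    by (simp only: mateW flip: e_def g_def) (simp add: cntW_sel adr_N put_def v_def)
  have "aW W1 = (if e \<noteq> k then break_link N (Suc k) k ((aW W)(k := fst x)) else aW W)"
    "bW W1 = (if e \<noteq> k then (bW W)(k := fst (snd x)) else bW W)"
    "eW W1 = (if e \<noteq> k then (eW W)(k := snd (snd x)) else eW W)"
    unfolding W1_def using plainW[OF assms(1)] by auto
  moreover have "aW W2 = (if i \<le> k then break_link N (Suc k) i ((aW W1)(i := v0)) else aW W1)"
    "bW W2 = (if i \<le> k then (bW W1)(i := v1) else bW W1)"
    "eW W2 = (if i \<le> k then (eW W1)(i := v2) else eW W1)"
    unfolding W2_def using plainW[OF assms(2)] by auto
  ultimately show "aW (fillW w N k W i v0 v1 v2) = fillA N k (aW W) (bW W) (eW W) i v"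
    "bW (fillW w N k W i v0 v1 v2) = fillB N k (aW W) (bW W) (eW W) i v"
    "eW (fillW w N k W i v0 v1 v2) = fillE N k (aW W) (bW W) (eW W) i v"
    unfolding * fillA_def fillB_def fillE_def Let_def
      e_def[symmetric] g_def[symmetric] x_def[symmetric] y_def[symmetric]
    by (simp_all only: blocks_upd if_distrib[of aW] if_distrib[of bW] if_distrib[of eW] v_def fst_conv snd_conv)
  show "3 * N \<le> p \<Longrightarrow> fillW w N k W i v0 v1 v2 p = W p"
    unfolding * W2_def W1_def using eg assms plainW(4) by auto
qed


lemma N_le: "3 * N \<le> n div w" "n div w \<le> 3 * N + 2"
  unfolding N by linarith+

lemma blkW: "i < N \<Longrightarrow> (cnt0 w N k W i, cnt1 w N k W i, cnt2 w N k W i) = block N k W i"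
  by (simp add: block_def cntW)

lemma blkW_sel: "i < N \<Longrightarrow> cnt0 w N k W i = sel 0 (block N k W i)"
  "i < N \<Longrightarrow> cnt1 w N k W i = sel 1 (block N k W i)"
  "i < N \<Longrightarrow> cnt2 w N k W i = sel 2 (block N k W i)"
  by (simp_all add: block_def cntW_sel sel_def)

lemma readK: "barrier_at w n N k W \<Longrightarrow> readK w n N W = k"
  using adr_N(2)[of "N - 1"] by (auto simp: readK_def barrier_at_def get_def chain_inv_def)

text \<open>If \<open>k < N\<close>, then block \<open>N - 1\<close> is right and its
  \<open>B\<close> word is ignored by \<open>content\<close>; the flag lies in word
  \<open>n div w\<close>, after all blocks. So neither write changes any content.\<close>

lemma writeK:
  assumes "chain_inv N k (aW W) (bW W) (eW W)"
  defines "W' \<equiv> writeK w n N k W"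
  shows "barrier_at w n N k W'" "i < N \<Longrightarrow> block N k W' i = block N k W i" "same_bits_beyond w n N W W'"
proof -
  have k: "k \<le> N" using assms by (simp add: chain_inv_def)
  define W1 where "W1 = (if k < N then W(3 * (N - 1) + 1 := k) else W)"
  have *: "W' = W1(n div w := setb w (k < N) (n mod w) (W1 (n div w)))"
    using adr_N(2)[of "N - 1"] by (simp add: W'_def writeK_def W1_def put_def get_def)
  have "3 * i \<noteq> n div w" "3 * i + 1 \<noteq> n div w" "3 * i + 2 \<noteq> n div w" if "i < N" for i
    using that N_le by linarith+
  then have 1: "aW W' i = aW W1 i" "bW W' i = bW W1 i" "eW W' i = eW W1 i" if "i < N" for i
    using that by (auto simp: * aW_def bW_def eW_def)
  have 2: "aW W1 = aW W" "bW W1 = (if k < N then (bW W)(N - 1 := k) else bW W)" "eW W1 = eW W"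
    by (simp_all add: W1_def blocks_upd del: One_nat_def)
  have 3: "aW W i = aW W' i" "i < k \<Longrightarrow> bW W i = bW W' i" "eW W i = eW W' i" if "i < N" for i
    using 1[OF that] 2 k by auto
  show "i < N \<Longrightarrow> block N k W' i = block N k W i"
    unfolding block_def by (rule content_cong[symmetric, OF 3])
  have "chain_inv N k (aW W') (bW W') (eW W')"
    by (rule chain_inv_cong[OF 3 assms(1)])
  moreover have "W' (3 * (N - 1) + 1) = k" if "k < N"
  proof -
    have "bW W' (N - 1) = k" using 1(2)[of "N - 1"] 2(2) that by simp
    then show ?thesis by (simp add: bW_def)
  qed
  ultimately show "barrier_at w n N k W'"
    using w by (simp add: barrier_at_def bit_setb *)
  have "3 * (N - 1) + 1 < 3 * N" if "k < N" using that by linarith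
  then show "same_bits_beyond w n N W W'"
    unfolding same_bits_beyond_def using w by (auto simp: * W1_def bit_setb)
qed

lemma updW:
  fixes v0 v1 v2 :: nat
  assumes barrier_at: "barrier_at w n N k W" and i: "i < N"
  defines "W' \<equiv> updW w n N i v0 v1 v2 W"
  shows "\<exists>k'. barrier_at w n N k' W' \<and> (\<forall>j<N. block N k' W' j = (if j = i then (v0, v1, v2) else block N k W j)) \<and>
    same_bits_beyond w n N W W'"
proof -
  define ne where "ne \<longleftrightarrow> block N k W i \<noteq> empty3"
  have ne: "cnt0 w N k W i \<noteq> 0 \<or> cnt1 w N k W i \<noteq> 0 \<or> cnt2 w N k W i \<noteq> 0 \<longleftrightarrow> ne"
    by (auto simp: ne_def empty3_def blkW[OF i, symmetric])
  have chain_inv: "chain_inv N k (aW W) (bW W) (eW W)" using barrier_at by (simp add: barrier_at_def)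
  define k1 where "k1 = (if ne then k - 1 else k)"
  define W1 where "W1 = (if ne then writeK w n N k1 (clearW w N k W i) else W)"
  have 1: "barrier_at w n N k1 W1 \<and> (\<forall>j<N. block N k1 W1 j = (if j = i then empty3 else block N k W j)) \<and>
    same_bits_beyond w n N W W1"
  proof (cases ne)
    case True
    let ?W = "clearW w N k W i"
    have ne': "content N k (aW W) (bW W) (eW W) i \<noteq> empty3" using True by (simp add: ne_def block_def)
    note c = clear_correct[OF chain_inv i ne']
    have "k \<le> N" using chain_inv by (simp add: chain_inv_def)
    note cW = clearW[OF c(1) this i]
    have "chain_inv N k1 (aW ?W) (bW ?W) (eW ?W)" using c(3) True by (simp add: cW k1_def)
    note wr = writeK[OF this]
    have "same_bits_beyond w n N W ?W" by (simp add: same_bits_beyond_def cW)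
    then have "same_bits_beyond w n N W (writeK w n N k1 ?W)"
      using wr(3) by (simp add: same_bits_beyond_def)
    then show ?thesis
      using wr c(2) True by (simp add: W1_def block_def cW k1_def)
  next
    case False
    then show ?thesis using barrier_at by (auto simp: W1_def k1_def ne_def same_bits_beyond_def)
  qed
  define k2 where "k2 = (if (v0, v1, v2) \<noteq> empty3 then Suc k1 else k1)"
  define W2 where "W2 = (if (v0, v1, v2) \<noteq> empty3 then writeK w n N k2 (fillW w N k1 W1 i v0 v1 v2) else W1)"
  have inv1: "chain_inv N k1 (aW W1) (bW W1) (eW W1)" using 1 by (simp add: barrier_at_def)
  \<comment> \<open>The last conjunct ensures that the increment of \<open>k1\<close> does not wrap
    around.\<close>
  have 2: "barrier_at w n N k2 W2 \<and> (\<forall>j<N. block N k2 W2 j = (if j = i then (v0, v1, v2) else block N k W j)) \<and>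
    same_bits_beyond w n N W W2 \<and> (k2 = k1 \<or> k1 < N)"
  proof (cases "(v0, v1, v2) \<noteq> empty3")
    case True
    let ?W = "fillW w N k1 W1 i v0 v1 v2"
    have "content N k1 (aW W1) (bW W1) (eW W1) i = empty3" using 1 i by (simp add: block_def)
    note c = fill_correct[OF inv1 i this True]
    note cW = fillW[OF c(1) i]
    have "chain_inv N k2 (aW ?W) (bW ?W) (eW ?W)" using c(3) True by (simp add: cW k2_def)
    note wr = writeK[OF this]
    have "same_bits_beyond w n N W1 ?W" by (simp add: same_bits_beyond_def cW)
    then have "same_bits_beyond w n N W (writeK w n N k2 ?W)"
      using wr(3) 1 by (simp add: same_bits_beyond_def)
    then show ?thesis
      using wr c(1,2) True 1 by (simp add: W2_def block_def cW k2_def)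
  next
    case False
    then show ?thesis using 1 by (auto simp: W2_def k2_def)
  qed
  have "W' = W2"
  proof -
    have "(k1 + 1) mod 2 ^ w = k2" if "(v0, v1, v2) \<noteq> empty3"
      using 2 that small by (auto simp: k2_def)
    moreover have "k - of_bool ne = k1" by (simp add: k1_def)
    ultimately show ?thesis
      unfolding W'_def updW_def readK[OF barrier_at] ne Let_def W2_def W1_def
      by (auto simp: empty3_def)
  qed
  with 2 show ?thesis by blast
qed

lemma lword:
  "barrier_at w n N k W \<Longrightarrow> lword w n N W j = (if j div 3 < N then sel (j mod 3) (block N k W (j div 3)) else W j)"
proof -
  have "j mod 3 = 0 \<or> j mod 3 = 1 \<or> j mod 3 = 2" by linarith
  then show "barrier_at w n N k W \<Longrightarrow> ?thesis"
    by (auto simp: lword_def readK blkW_sel get_def Let_def)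
qed

lemma pos_ne_flag: "p \<noteq> n \<Longrightarrow> (p div w, p mod w) \<noteq> (n div w, n mod w)"
  by (metis div_mult_mod_eq prod.inject)

text \<open>Position \<open>n\<close> is excluded because word \<open>n div w\<close> is stored
  verbatim and contains the flag there. All positions after \<open>n\<close> are included, so the
  claim also says that foreign bits survive.\<close>

lemma editW:
  fixes v :: bool
  assumes barrier_at: "barrier_at w n N k W" and p: "l - 1 < n"
  defines "W' \<equiv> editW w n N v l W"
  shows "\<exists>k'. barrier_at w n N k' W' \<and> (\<forall>j b. (j, b) \<noteq> (n div w, n mod w) \<longrightarrow>
      bit (lword w n N W' j) b = (if j = (l - 1) div w \<and> b = (l - 1) mod w then v else bit (lword w n N W j) b))"
proof -
  define j0 b0 where "j0 = (l - 1) div w" and "b0 = (l - 1) mod w"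
  have b0: "b0 < w" using w by (simp add: b0_def)
  define x where "x = setb w v b0 (lword w n N W j0)"
  have x: "bit x b = (if b = b0 then v else bit (lword w n N W j0) b)" for b
    using bit_setb[OF b0] by (simp add: x_def)
  show ?thesis
  proof (cases "j0 div 3 < N")
    case True
    define i where "i = j0 div 3"
    have i: "i < N" using True by (simp add: i_def)
    define v0 v1 v2 where "v0 = (if j0 mod 3 = 0 then x else cnt0 w N k W i)"
      and "v1 = (if j0 mod 3 = 1 then x else cnt1 w N k W i)"
      and "v2 = (if j0 mod 3 = 2 then x else cnt2 w N k W i)"
    have t: "j0 mod 3 = 0 \<or> j0 mod 3 = 1 \<or> j0 mod 3 = 2" by linarith
    have W': "W' = updW w n N i v0 v1 v2 W"
      using i t unfolding W'_def editW_def Let_def readK[OF barrier_at]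
      by (auto simp: v0_def v1_def v2_def i_def j0_def x_def b0_def)
    obtain k' where k': "barrier_at w n N k' W'"
      "\<And>j. j < N \<Longrightarrow> block N k' W' j = (if j = i then (v0, v1, v2) else block N k W j)"
      "same_bits_beyond w n N W W'"
      using updW[OF barrier_at i, of v0 v1 v2] unfolding W' by blast
    have "bit (lword w n N W' j) b = (if j = j0 \<and> b = b0 then v else bit (lword w n N W j) b)"
      if "(j, b) \<noteq> (n div w, n mod w)" for j b
    proof (cases "j div 3 < N")
      case j: True
      have t: "j mod 3 = 0 \<or> j mod 3 = 1 \<or> j mod 3 = 2" by linarith
      have "lword w n N W' j = (if j = j0 then x else lword w n N W j)"
      proof (cases "j div 3 = i")
        case True
        then have "j = j0 \<longleftrightarrow> j mod 3 = j0 mod 3" unfolding i_def by (metis div_mult_mod_eq)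
        then show ?thesis
          using t True i by (auto simp: lword[OF k'(1)] lword[OF barrier_at] k'(2) v0_def v1_def v2_def blkW_sel sel_def)
      next
        case False
        then show ?thesis using j by (auto simp: lword[OF k'(1)] lword[OF barrier_at] k'(2) i_def)
      qed
      then show ?thesis using x by simp
    next
      case False
      then have "3 * N \<le> j" by linarith
      then have "bit (W' j) b = bit (W j) b" using k'(3) that by (simp add: same_bits_beyond_def)
      then show ?thesis using False True by (auto simp: lword[OF k'(1)] lword[OF barrier_at])
    qed
    then show ?thesis using k'(1) by (auto simp: j0_def b0_def)
  next
    case False
    then have j0: "3 * N \<le> j0" by linarith
    have W': "W' = W(j0 := x)"
      using False unfolding W'_def editW_def Let_def
      by (simp add: j0_def x_def b0_def put_def)
    have "aW W i = aW W' i" "bW W i = bW W' i" "eW W i = eW W' i" if "i < N" for i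
      using that j0 by (auto simp: W' aW_def bW_def eW_def)
    note eq = this
    have "chain_inv N k (aW W') (bW W') (eW W')"
      by (rule chain_inv_cong[of N "aW W" _ k "bW W" _ "eW W"]) (use eq barrier_at in \<open>auto simp: barrier_at_def\<close>)
    moreover have "bit (W' (n div w)) (n mod w) = bit (W (n div w)) (n mod w)"
    proof (cases "j0 = n div w")
      case True
      then have "b0 \<noteq> n mod w" using pos_ne_flag[of "l - 1"] p by (auto simp: j0_def b0_def)
      then show ?thesis using x False True lword[OF barrier_at, of j0] by (simp add: W')
    qed (simp add: W')
    moreover have "W' (3 * (N - 1) + 1) = W (3 * (N - 1) + 1)" if "k < N"
      using eq(2)[of "N - 1"] that by (simp add: bW_def)
    ultimately have barrier_at': "barrier_at w n N k W'" using barrier_at by (simp add: barrier_at_def)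
    have "block N k W' i = block N k W i" if "i < N" for i
      unfolding block_def by (rule content_cong[symmetric]) (use eq that in auto)
    then have "lword w n N W' j = (if j = j0 then x else lword w n N W j)" for j
      unfolding lword[OF barrier_at'] lword[OF barrier_at] using False by (auto simp: W')
    then have "bit (lword w n N W' j) b = (if j = j0 \<and> b = b0 then v else bit (lword w n N W j) b)" for j b
      using x by auto
    then show ?thesis using barrier_at' by (auto simp: j0_def b0_def)
  qed
qed


lemma div_mod_less: "p < n \<Longrightarrow> j = p div w \<Longrightarrow> j < n div w \<or> (j = n div w \<and> p mod w < n mod w)"
  by (metis div_le_mono div_mult_mod_eq less_imp_le nat_add_left_cancel_less order_le_less)

lemma rest_word:
  assumes "b < w"
  shows "bit (rest_word w n j W) b \<longleftrightarrow> bit (W j) b \<and> j * w + b < n"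
proof -
  have m: "(2::nat) ^ (n mod w) mod 2 ^ w = 2 ^ (n mod w)" using w by simp
  have "j * w + b < n \<longleftrightarrow> j < n div w \<or> j = n div w \<and> b < n mod w"
  proof
    assume "j * w + b < n"
    from div_mod_less[OF this refl] assms show "j < n div w \<or> j = n div w \<and> b < n mod w" by simp
  next
    assume "j < n div w \<or> j = n div w \<and> b < n mod w"
    then show "j * w + b < n"
    proof
      assume "j < n div w"
      then have "Suc j * w \<le> n div w * w" by (intro mult_le_mono1) simp
      also have "\<dots> \<le> n" by simp
      finally show ?thesis using assms by simp
    next
      assume "j = n div w \<and> b < n mod w"
      then show ?thesis by (metis div_mult_mod_eq nat_add_left_cancel_less)
    qed
  qed
  then show ?thesis
    unfolding rest_word_def get_def m by (auto simp: bit_take_bit_iff simp flip: take_bit_eq_mod)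
qed

lemma elem:
  assumes "j * w + L x < n" "L x < w"
  shows "elem w L j x = Suc (j * w + L x)"
  using assms n unfolding elem_def by simp

lemma choiceW:
  assumes barrier_at: "barrier_at w n N k W" and W: "\<And>j. W j < 2 ^ w"
    and L: "\<And>x. x < 2 ^ w \<Longrightarrow> x \<noteq> 0 \<Longrightarrow> L x < w \<and> bit x (L x)"
  defines "S \<equiv> {l \<in> {1..n}. bit (lword w n N W ((l - 1) div w)) ((l - 1) mod w)}"
  shows "if S = {} then choiceW w n N L W = 0 else choiceW w n N L W \<in> S"
proof -
  have S: "elem w L j (lword w n N W j) \<in> S"
    if "lword w n N W j \<noteq> 0" "j div 3 < N" "lword w n N W j < 2 ^ w" for j
  proof -
    let ?x = "lword w n N W j"
    have l: "L ?x < w" "bit ?x (L ?x)" using L that by blast+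
    have "Suc j \<le> n div w" using that(2) N_le by linarith
    then have "Suc j * w \<le> n div w * w" by (rule mult_le_mono1)
    also have "\<dots> \<le> n" by simp
    finally have "j * w + L ?x < n" using l by simp
    then show ?thesis using l by (simp add: elem S_def)
  qed
  have chain_inv: "chain_inv N k (aW W) (bW W) (eW W)" using barrier_at by (simp add: barrier_at_def)
  show ?thesis
  proof (cases "k = 0")
    case False
    define i where "i = mateW w N k W 0"
    have N0: "0 < N" using chain_inv False by (simp add: chain_inv_def)
    have i: "i = mate N k (aW W) 0" using mateW[OF N0] by (simp add: i_def)
    have iN: "i < N" using mate_less[OF N0] i by simp
    have nz: "block N k W i \<noteq> empty3"
    proof (cases "matched N k (aW W) 0")
      case True
      then show ?thesis using chain_inv False N0 matched_sym[OF True N0] by (simp add: i mate_def chain_inv_def block_def)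
    next
      case m: False
      then show ?thesis using chain_inv False N0 by (simp add: i mate_def chain_inv_def block_def)
    qed
    have lt: "cnt0 w N k W i < 2 ^ w" "cnt1 w N k W i < 2 ^ w" "cnt2 w N k W i < 2 ^ w"
      using W by (auto simp: cnt0_def cnt1_def cnt2_def get_def)
    have div3: "Suc (3 * i) div 3 = i" "Suc (Suc (3 * i)) div 3 = i" "Suc (3 * i) mod 3 = Suc 0"
      "Suc (Suc (3 * i)) mod 3 = 2"
      by presburger+
    have lw: "lword w n N W (adr w 0 i) = cnt0 w N k W i" "lword w n N W (adr w 1 i) = cnt1 w N k W i"
      "lword w n N W (adr w 2 i) = cnt2 w N k W i"
      using iN div3 by (simp_all add: lword[OF barrier_at] adr blkW_sel)
    have d: "adr w 0 i div 3 < N" "adr w 1 i div 3 < N" "adr w 2 i div 3 < N"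
      using iN div3 by (simp_all add: adr)
    have "choiceW w n N L W = (if cnt0 w N k W i \<noteq> 0 then elem w L (adr w 0 i) (cnt0 w N k W i)
       else if cnt1 w N k W i \<noteq> 0 then elem w L (adr w 1 i) (cnt1 w N k W i)
       else elem w L (adr w 2 i) (cnt2 w N k W i))"
      using False by (simp add: choiceW_def readK[OF barrier_at] Let_def i_def)
    moreover have "cnt0 w N k W i \<noteq> 0 \<or> cnt1 w N k W i \<noteq> 0 \<or> cnt2 w N k W i \<noteq> 0"
      using nz by (auto simp: empty3_def blkW[OF iN, symmetric])
    ultimately have "choiceW w n N L W \<in> S"
      using S[of "adr w 0 i"] S[of "adr w 1 i"] S[of "adr w 2 i"] lt d unfolding lw by auto
    then show ?thesis by auto
  next
    case True
    \<comment> \<open>A match needs a left partner, and for \<open>k = 0\<close> there are no left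
      blocks.\<close>
    have "block N k W i = empty3" if "i < N" for i
      using chain_inv that True unfolding chain_inv_def block_def matched_def by auto
    then have lw: "lword w n N W j = (if j div 3 < N then 0 else W j)" for j
      by (simp add: lword[OF barrier_at] sel_def empty3_def)
    define r where "r t = rest_word w n (adr w t N) W" for t
    have ch: "choiceW w n N L W = (if r 0 \<noteq> 0 then elem w L (adr w 0 N) (r 0)
       else if r 1 \<noteq> 0 then elem w L (adr w 1 N) (r 1)
       else if r 2 \<noteq> 0 then elem w L (adr w 2 N) (r 2) else 0)"
      using True by (simp add: choiceW_def readK[OF barrier_at] Let_def r_def)
    have rS: "elem w L (adr w t N) (r t) \<in> S" if "r t \<noteq> 0" "t < 3" for t
    proof -
      have "r t < 2 ^ w"
        using W[of "adr w t N"] by (auto simp: r_def rest_word_def get_def intro: le_less_trans[OF mod_less_eq_dividend])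
      with L that have l: "L (r t) < w" "bit (r t) (L (r t))" by blast+
      with rest_word have b: "bit (W (3 * N + t)) (L (r t))" "(3 * N + t) * w + L (r t) < n"
        unfolding r_def using that by (auto simp: adr)
      then show ?thesis
        using l that by (simp add: adr elem S_def lw)
    qed
    have "r (p div w - 3 * N) \<noteq> 0 \<and> p div w - 3 * N < 3"
      if p: "p < n" "bit (lword w n N W (p div w)) (p mod w)" for p
    proof -
      have "3 * N \<le> p div w" using p(2) by (auto simp: lw not_less split: if_splits)
      moreover have "p div w \<le> 3 * N + 2" using p(1) N_le(2) by (meson div_le_mono le_trans less_imp_le)
      ultimately have j: "p div w - 3 * N < 3" "adr w (p div w - 3 * N) N = p div w"
        by (simp_all add: adr)
      have "bit (r (p div w - 3 * N)) (p mod w)"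
        unfolding r_def j using p w by (auto simp: rest_word lw split: if_splits)
      moreover have "\<not> bit (0 :: nat) (p mod w)" by simp
      ultimately show ?thesis using j by metis
    qed
    note ex = this
    show ?thesis
    proof (cases "r 0 = 0 \<and> r 1 = 0 \<and> r 2 = 0")
      case True
      have "S = {}"
      proof (rule ccontr)
        assume "S \<noteq> {}"
        then obtain l where "l \<in> S" by blast
        then have "l - 1 < n" "bit (lword w n N W ((l - 1) div w)) ((l - 1) mod w)"
          by (auto simp: S_def)
        from ex[OF this] True show False
          by (metis One_nat_def Suc_1 less_2_cases less_Suc_eq numeral_3_eq_3)
      qed
      then show ?thesis using ch True by simp
    next
      case False
      then have "choiceW w n N L W \<in> S"
        using rS[of 0] rS[of 1] rS[of 2] unfolding ch by auto
      then show ?thesis by auto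
    qed
  qed
qed

lemma clear_rest:
  assumes "b < w"
  shows "bit (clear_rest w n j W i) b \<longleftrightarrow> bit (W i) b \<and> \<not> (i = j \<and> j * w + b < n)"
proof -
  have m: "(2::nat) ^ (n mod w) mod 2 ^ w = 2 ^ (n mod w)" using w by simp
  have "x - x mod 2 ^ d = push_bit d (drop_bit d x)" for x d :: nat
    by (simp add: push_bit_eq_mult drop_bit_eq_div minus_mod_eq_div_mult)
  then show ?thesis
    using rest_word[OF assms, of j W] assms
    unfolding clear_rest_def rest_word_def get_def m put_def
    by (auto simp: bit_push_bit_iff bit_drop_bit_eq bit_take_bit_iff simp flip: take_bit_eq_mod)
qed

lemma initW:
  assumes W: "\<And>j. W j < 2 ^ w"
  defines "W' \<equiv> initW w n N W"
  shows "barrier_at w n N 0 W'" "l - 1 < n \<Longrightarrow> \<not> bit (lword w n N W' ((l - 1) div w)) ((l - 1) mod w)"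
    "n < p \<Longrightarrow> bit (W' (p div w)) (p mod w) = bit (W (p div w)) (p mod w)"
proof -
  define W1 where "W1 = clear_rest w n (3 * N) (clear_rest w n (3 * N + 1) (clear_rest w n (3 * N + 2) W))"
  have *: "W' = writeK w n N 0 W1" by (simp add: W'_def initW_def W1_def adr)
  \<comment> \<open>With the barrier at 0 nothing can be matched, so arbitrary initial memory
    represents empty blocks.\<close>
  have e: "content N 0 A B E i = empty3" for A B E i by (simp add: content_def matched_def)
  have chain_inv: "chain_inv N 0 (aW W1) (bW W1) (eW W1)" by (simp add: chain_inv_def e) (simp add: matched_def)
  note wr = writeK[OF chain_inv, folded *]
  show barrier_at: "barrier_at w n N 0 W'" by (rule wr(1))
  have W1: "bit (W1 (p div w)) (p mod w) \<longleftrightarrow> bit (W (p div w)) (p mod w) \<and> \<not> (p div w \<in> {3 * N, 3 * N + 1, 3 * N + 2} \<and> p < n)" for p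
  proof -
    have "bit (W1 j) b \<longleftrightarrow> bit (W j) b \<and> \<not> (j \<in> {3 * N, 3 * N + 1, 3 * N + 2} \<and> j * w + b < n)"
      if "b < w" for j b
      using that unfolding W1_def clear_rest[OF that] by auto
    from this[of "p mod w" "p div w"] w show ?thesis by simp
  qed
  have same: "bit (W' (p div w)) (p mod w) = bit (W1 (p div w)) (p mod w)" if "3 * N \<le> p div w" "p \<noteq> n" for p
    using wr(3) that pos_ne_flag[OF that(2)] unfolding same_bits_beyond_def by blast
  show "\<not> bit (lword w n N W' ((l - 1) div w)) ((l - 1) mod w)" if l: "l - 1 < n"
  proof (cases "(l - 1) div w div 3 < N")
    case True
    then show ?thesis by (simp add: lword[OF barrier_at] block_def e sel_def) (simp add: empty3_def)
  next
    case False
    then have "3 * N \<le> (l - 1) div w" by linarith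
    moreover have "(l - 1) div w \<le> 3 * N + 2" using l N_le(2) by (meson div_le_mono le_trans less_imp_le)
    ultimately have "(l - 1) div w \<in> {3 * N, 3 * N + 1, 3 * N + 2}" "3 * N \<le> (l - 1) div w" by auto
    then show ?thesis using False W1 l same[of "l - 1"] by (simp add: lword[OF barrier_at])
  qed
  show "bit (W' (p div w)) (p mod w) = bit (W (p div w)) (p mod w)" if "n < p"
    using same[of p] W1[of p] that N_le(1) div_le_mono[of n p w] by auto
qed

end

section \<open>The index of a bit in a word\<close>

lemma sum_pow_mult: "(\<Sum>t<m. (Suc q) ^ t) * q = Suc q ^ m - 1"
  by (induction m) (auto simp: algebra_simps)

text \<open>The way to create a word with \<open>m\<close> ones at distance \<open>h\<close> in
  constant time: a single division.\<close>

lemma geometric_div: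
  assumes "0 < h"
  shows "(2 ^ (m * h) - 1) div (2 ^ h - 1) = (\<Sum>t<m. 2 ^ (h * t) :: nat)"
proof -
  obtain q where q: "2 ^ h = Suc q" by (metis gr0_implies_Suc zero_less_numeral zero_less_power)
  have "(2::nat) ^ 1 \<le> 2 ^ h" using assms by (intro power_increasing) auto
  with q have "0 < q" by simp
  moreover have "2 ^ (m * h) - 1 = (\<Sum>t<m. Suc q ^ t) * q"
    by (simp add: sum_pow_mult power_mult q mult.commute[of m])
  ultimately show ?thesis by (simp add: power_mult q)
qed

text \<open>Modulo the square of M = 2 ^ h - 1, the power (1 + M) ^ b is 1 + b * M.\<close>

lemma exponent_from_mod:
  assumes "2 \<le> h" "b < 2 ^ h - 1"
  shows "2 ^ (h * b) mod (2 ^ h - 1)\<^sup>2 div (2 ^ h - 1) = (b :: nat)"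
proof -
  define M where "M = (2::nat) ^ h - 1"
  have "(2::nat) ^ 2 \<le> 2 ^ h" using assms by (intro power_increasing) auto
  then have M: "1 < M" "2 ^ h = Suc M" by (auto simp: M_def)
  have "\<exists>c. Suc M ^ b = 1 + b * M + M\<^sup>2 * c"
  proof (induction b)
    case (Suc b)
    then obtain c where "Suc M ^ b = 1 + b * M + M\<^sup>2 * c" by blast
    then have "Suc M ^ Suc b = 1 + Suc b * M + M\<^sup>2 * (b + c + M * c)"
      by (simp add: algebra_simps power2_eq_square)
    then show ?case by blast
  qed auto
  then obtain c where c: "2 ^ (h * b) = 1 + b * M + M\<^sup>2 * c"
    by (auto simp: power_mult M)
  have "Suc b * M \<le> M * M" using assms(2) by (intro mult_le_mono1) (simp add: M_def)
  then have "1 + b * M < M\<^sup>2" using M by (simp add: power2_eq_square)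
  then have "2 ^ (h * b) mod M\<^sup>2 = 1 + b * M" unfolding c by simp
  moreover have "(1 + b * M) div M = b" by (rule div_nat_eqI) (use M(1) in auto)
  ultimately show ?thesis unfolding M_def[symmetric] by simp
qed

lemma bit_sum_image:
  fixes e :: "nat \<Rightarrow> nat"
  assumes "inj_on e {..<m}"
  shows "bit (\<Sum>t<m. 2 ^ e t :: nat) p \<longleftrightarrow> (\<exists>t<m. p = e t)"
proof -
  have "(\<Sum>t<m. 2 ^ e t :: nat) = (\<Sum>i\<in>e ` {..<m}. 2 ^ i)"
    by (simp add: sum.reindex[OF assms])
  then show ?thesis using bit_sum_pow2[of "e ` {..<m}" p] by auto
qed

text \<open>Copies of a power of 2 at distance g, masked with bits at distance g + 1, leave the single
bit number (g + 1) * b.\<close>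

lemma spread_power:
  assumes "b < g"
  shows "Bit_Operations.and (2 ^ b * (\<Sum>t<g. 2 ^ (g * t))) (\<Sum>t<g. 2 ^ (Suc g * t)) = (2 :: nat) ^ (Suc g * b)"
proof (rule bit_eqI)
  fix p
  have g: "0 < g" using assms by simp
  have 1: "bit (2 ^ b * (\<Sum>t<g. 2 ^ (g * t)) :: nat) p \<longleftrightarrow> (\<exists>t<g. p = b + g * t)"
    unfolding sum_distrib_left power_add[symmetric]
    by (rule bit_sum_image) (use g in \<open>auto simp: inj_on_def\<close>)
  have 2: "bit (\<Sum>t<g. 2 ^ (Suc g * t) :: nat) p \<longleftrightarrow> (\<exists>t<g. p = Suc g * t)"
    by (rule bit_sum_image, rule inj_onI) (metis Suc_not_Zero mult_cancel1)
  \<comment> \<open>Modulo \<open>g\<close> the two positions are \<open>b\<close> and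
    \<open>t'\<close>, both below \<open>g\<close>, so they coincide only for
    \<open>t' = b\<close>.\<close>
  have "t = b \<and> t' = b" if "b + g * t = Suc g * t'" "t < g" "t' < g" for t t'
  proof -
    from that have *: "g * t + b = g * t' + t'" by simp
    from arg_cong[OF this, of "\<lambda>x. x mod g"] have "b = t'" using assms that by simp
    with * g show ?thesis by simp
  qed
  then have "(\<exists>t<g. p = b + g * t) \<and> (\<exists>t<g. p = Suc g * t) \<longleftrightarrow> p = Suc g * b"
    using assms by (auto intro!: exI[of _ b])
  then show "bit (Bit_Operations.and (2 ^ b * (\<Sum>t<g. 2 ^ (g * t))) (\<Sum>t<g. 2 ^ (Suc g * t)) :: nat) p
      = bit ((2 :: nat) ^ (Suc g * b)) p"
    unfolding bit_and_iff 1 2 bit_exp_iff by auto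
qed

text \<open>Binary logarithm of \<open>z = 2 ^ b\<close> for \<open>b < g\<close>. The division
  trick of \<open>exponent_from_mod\<close> needs an exponent that is a multiple of the field width.
  Multiplication by \<open>u\<close> (ones at distance \<open>g\<close>) and masking with
  \<open>u'\<close> (ones at distance \<open>h = g + 1\<close>) therefore first turn
  \<open>2 ^ b\<close> into \<open>2 ^ (h * b)\<close>.\<close>

definition lgW :: "nat \<Rightarrow> nat \<Rightarrow> nat \<Rightarrow> nat" where
  "lgW w g z = (let q = 2 ^ g mod 2 ^ w - 1; h = (g + 1) mod 2 ^ w; q' = 2 ^ h mod 2 ^ w - 1;
     u = (2 ^ ((g * g) mod 2 ^ w) mod 2 ^ w - 1) div q; u' = (2 ^ ((g * h) mod 2 ^ w) mod 2 ^ w - 1) div q'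
     in Bit_Operations.and ((z * u) mod 2 ^ w) u' mod ((q' * q') mod 2 ^ w) div q')"

text \<open>For y = 2 ^ (g * a + b) with b < g, the residue of y modulo 2 ^ g - 1 is z = 2 ^ b.\<close>

definition idxW :: "nat \<Rightarrow> nat \<Rightarrow> nat \<Rightarrow> nat" where
  "idxW w g y = (let q = 2 ^ g mod 2 ^ w - 1; z = y mod q; a = (y div z) mod ((q * q) mod 2 ^ w) div q
     in ((g * a) mod 2 ^ w + lgW w g z) mod 2 ^ w)"

definition lsbW :: "nat \<Rightarrow> nat \<Rightarrow> nat \<Rightarrow> nat" where
  "lsbW w g x = idxW w g (x - Bit_Operations.and x (x - 1))"

text \<open>The upper bound on \<open>g\<close> makes the masks of \<open>lgW\<close>, of up to
  \<open>g * (g + 1)\<close> bits, fit into a word. The last condition bounds the quotient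
  \<open>a\<close> of a bit index by \<open>g\<close>, giving \<open>a < 2 ^ g - 1\<close> as
  \<open>exponent_from_mod\<close> requires.\<close>

definition good_field :: "nat \<Rightarrow> nat \<Rightarrow> bool" where
  "good_field w g \<longleftrightarrow> 2 \<le> g \<and> g * (g + 1) < w \<and> w \<le> g * (2 ^ g - 1)"

lemma good_field_bounds:
  assumes "good_field w g"
  shows "g + 1 < 2 ^ w" "g * g < w" "w < 2 ^ w" "2 * g + 2 \<le> w" "g < w" "g + 1 < w"
proof -
  show w: "w < 2 ^ w" by simp
  have g: "2 \<le> g" "g * g + g < w" using assms by (simp_all add: good_field_def algebra_simps)
  have "2 * g \<le> g * g" using g by simp
  with g show "g * g < w" "2 * g + 2 \<le> w" "g < w" "g + 1 < w" by linarith+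
  with w show "g + 1 < 2 ^ w" by linarith
qed

lemma lgW:
  assumes "good_field w g" "b < g"
  shows "lgW w g (2 ^ b) = b"
proof -
  note bd = good_field_bounds[OF assms(1)]
  have gg: "2 \<le> g" "g * (g + 1) < w" using assms by (simp_all add: good_field_def)
  define U where "U = (\<Sum>t<g. 2 ^ (g * t) :: nat)"
  define U' where "U' = (\<Sum>t<g. 2 ^ (Suc g * t) :: nat)"
  have U: "(2 ^ (g * g) - 1) div (2 ^ g - 1) = U"
    using geometric_div[of g g] gg by (simp add: U_def)
  have U': "(2 ^ (g * Suc g) - 1) div (2 ^ Suc g - 1) = U'"
    using geometric_div[of "Suc g" g] by (simp add: U'_def)
  have lt: "x < w \<Longrightarrow> x < 2 ^ w" for x by (rule less_trans[OF _ bd(3)])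
  have lts: "g * Suc g < 2 ^ w" "g * g < 2 ^ w" "Suc g < 2 ^ w"
    by (rule lt; use bd gg in simp)+
  have m: "g * Suc g mod 2 ^ w = g * Suc g" "g * g mod 2 ^ w = g * g" "(2::nat) ^ g mod 2 ^ w = 2 ^ g"
    "(2::nat) ^ (g * g) mod 2 ^ w = 2 ^ (g * g)" "(2::nat) ^ (g * Suc g) mod 2 ^ w = 2 ^ (g * Suc g)"
    "(2::nat) ^ Suc g mod 2 ^ w = 2 ^ Suc g" "(g + 1) mod 2 ^ w = Suc g"
    using bd gg by (simp_all add: mod_less[OF lts(1)] mod_less[OF lts(2)] mod_less[OF lts(3)]
        del: power_Suc mult_Suc_right)
  have "2 ^ b * U \<le> (2 ^ g - 1) * U"
  proof (rule mult_le_mono1)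
    have "(2::nat) ^ b < 2 ^ g" using assms by simp
    then show "(2::nat) ^ b \<le> 2 ^ g - 1" by linarith
  qed
  also have "\<dots> \<le> 2 ^ (g * g) - 1" unfolding U[symmetric] by simp
  also have "\<dots> < 2 ^ w"
  proof -
    have "(2::nat) ^ (g * g) < 2 ^ w" using bd by simp
    then show ?thesis by linarith
  qed
  finally have z: "2 ^ b * U mod 2 ^ w = 2 ^ b * U" by simp
  have "((2::nat) ^ Suc g - 1) * (2 ^ Suc g - 1) < 2 ^ Suc g * 2 ^ Suc g"
    by (intro mult_strict_mono) auto
  also have "\<dots> = 2 ^ (Suc g + Suc g)" by (simp only: power_add)
  also have "\<dots> \<le> 2 ^ w" using bd by (intro power_increasing) auto
  finally have q: "((2::nat) ^ Suc g - 1) * (2 ^ Suc g - 1) mod 2 ^ w = (2 ^ Suc g - 1)\<^sup>2"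
    by (simp add: power2_eq_square)
  have "b < 2 ^ g" using assms(2) less_exp by (rule less_trans)
  then have "b < 2 ^ Suc g - 1" unfolding power_Suc by linarith
  from exponent_from_mod[OF _ this] gg have
    "2 ^ (Suc g * b) mod (2 ^ Suc g - 1)\<^sup>2 div (2 ^ Suc g - 1) = b" by simp
  then show ?thesis
    unfolding lgW_def Let_def m U U' z q using spread_power[OF assms(2)] by (simp only: U_def U'_def)
qed

text \<open>Write \<open>i = g * a + b\<close>. Since \<open>2 ^ g\<close> is 1 modulo
  \<open>M = 2 ^ g - 1\<close>, the residue of \<open>2 ^ i\<close> is \<open>2 ^ b\<close>, which
  is below \<open>M\<close> because \<open>g\<close> is at least 2. Dividing it out leaves
  \<open>2 ^ (g * a)\<close>, from which \<open>a\<close> is extracted modulo the square of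
  \<open>M\<close>.\<close>

lemma idxW:
  assumes "good_field w g" "i < w"
  shows "idxW w g (2 ^ i) = i"
proof -
  note bd = good_field_bounds[OF assms(1)]
  have g: "2 \<le> g" "w \<le> g * (2 ^ g - 1)" using assms by (simp_all add: good_field_def)
  define M where "M = (2::nat) ^ g - 1"
  have "(2::nat) ^ 2 \<le> 2 ^ g" using g by (intro power_increasing) auto
  then have M: "1 < M" "2 ^ g = Suc M" by (auto simp: M_def)
  have m: "(2::nat) ^ g mod 2 ^ w = 2 ^ g" using bd by simp
  define a b where "a = i div g" and "b = i mod g"
  have i: "i = g * a + b" and b: "b < g" using g by (simp_all add: a_def b_def)
  have a: "a < M" unfolding a_def M_def using assms(2) g
    by (metis less_le_trans less_mult_imp_div_less mult.commute)
  have y: "2 ^ i = 2 ^ b * Suc M ^ a" by (simp add: i power_add power_mult M)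
  have "Suc M ^ a mod M = 1" using M(1) power_mod[of "Suc M" M a] by (simp add: mod_Suc)
  then have "2 ^ i mod M = 2 ^ b mod M" unfolding y
    by (metis mod_mult_right_eq mult.right_neutral)
  moreover have "(2::nat) ^ b < M"
  proof -
    have "(2::nat) * 2 ^ b \<le> 2 ^ g" using b by (metis Suc_leI power_Suc power_increasing one_le_numeral)
    moreover have "(2::nat) ^ b * 2 \<noteq> 2" if "b \<noteq> 0" using that by simp
    ultimately show ?thesis using M by (cases "b = 0") auto
  qed
  ultimately have z: "2 ^ i mod M = 2 ^ b" by simp
  have d: "2 ^ i div (2 ^ b) = (2::nat) ^ (g * a)" by (simp add: i power_add)
  have "M * M < 2 ^ g * 2 ^ g" using M by (intro mult_strict_mono) auto
  also have "\<dots> = 2 ^ (2 * g)" by (simp add: mult_2 power_add)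
  also have "\<dots> \<le> 2 ^ w" using bd by (intro power_increasing) auto
  finally have q: "M * M mod 2 ^ w = M\<^sup>2" by (simp add: power2_eq_square)
  have ea: "2 ^ (g * a) mod M\<^sup>2 div M = a"
    using exponent_from_mod[OF g(1), of a] a by (simp add: M_def)
  have "i < 2 ^ w" using assms(2) bd(3) by linarith
  then show ?thesis
    unfolding idxW_def Let_def m M_def[symmetric] z d q ea lgW[OF assms(1) b]
    by (simp add: mod_add_left_eq flip: i)
qed

lemma lowest_bit:
  "x \<noteq> 0 \<Longrightarrow> \<exists>i. x - Bit_Operations.and x (x - 1) = 2 ^ i \<and> bit (x :: nat) i"
proof (induction x rule: less_induct)
  case (less x)
  show ?case
  proof (cases "even x")
    case True
    then obtain y where y: "x = 2 * y" by blast
    with less.prems less.IH[of y] obtain i where i: "y - Bit_Operations.and y (y - 1) = 2 ^ i" "bit y i"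
      by auto
    have "x - 1 = 2 * (y - 1) + 1" using y less.prems by simp
    then have "Bit_Operations.and x (x - 1) = 2 * Bit_Operations.and y (y - 1)"
      unfolding y by (subst and_nat_rec) simp
    then have "x - Bit_Operations.and x (x - 1) = 2 ^ Suc i" using i(1) y
      by (simp add: diff_mult_distrib2[symmetric])
    moreover have "bit x (Suc i)" using i(2) y by (simp add: bit_Suc)
    ultimately show ?thesis by blast
  next
    case False
    then obtain y where y: "x = 2 * y + 1" by (metis oddE)
    have "Bit_Operations.and x (x - 1) = 2 * y"
      unfolding y by (simp add: and_nat_rec[of "Suc (2 * y)" "2 * y"])
    with y have "x - Bit_Operations.and x (x - 1) = 2 ^ 0" "bit x 0" by (simp_all add: bit_0)
    then show ?thesis by blast
  qed
qed

lemma lsbW: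
  assumes "good_field w g" "x < 2 ^ w" "x \<noteq> 0"
  shows "lsbW w g x < w \<and> bit x (lsbW w g x)"
proof -
  obtain i where i: "x - Bit_Operations.and x (x - 1) = 2 ^ i" "bit x i"
    using lowest_bit[OF assms(3)] by blast
  have "i < w" using i(2) assms(2) unfolding less_pow2_iff_bits by (meson not_le)
  then show ?thesis using i idxW[OF assms(1)] by (simp add: lsbW_def)
qed


section \<open>Computability of the word-level operations\<close>

lemma compP_let:
  assumes "computable D f" "\<And>F. computable D F \<Longrightarrow> computableP D (\<lambda>c. G c (F c))"
  shows "computableP D (\<lambda>c. let x = f c in G c x)"
  using assms by (simp add: Let_def)

lemma compP_const: "D \<subseteq> ok_ctx \<Longrightarrow> computableP D (\<lambda>_. b)"
  by (cases b) (simp_all add: compP_True compP_False)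

lemma comp_adr: "computable D I \<Longrightarrow> computable D (\<lambda>c. adr (cw c) t (I c))"
  unfolding adr_def
  using comp_add[OF comp_mult[OF comp_const[of D 3]] comp_const[of D t], of I] comp_ok[of D I]
  by (simp add: mod_simps)

text \<open>The rules for results reduced modulo \<open>2 ^ cw c\<close> precede
  \<open>comp_mod\<close>, which would match the same terms but ask for the modulus
  \<open>2 ^ cw c\<close>, a number that is not a word.\<close>

lemmas comp_rules =
  comp_if comp_let comp_get comp_of_bool comp_adr comp_0 comp_1 comp_Suc_0
  comp_pow2 comp_add comp_mult comp_mod comp_diff comp_div comp_and comp_or comp_xor
  comp_cn comp_cl
  compP_if compP_let compP_conj compP_disj compP_not compP_eq compP_less compP_le compP_bit compP_const
  compM_if compM_let compM_letM compM_put compM_cW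

lemma comp_lgW:
  "computable D g \<Longrightarrow> computable D z \<Longrightarrow> computable D (\<lambda>c. lgW (cw c) (g c) (z c))"
  unfolding lgW_def by (assumption | rule comp_rules | erule comp_ok)+

lemma comp_idxW:
  "computable D g \<Longrightarrow> computable D y \<Longrightarrow> computable D (\<lambda>c. idxW (cw c) (g c) (y c))"
  unfolding idxW_def by (assumption | rule comp_lgW comp_rules | erule comp_ok)+

lemma comp_lsbW:
  "computable D g \<Longrightarrow> computable D y \<Longrightarrow> computable D (\<lambda>c. lsbW (cw c) (g c) (y c))"
  unfolding lsbW_def by (assumption | rule comp_idxW comp_rules | erule comp_ok)+

text \<open>The word length is one more than the index of the highest bit of a word.\<close>

lemma comp_cw:
  assumes "computable D g" "\<And>c. c \<in> D \<Longrightarrow> good_field (cw c) (g c)"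
  shows "computable D cw"
proof -
  have ok: "D \<subseteq> ok_ctx" by (rule comp_ok[OF assms(1)])
  have "computable D (\<lambda>c. nat ((int 0 - int 1) mod 2 ^ cw c))"
    using comp_bin[OF comp_0[OF ok] comp_1[OF ok], of BSub] by simp
  then have ones: "computable D (\<lambda>c. 2 ^ cw c - 1)"
  proof (rule comp_cong)
    fix c
    have "(- 1 :: int) mod 2 ^ cw c = 2 ^ cw c - 1" by (simp add: zmod_minus1)
    then show "nat ((int 0 - int 1) mod 2 ^ cw c) = 2 ^ cw c - 1"
      by (simp add: nat_diff_distrib nat_power_eq)
  qed
  \<comment> \<open>All ones minus its half is the highest bit
    \<open>2 ^ (cw c - 1)\<close>.\<close>
  have "computable D (\<lambda>c. idxW (cw c) (g c) ((2 ^ cw c - 1) - (2 ^ cw c - 1) div 2 ^ 1))"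
    by (intro comp_idxW comp_diff comp_shr assms(1) ones comp_1[OF ok])
  then have "computable D (\<lambda>c. (idxW (cw c) (g c) ((2 ^ cw c - 1) - (2 ^ cw c - 1) div 2 ^ 1) + 1) mod 2 ^ cw c)"
    by (intro comp_add comp_1[OF ok])
  then show ?thesis
  proof (rule comp_cong)
    fix c assume c: "c \<in> D"
    obtain v where v: "cw c = Suc v" using ok c by (cases "cw c") (auto simp: ok_ctx_def)
    have "(2::nat) ^ cw c - 1 - (2 ^ cw c - 1) div 2 ^ 1 = 2 ^ v"
      unfolding v by (cases "(2::nat) ^ v") auto
    moreover have "idxW (cw c) (g c) (2 ^ v) = v"
      by (rule idxW[OF assms(2)[OF c]]) (simp add: v)
    moreover have "cw c < 2 ^ cw c" by simp
    ultimately show "(idxW (cw c) (g c) ((2 ^ cw c - 1) - (2 ^ cw c - 1) div 2 ^ 1) + 1) mod 2 ^ cw c = cw c"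
      by (simp add: v)
  qed
qed

lemma compP_matchedW:
  "computable D N \<Longrightarrow> computable D K \<Longrightarrow> computableM D M \<Longrightarrow> computable D I \<Longrightarrow>
   computableP D (\<lambda>c. matchedW (cw c) (N c) (K c) (M c) (I c))"
  unfolding matchedW_def by (assumption | rule comp_rules | erule comp_ok)+

lemma comp_mateW:
  "computable D N \<Longrightarrow> computable D K \<Longrightarrow> computableM D M \<Longrightarrow> computable D I \<Longrightarrow>
   computable D (\<lambda>c. mateW (cw c) (N c) (K c) (M c) (I c))"
  unfolding mateW_def by (assumption | rule compP_matchedW comp_rules | erule comp_ok)+

lemma comp_cntW:
  "computable D N \<Longrightarrow> computable D K \<Longrightarrow> computableM D M \<Longrightarrow> computable D I \<Longrightarrow>
   computable D (\<lambda>c. cnt0 (cw c) (N c) (K c) (M c) (I c))"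
  "computable D N \<Longrightarrow> computable D K \<Longrightarrow> computableM D M \<Longrightarrow> computable D I \<Longrightarrow>
   computable D (\<lambda>c. cnt1 (cw c) (N c) (K c) (M c) (I c))"
  "computable D N \<Longrightarrow> computable D K \<Longrightarrow> computableM D M \<Longrightarrow> computable D I \<Longrightarrow>
   computable D (\<lambda>c. cnt2 (cw c) (N c) (K c) (M c) (I c))"
  unfolding cnt0_def cnt1_def cnt2_def by (assumption | rule compP_matchedW comp_rules | erule comp_ok)+

lemmas comp_rules1 = compP_matchedW comp_mateW comp_cntW comp_rules

lemma compM_clearW:
  "computable D N \<Longrightarrow> computable D K \<Longrightarrow> computableM D M \<Longrightarrow> computable D I \<Longrightarrow>
   computableM D (\<lambda>c. clearW (cw c) (N c) (K c) (M c) (I c))"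
  unfolding clearW_def by (assumption | rule comp_rules1 | erule comp_ok)+

lemma compM_break_linkW:
  "computable D N \<Longrightarrow> computable D K \<Longrightarrow> computableM D M \<Longrightarrow> computable D I \<Longrightarrow>
   computableM D (\<lambda>c. break_linkW (cw c) (N c) (K c) (I c) (M c))"
  unfolding break_linkW_def by (assumption | rule comp_rules1 | erule comp_ok)+

lemma compM_plainW:
  "computable D N \<Longrightarrow> computable D K \<Longrightarrow> computableM D M \<Longrightarrow> computable D I \<Longrightarrow>
   computable D v0 \<Longrightarrow> computable D v1 \<Longrightarrow> computable D v2 \<Longrightarrow>
   computableM D (\<lambda>c. plainW (cw c) (N c) (K c) (I c) (v0 c) (v1 c) (v2 c) (M c))"
  unfolding plainW_def by (assumption | rule compM_break_linkW comp_rules1 | erule comp_ok)+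

lemma compM_fillW:
  "computable D N \<Longrightarrow> computable D K \<Longrightarrow> computableM D M \<Longrightarrow> computable D I \<Longrightarrow>
   computable D v0 \<Longrightarrow> computable D v1 \<Longrightarrow> computable D v2 \<Longrightarrow>
   computableM D (\<lambda>c. fillW (cw c) (N c) (K c) (M c) (I c) (v0 c) (v1 c) (v2 c))"
  unfolding fillW_def by (assumption | rule compM_plainW comp_rules1 | erule comp_ok)+

lemma comp_setb:
  "computableP D V \<Longrightarrow> computable D B \<Longrightarrow> computable D X \<Longrightarrow> computable D (\<lambda>c. setb (cw c) (V c) (B c) (X c))"
  unfolding setb_def by (assumption | rule comp_rules | erule comp_ok)+

lemma comp_readK:
  "computable D cw \<Longrightarrow> computable D N \<Longrightarrow> computableM D M \<Longrightarrow> computable D (\<lambda>c. readK (cw c) (cn c) (N c) (M c))"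
  unfolding readK_def by (assumption | rule comp_rules | erule comp_ok)+

lemma compM_writeK:
  "computable D cw \<Longrightarrow> computable D N \<Longrightarrow> computable D K \<Longrightarrow> computableM D M \<Longrightarrow>
   computableM D (\<lambda>c. writeK (cw c) (cn c) (N c) (K c) (M c))"
  unfolding writeK_def by (assumption | rule comp_setb comp_rules | erule comp_ok)+

lemmas comp_rules2 = comp_readK compM_writeK compM_clearW compM_fillW comp_setb comp_rules1

lemma compM_updW:
  "computable D cw \<Longrightarrow> computable D N \<Longrightarrow> computableM D M \<Longrightarrow> computable D I \<Longrightarrow>
   computable D v0 \<Longrightarrow> computable D v1 \<Longrightarrow> computable D v2 \<Longrightarrow>
   computableM D (\<lambda>c. updW (cw c) (cn c) (N c) (I c) (v0 c) (v1 c) (v2 c) (M c))"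
  unfolding updW_def by (assumption | rule comp_rules2 | erule comp_ok)+

context
  fixes D :: "ctx set"
  assumes two: "\<And>c. c \<in> D \<Longrightarrow> 2 \<le> cw c"
begin

lemma comp_2_3:
  assumes "D \<subseteq> ok_ctx"
  shows "computable D (\<lambda>c. 2)" "computable D (\<lambda>c. 3)"
proof -
  have 3: "3 < (2::nat) ^ cw c" if "c \<in> D" for c
    using power_increasing[OF two[OF that], of "2::nat"] by simp
  have 2: "2 < (2::nat) ^ cw c" if "c \<in> D" for c
    by (rule less_trans[OF _ 3[OF that]]) simp
  show "computable D (\<lambda>c. 2)" "computable D (\<lambda>c. 3)"
    by (rule comp_const_less[OF assms], erule 2 3)+
qed

lemma comp_lword:
  "computable D cw \<Longrightarrow> computable D N \<Longrightarrow> computableM D M \<Longrightarrow> computable D J \<Longrightarrow>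
   computable D (\<lambda>c. lword (cw c) (cn c) (N c) (M c) (J c))"
  unfolding lword_def by (assumption | rule comp_rules2 comp_2_3 | erule comp_ok)+

lemma compM_editW:
  "computable D cw \<Longrightarrow> computable D N \<Longrightarrow> computableM D M \<Longrightarrow>
   computableM D (\<lambda>c. editW (cw c) (cn c) (N c) v (cl c) (M c))"
  unfolding editW_def by (assumption | rule compM_updW comp_lword comp_rules2 comp_2_3 | erule comp_ok)+

lemma compP_containsW:
  "computable D cw \<Longrightarrow> computable D N \<Longrightarrow> computableM D M \<Longrightarrow>
   computableP D (\<lambda>c. containsW (cw c) (cn c) (N c) (cl c) (M c))"
  unfolding containsW_def by (assumption | rule comp_lword comp_rules2 comp_2_3 | erule comp_ok)+

lemma compM_clear_rest:
  "computable D cw \<Longrightarrow> computable D J \<Longrightarrow> computableM D M \<Longrightarrow>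
   computableM D (\<lambda>c. clear_rest (cw c) (cn c) (J c) (M c))"
  unfolding clear_rest_def by (assumption | rule comp_rules2 comp_2_3 | erule comp_ok)+

lemma compM_initW:
  "computable D cw \<Longrightarrow> computable D N \<Longrightarrow> computableM D M \<Longrightarrow> computableM D (\<lambda>c. initW (cw c) (cn c) (N c) (M c))"
  unfolding initW_def by (assumption | rule compM_clear_rest comp_rules2 comp_2_3 | erule comp_ok)+

lemma comp_rest_word:
  "computable D cw \<Longrightarrow> computable D J \<Longrightarrow> computableM D M \<Longrightarrow>
   computable D (\<lambda>c. rest_word (cw c) (cn c) (J c) (M c))"
  unfolding rest_word_def by (assumption | rule comp_rules2 comp_2_3 | erule comp_ok)+

lemma comp_elem:
  "computable D cw \<Longrightarrow> computable D g \<Longrightarrow> computable D J \<Longrightarrow> computable D X \<Longrightarrow>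
   computable D (\<lambda>c. elem (cw c) (lsbW (cw c) (g c)) (J c) (X c))"
  unfolding elem_def by (assumption | rule comp_lsbW comp_rules2 comp_2_3 | erule comp_ok)+

lemma comp_choiceW:
  "computable D cw \<Longrightarrow> computable D N \<Longrightarrow> computable D g \<Longrightarrow> computableM D M \<Longrightarrow>
   computable D (\<lambda>c. choiceW (cw c) (cn c) (N c) (lsbW (cw c) (g c)) (M c))"
  unfolding choiceW_def by (assumption | rule comp_elem comp_rest_word comp_rules2 comp_2_3 | erule comp_ok)+

end

section \<open>From computable functions to programs\<close>

definition bitat :: "nat \<Rightarrow> (nat \<Rightarrow> nat) \<Rightarrow> nat \<Rightarrow> bool" where
  "bitat w W p = bit (W (p div w)) (p mod w)"

lemma bitat_word_at: "0 < w \<Longrightarrow> bitat w (word_at w m) p = m p"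
  by (simp add: bitat_def bit_word_at)

text \<open>Correctness of the dictionary on sequences of words, free of programs. The first clause
  lets \<open>Inv\<close> survive the changes that the environment may make to the bits after
  \<open>n\<close> between operations.\<close>

definition implements where
  "implements w s n res M \<longleftrightarrow> (\<exists>Inv :: nat set \<Rightarrow> (nat \<Rightarrow> nat) \<Rightarrow> bool.
     (\<forall>S W W'. (\<forall>j. W j < 2 ^ w) \<longrightarrow> (\<forall>j. W' j < 2 ^ w) \<longrightarrow> (\<forall>p\<le>n. bitat w W' p = bitat w W p) \<longrightarrow>
        Inv S W \<longrightarrow> Inv S W') \<and>
     (\<forall>W. (\<forall>j. W j < 2 ^ w) \<longrightarrow> Inv {} (M Init (Ctx w s n 0 W)) \<and>
        (\<forall>p>n. bitat w (M Init (Ctx w s n 0 W)) p = bitat w W p)) \<and>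
     (\<forall>S W k l. (\<forall>j. W j < 2 ^ w) \<longrightarrow> Inv S W \<longrightarrow> valid_op n k l \<longrightarrow>
        Inv (abs_update k l S) (M k (Ctx w s n l W)) \<and>
        correct_result k l S (res k (Ctx w s n l W)) \<and>
        (\<forall>p>n. bitat w (M k (Ctx w s n l W)) p = bitat w W p)))"

lemma ex_opk_bound: "\<exists>b :: nat. \<forall>k :: opk. f k \<le> b"
proof -
  have "f k \<le> f Init + f Ins + f Del + f Cont + f Ch" for k by (cases k) auto
  then show ?thesis by blast
qed

text \<open>Programs, running time and register count are read off the expressions for
  \<open>res\<close> and \<open>M\<close>; hence they are fixed before \<open>w\<close>,
  \<open>s\<close> and \<open>n\<close>.\<close>

lemma choice_dict_of_computable:
  assumes computable: "\<And>k. computable D (res k)" "\<And>k. computableM D (M k)"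
  shows "\<exists>P T R. uses_regs_below P R \<and> (\<forall>w s n. (\<forall>l W. l < 2 ^ w \<longrightarrow> (\<forall>j. W j < 2 ^ w) \<longrightarrow> Ctx w (s w) n l W \<in> D) \<longrightarrow>
     n < 2 ^ w \<longrightarrow> implements w (s w) n res M \<longrightarrow> choice_dict_ok P T w s n)"
proof -
  have "\<forall>k. \<exists>e. \<forall>c\<in>D. eval e c = res k c" using computable(1) by (auto simp: computable_def)
  then obtain e where e: "\<And>k c. c \<in> D \<Longrightarrow> eval (e k) c = res k c" by metis
  have "\<forall>k. \<exists>ps. \<forall>c\<in>D. stored ps c = M k c" using computable(2) by (auto simp: computableM_def)
  then obtain ps where ps: "\<And>k c. c \<in> D \<Longrightarrow> stored (ps k) c = M k c" by metis
  define P where "P k = compile_op (e k) (ps k)" for k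
  obtain T where T: "\<And>k. length (P k) \<le> T"
    using ex_opk_bound[of "\<lambda>k. length (P k)"] by blast
  \<comment> \<open>The sum of all register numbers is a crude bound on each of them.\<close>
  obtain R where R: "\<And>k. sum_list (concat (map regs_of (P k))) \<le> R"
    using ex_opk_bound[of "\<lambda>k. sum_list (concat (map regs_of (P k)))"] by blast
  have "uses_regs_below P (Suc R)"
    unfolding uses_regs_below_def
  proof (intro allI ballI)
    fix k i x assume "i \<in> set (P k)" "x \<in> set (regs_of i)"
    then have "x \<le> sum_list (concat (map regs_of (P k)))"
      by (intro member_le_sum_list) auto
    with R[of k] show "x < Suc R" by linarith
  qed
  moreover have "choice_dict_ok P T w s n"
    if D: "\<And>l W. l < 2 ^ w \<Longrightarrow> (\<forall>j. W j < 2 ^ w) \<Longrightarrow> Ctx w (s w) n l W \<in> D"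
      and n: "n < 2 ^ w" and impl: "implements w (s w) n res M" for w s n
  proof -
    let ?c = "\<lambda>l m. ctx_of w s n l m"
    have cD: "?c l m \<in> D" if "l < 2 ^ w" for l m
      unfolding ctx_of_def by (rule D) (use that word_at_less in auto)
    have "?c 0 (\<lambda>_. False) \<in> ok_ctx" using comp_ok[OF computable(1)] cD[of 0] by auto
    then have w: "0 < w" by (auto simp: ok_ctx_def ctx_of_def)
    have run: "fst (run_op (P k) w s n T l m) = length (P k)"
      "result_of (run_op (P k) w s n T l m) = res k (?c l m)"
      "word_at w (mem_of (run_op (P k) w s n T l m)) = M k (?c l m)" if "l < 2 ^ w" for k l m
      unfolding P_def using run_compile_op[OF T[of k, unfolded P_def] w that, of s n m] e ps cD[OF that] by auto
    obtain Inv where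
      Inv1: "\<And>S W W'. (\<forall>j. W j < 2 ^ w) \<Longrightarrow> (\<forall>j. W' j < 2 ^ w) \<Longrightarrow> (\<forall>p\<le>n. bitat w W' p = bitat w W p) \<Longrightarrow>
        Inv S W \<Longrightarrow> Inv S W'" and
      Inv2: "\<And>W. (\<forall>j. W j < 2 ^ w) \<Longrightarrow> Inv {} (M Init (Ctx w (s w) n 0 W)) \<and>
        (\<forall>p>n. bitat w (M Init (Ctx w (s w) n 0 W)) p = bitat w W p)" and
      Inv3: "\<And>S W k l. (\<forall>j. W j < 2 ^ w) \<Longrightarrow> Inv S W \<Longrightarrow> valid_op n k l \<Longrightarrow>
        Inv (abs_update k l S) (M k (Ctx w (s w) n l W)) \<and>
        correct_result k l S (res k (Ctx w (s w) n l W)) \<and>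
        (\<forall>p>n. bitat w (M k (Ctx w (s w) n l W)) p = bitat w W p)"
      using impl unfolding implements_def by blast
    have l: "l < 2 ^ w" if "valid_op n k l" for k l
      using that n by (auto simp: valid_op_def)
    have env: "Inv S (word_at w m')" if "Inv S (word_at w m)" "\<forall>p\<le>n. m' p = m p" for S m m'
      by (rule Inv1[of "word_at w m"]) (use that w in \<open>auto simp: word_at_less bitat_word_at\<close>)
    have reach: "(S, m) \<in> reach P w s n T \<Longrightarrow> Inv S (word_at w m)" for S m
    proof (induction rule: reach.induct)
      case (init m0)
      then show ?case using Inv2[of "word_at w m0"] run(3)[of 0 Init] by (simp add: word_at_less ctx_of_def)
    next
      case (upd S m m' k l)
      from Inv3[OF _ env[OF upd.IH upd.hyps(2)] upd.hyps(3)] show ?case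
        using run(3)[OF l[OF upd.hyps(3)]] by (simp add: word_at_less ctx_of_def)
    qed
    have outside: "mem_of (run_op (P k) w s n T l m) p = m p"
      if "bitat w (M k (?c l m)) p = bitat w (word_at w m) p" "l < 2 ^ w" for k l m p
      using that bitat_word_at[OF w, of m p] bitat_word_at[OF w, of "mem_of (run_op (P k) w s n T l m)" p]
      by (simp add: run)
    show ?thesis
      unfolding choice_dict_ok_def
    proof (intro conjI allI impI)
      fix m0
      show "op_ok (P Init) w s n T 0 m0"
        using Inv2[of "word_at w m0"] run(1)[of 0 Init] outside[of Init 0 m0]
        by (auto simp: op_ok_def Let_def word_at_less ctx_of_def)
    next
      fix S m m' k l
      assume *: "(S, m) \<in> reach P w s n T" "\<forall>p\<le>n. m' p = m p" "valid_op n k l"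
      note 3 = Inv3[OF _ env[OF reach[OF *(1)] *(2)] *(3)]
      show "op_ok (P k) w s n T l m'"
        using 3 run(1)[OF l[OF *(3)]] outside[OF _ l[OF *(3)]]
        by (auto simp: op_ok_def Let_def word_at_less ctx_of_def)
      show "correct_result k l S (result_of (run_op (P k) w s n T l m'))"
        using 3 run(2)[OF l[OF *(3)]] by (simp add: word_at_less ctx_of_def)
    qed
  qed
  ultimately show ?thesis by blast
qed

text \<open>Unlike in \<open>comp_if\<close>, each alternative is computable only on its own part of
  \<open>D\<close>. Expressions are total, so evaluating the other one there is harmless.\<close>

lemma comp_split:
  assumes "computableP D P" "computable {c \<in> D. P c} f" "computable {c \<in> D. \<not> P c} g"
  shows "computable D (\<lambda>c. if P c then f c else g c)"
proof -
  from assms(2,3) obtain e1 e2 where "\<forall>c\<in>{c \<in> D. P c}. eval e1 c = f c" "\<forall>c\<in>{c \<in> D. \<not> P c}. eval e2 c = g c"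
    by (auto simp: computable_def)
  moreover have "computable D (eval e1)" "computable D (eval e2)"
    using compP_D[OF assms(1)] by (auto intro: compI)
  ultimately show ?thesis
    by - (rule comp_cong[OF comp_if[OF assms(1)]], assumption, assumption, auto)
qed

lemma compM_split:
  assumes "computableP D P" "computableM {c \<in> D. P c} f" "computableM {c \<in> D. \<not> P c} g"
  shows "computableM D (\<lambda>c. if P c then f c else g c)"
proof -
  from assms(2,3) obtain e1 e2 where "\<forall>c\<in>{c \<in> D. P c}. stored e1 c = f c" "\<forall>c\<in>{c \<in> D. \<not> P c}. stored e2 c = g c"
    by (auto simp: computableM_def)
  moreover have "computableM D (stored e1)" "computableM D (stored e2)"
    using compP_D[OF assms(1)] by (auto simp: computableM_def)
  ultimately show ?thesis
    by - (rule compM_cong[OF compM_if[OF assms(1)]], assumption, assumption, auto)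
qed

lemma implements_cong:
  assumes "implements w s n res M" "\<And>k l W. res' k (Ctx w s n l W) = res k (Ctx w s n l W)"
    "\<And>k l W. M' k (Ctx w s n l W) = M k (Ctx w s n l W)"
  shows "implements w s n res' M'"
  using assms(1) unfolding implements_def assms(2,3) .

section \<open>Small word lengths\<close>

text \<open>For word lengths below a constant, the relevant part of the input has boundedly many values,
so every function of it is computable, and S is stored as a plain bit vector.\<close>

definition agree :: "ctx \<Rightarrow> ctx \<Rightarrow> bool" where
  "agree c c' \<longleftrightarrow> cw c = cw c' \<and> cn c = cn c' \<and> cl c = cl c' \<and> (\<forall>j\<le>cn c. cW c j = cW c' j)"

context
  fixes w0 :: nat and D :: "ctx set"
  assumes D: "D \<subseteq> ok_ctx" and D_small: "\<And>c. c \<in> D \<Longrightarrow> cw c < w0"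
begin

text \<open>A constant address may exceed the word range for the current \<open>w\<close>. The
  truncated address never does, and it still reaches every word up to \<open>cn c\<close>.\<close>

lemma comp_min_cn: "computable D (\<lambda>c. min j (cn c))"
proof (induction j)
  case 0
  then show ?case using comp_0[OF D] by simp
next
  case (Suc j)
  have "computable D (\<lambda>c. if min j (cn c) < cn c then (min j (cn c) + 1) mod 2 ^ cw c else cn c)"
    by (intro comp_if compP_less comp_add Suc comp_cn comp_1 D)
  then show ?case
  proof (rule comp_cong)
    fix c assume "c \<in> D"
    then have "cn c < 2 ^ cw c" using D by (auto simp: ok_ctx_def)
    then show "(if min j (cn c) < cn c then (min j (cn c) + 1) mod 2 ^ cw c else cn c) = min (Suc j) (cn c)"
      by (auto simp: min_def)
  qed
qed

lemma comp_small:
  assumes "\<And>c. c \<in> D \<Longrightarrow> f c < 2 ^ cw c"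
    "\<And>c c'. c \<in> D \<Longrightarrow> c' \<in> D \<Longrightarrow> agree c c' \<Longrightarrow> f c = f c'"
  shows "computable D f"
proof -
  \<comment> \<open>\<open>2 ^ i mod 2 ^ cw c\<close> vanishes exactly for
    \<open>cw c \<le> i\<close>, so the first entries reveal the word length.\<close>
  define gs where "gs = map (\<lambda>i c. 2 ^ i mod 2 ^ cw c) [0..<w0] @ [cn, cl] @
    map (\<lambda>j c. get (cW c) (min j (cn c))) [0..<2 ^ w0]"
  \<comment> \<open>Any input with the same recorded information will do, since such inputs agree
    and \<open>f\<close> cannot tell them apart.\<close>
  define h where "h xs = f (SOME c. c \<in> D \<and> map (\<lambda>g. g c) gs = xs)" for xs
  have ag: "agree c c'" if c: "c \<in> D" "c' \<in> D" and eq: "map (\<lambda>g. g c) gs = map (\<lambda>g. g c') gs" for c c'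
  proof -
    have eq': "g c = g c'" if "g \<in> set gs" for g
      using eq that by (auto simp: map_eq_conv)
    have "(2::nat) ^ i mod 2 ^ cw c = 2 ^ i mod 2 ^ cw c'" if "i < w0" for i
      using eq'[of "\<lambda>c. 2 ^ i mod 2 ^ cw c"] that by (force simp: gs_def)
    from this[of "cw c"] this[of "cw c'"] D_small[OF c(1)] D_small[OF c(2)] have "cw c = cw c'"
      by (metis linorder_neqE_nat mod_self mod_less one_less_numeral_iff power_strict_increasing_iff
          semiring_norm(76) power_not_zero zero_neq_numeral)
    moreover have "cn c = cn c'" "cl c = cl c'" using eq'[of cn] eq'[of cl] by (auto simp: gs_def)
    moreover have "cW c j = cW c' j" if "j \<le> cn c" for j
    proof -
      have "cn c < 2 ^ cw c" using c D by (auto simp: ok_ctx_def)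
      also have "\<dots> \<le> 2 ^ w0" using D_small[OF c(1)] by (intro power_increasing) auto
      finally have "j < 2 ^ w0" using that by simp
      then have "(\<lambda>c. get (cW c) (min j (cn c))) \<in> set gs" by (auto simp: gs_def)
      from eq'[OF this] show ?thesis using that \<open>cn c = cn c'\<close> by (simp add: get_def min_def)
    qed
    ultimately show ?thesis by (simp add: agree_def)
  qed
  have "computable D (\<lambda>c. h (map (\<lambda>g. g c) gs) mod 2 ^ cw c)"
  proof (rule comp_finite_info[OF D, where V = "2 ^ w0"])
    fix g assume "g \<in> set gs"
    then show "computable D g"
      using D by (auto simp: gs_def intro!: comp_const comp_cn comp_cl comp_get compM_cW comp_min_cn)
    fix c assume "c \<in> D"
    with comp_less[OF \<open>computable D g\<close>] have "g c < 2 ^ cw c" by blast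
    also have "\<dots> \<le> 2 ^ w0" using D_small[OF \<open>c \<in> D\<close>] by (intro power_increasing) auto
    finally show "g c < 2 ^ w0" .
  qed
  then show ?thesis
  proof (rule comp_cong)
    fix c assume c: "c \<in> D"
    define c' where "c' = (SOME c'. c' \<in> D \<and> map (\<lambda>g. g c') gs = map (\<lambda>g. g c) gs)"
    have "c' \<in> D \<and> map (\<lambda>g. g c') gs = map (\<lambda>g. g c) gs"
      unfolding c'_def by (rule someI[of _ c]) (use c in simp)
    then have "f c' = f c" using ag c assms(2) by blast
    then show "h (map (\<lambda>g. g c) gs) mod 2 ^ cw c = f c"
      using assms(1)[OF c] by (simp add: h_def c'_def)
  qed
qed

lemma compM_small:
  assumes "\<And>c j. c \<in> D \<Longrightarrow> j \<le> cn c \<Longrightarrow> F c j < 2 ^ cw c"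
    "\<And>c j. c \<in> D \<Longrightarrow> cn c < j \<Longrightarrow> F c j = cW c j"
    "\<And>c c' j. c \<in> D \<Longrightarrow> c' \<in> D \<Longrightarrow> agree c c' \<Longrightarrow> j \<le> cn c \<Longrightarrow> F c j = F c' j"
  shows "computableM D F"
proof -
  have "computableM D (\<lambda>c j. if j < B \<and> j \<le> cn c then F c j else cW c j)" for B
  proof (induction B)
    case 0
    then show ?case using compM_cW[OF D] by simp
  next
    case (Suc B)
    have "computable D (\<lambda>c. F c (min B (cn c)))"
    proof (rule comp_small)
      fix c c' assume *: "c \<in> D" "c' \<in> D" "agree c c'"
      then have "cn c' = cn c" by (simp add: agree_def)
      then show "F c (min B (cn c)) = F c' (min B (cn c'))" using assms(3)[OF *] by simp
    qed (use assms(1) in auto)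
    \<comment> \<open>Once \<open>B\<close> exceeds \<open>cn c\<close>, this stores the final value
      of word \<open>cn c\<close> once more.\<close>
    from compM_put[OF Suc comp_min_cn this] show ?case
      by (rule compM_cong) (auto simp: put_def fun_eq_iff min_def)
  qed
  from this[of "2 ^ w0"] show ?thesis
  proof (rule compM_cong)
    fix c assume c: "c \<in> D"
    have "cn c < 2 ^ cw c" using c D by (auto simp: ok_ctx_def)
    also have "\<dots> \<le> 2 ^ w0" using D_small[OF c] by (intro power_increasing) auto
    finally have lt: "cn c < 2 ^ w0" .
    show "(\<lambda>j. if j < 2 ^ w0 \<and> j \<le> cn c then F c j else cW c j) = F c"
    proof
      fix j show "(if j < 2 ^ w0 \<and> j \<le> cn c then F c j else cW c j) = F c j"
        using assms(2)[OF c, of j] lt by (cases "j \<le> cn c") auto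
    qed
  qed
qed

end

text \<open>Here element \<open>l\<close> is bit \<open>l\<close>, as \<open>n + 1\<close> bits are
  owned. The guard \<open>cl c \<le> cn c\<close> makes the result depend on the words up to
  \<open>cn c\<close> only, even for invalid arguments.\<close>

definition resS :: "opk \<Rightarrow> ctx \<Rightarrow> nat" where
  "resS k c = (case k of Cont \<Rightarrow> of_bool (cl c \<le> cn c \<and> bitat (cw c) (cW c) (cl c))
     | Ch \<Rightarrow> (if \<exists>l\<in>{1..cn c}. bitat (cw c) (cW c) l then LEAST l. l \<in> {1..cn c} \<and> bitat (cw c) (cW c) l else 0)
     | _ \<Rightarrow> 0)"

definition memS :: "opk \<Rightarrow> ctx \<Rightarrow> nat \<Rightarrow> nat" where
  "memS k c = (case k of Init \<Rightarrow> word_at (cw c) (\<lambda>p. cn c < p \<and> bitat (cw c) (cW c) p)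
     | Ins \<Rightarrow> word_at (cw c) (\<lambda>p. p = cl c \<and> cl c \<le> cn c \<or> bitat (cw c) (cW c) p)
     | Del \<Rightarrow> word_at (cw c) (\<lambda>p. \<not> (p = cl c \<and> cl c \<le> cn c) \<and> bitat (cw c) (cW c) p)
     | _ \<Rightarrow> cW c)"

lemma bitat_word: "i < w \<Longrightarrow> bitat w W (j * w + i) = bit (W j) i"
  by (simp add: bitat_def)

lemma word_at_cong: "(\<And>i. i < w \<Longrightarrow> m (j * w + i) = m' (j * w + i)) \<Longrightarrow> word_at w m j = word_at w m' j"
  by (rule bit_eqI) (auto simp: bit_word_at)

lemma word_at_unchanged:
  assumes "\<And>i. i < w \<Longrightarrow> m (j * w + i) = bitat w W (j * w + i)" "W j < 2 ^ w"
  shows "word_at w m j = W j"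
proof (rule bit_eqI)
  fix i
  have "w \<le> i \<Longrightarrow> \<not> bit (W j) i" using assms(2) unfolding less_pow2_iff_bits by blast
  then show "bit (word_at w m j) i = bit (W j) i"
    using assms(1)[of i] bitat_word[of i w W j] by (cases "i < w") (auto simp: bit_word_at)
qed

lemma
  assumes D: "D \<subseteq> ok_ctx" and D_small: "\<And>c. c \<in> D \<Longrightarrow> cw c < w0"
  shows comp_resS: "computable D (resS k)" and compM_memS: "computableM D (memS k)"
proof -
  have ok: "0 < cw c" "cn c < 2 ^ cw c" "cW c j < 2 ^ cw c" if "c \<in> D" for c j
    using that D by (auto simp: ok_ctx_def)
  have agree_bit: "bitat (cw c) (cW c) p = bitat (cw c') (cW c') p" if "agree c c'" "p \<le> cn c" for c c' p
  proof -
    have "p div cw c \<le> cn c" using that(2) by (meson div_le_dividend le_trans)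
    then show ?thesis using that by (simp add: agree_def bitat_def)
  qed
  show "computable D (resS k)"
  proof (rule comp_small[OF D D_small])
    fix c assume c: "c \<in> D"
    show "resS k c < 2 ^ cw c"
    proof (cases "k = Ch \<and> (\<exists>l\<in>{1..cn c}. bitat (cw c) (cW c) l)")
      case True
      then obtain l where l: "l \<in> {1..cn c} \<and> bitat (cw c) (cW c) l" by blast
      have "resS k c \<le> l" using True l by (auto simp: resS_def intro: Least_le)
      then show ?thesis using l ok(2)[OF c] by simp
    next
      case False
      have "1 < (2::nat) ^ cw c" using ok(1)[OF c] by (rule one_less_power[rotated]) simp
      with False show ?thesis by (cases k) (auto simp: resS_def)
    qed
  next
    fix c c' assume "c \<in> D" "c' \<in> D" and a: "agree c c'"
    have eq: "l \<in> {1..cn c} \<and> bitat (cw c) (cW c) l \<longleftrightarrow> l \<in> {1..cn c'} \<and> bitat (cw c') (cW c') l" for l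
      using agree_bit[OF a, of l] a by (auto simp: agree_def)
    have "cl c \<le> cn c \<and> bitat (cw c) (cW c) (cl c) \<longleftrightarrow> cl c' \<le> cn c' \<and> bitat (cw c') (cW c') (cl c')"
      using agree_bit[OF a, of "cl c"] a by (auto simp: agree_def)
    then show "resS k c = resS k c'"
      unfolding resS_def Bex_def eq by (cases k) auto
  qed
  show "computableM D (memS k)"
  proof (rule compM_small[OF D D_small])
    fix c j assume c: "c \<in> D"
    show "memS k c j < 2 ^ cw c"
      using ok(3)[OF c] by (cases k) (auto simp: memS_def word_at_less)
    assume j: "cn c < j"
    have gt: "cn c < j * cw c + i" for i
    proof -
      have "j * 1 \<le> j * cw c" using ok(1)[OF c] by (intro mult_le_mono2) simp
      with j show ?thesis by linarith
    qed
    have ne: "\<not> (j * cw c + i = cl c \<and> cl c \<le> cn c)" for i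
      using gt[of i] by auto
    have *: "word_at (cw c) m j = cW c j"
      if "\<And>i. i < cw c \<Longrightarrow> m (j * cw c + i) = bitat (cw c) (cW c) (j * cw c + i)" for m
      using that ok(3)[OF c] by (rule word_at_unchanged)
    show "memS k c j = cW c j"
      by (cases k) (use gt ne in \<open>auto simp: memS_def intro!: *\<close>)
  next
    fix c c' j assume "c \<in> D" "c' \<in> D" and a: "agree c c'" and j: "j \<le> cn c"
    from a have e: "cw c' = cw c" "cn c' = cn c" "cl c' = cl c" "cW c' j = cW c j"
      using j by (auto simp: agree_def)
    then have "i < cw c \<Longrightarrow> bitat (cw c) (cW c') (j * cw c + i) = bitat (cw c) (cW c) (j * cw c + i)" for i
      by (simp add: bitat_word)
    then show "memS k c j = memS k c' j"
      using e by (cases k) (auto simp: memS_def intro!: word_at_cong)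
  qed
qed

lemma implements_small:
  assumes "0 < w" "n < 2 ^ w"
  shows "implements w s n resS memS"
  unfolding implements_def
proof (intro exI[of _ "\<lambda>S W. S = {l \<in> {1..n}. bitat w W l}"] conjI allI impI)
  fix S W k l assume *: "S = {l \<in> {1..n}. bitat w W l}" "valid_op n k l"
  show "abs_update k l S = {la \<in> {1..n}. bitat w (memS k (Ctx w s n l W)) la}"
    using * assms by (cases k) (auto simp: memS_def bitat_word_at valid_op_def)
  show "bitat w (memS k (Ctx w s n l W)) p = bitat w W p" if "n < p" for p
    using * assms that by (cases k) (auto simp: memS_def bitat_word_at valid_op_def)
  show "correct_result k l S (resS k (Ctx w s n l W))"
  proof (cases "k = Ch \<and> S \<noteq> {}")
    case True
    then obtain x where "x \<in> {1..n} \<and> bitat w W x" using * by auto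
    from LeastI[of "\<lambda>x. x \<in> {1..n} \<and> bitat w W x", OF this] this
    show ?thesis using * True by (auto simp: resS_def)
  next
    case False
    then show ?thesis using * by (cases k) (auto simp: resS_def valid_op_def)
  qed
qed (use assms in \<open>auto simp: memS_def bitat_word_at\<close>)

section \<open>The choice dictionary\<close>

definition num_blocks :: "ctx \<Rightarrow> nat" where
  "num_blocks c = cn c div cw c div 3"

definition resL :: "(ctx \<Rightarrow> nat) \<Rightarrow> opk \<Rightarrow> ctx \<Rightarrow> nat" where
  "resL g k c = (case k of
       Cont \<Rightarrow> of_bool (containsW (cw c) (cn c) (num_blocks c) (cl c) (cW c))
     | Ch \<Rightarrow> choiceW (cw c) (cn c) (num_blocks c) (lsbW (cw c) (g c)) (cW c)
     | _ \<Rightarrow> 0)"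

definition memL :: "opk \<Rightarrow> ctx \<Rightarrow> nat \<Rightarrow> nat" where
  "memL k c = (case k of
       Init \<Rightarrow> initW (cw c) (cn c) (num_blocks c) (cW c)
     | Ins \<Rightarrow> editW (cw c) (cn c) (num_blocks c) True (cl c) (cW c)
     | Del \<Rightarrow> editW (cw c) (cn c) (num_blocks c) False (cl c) (cW c)
     | _ \<Rightarrow> cW c)"

lemma
  assumes D: "D \<subseteq> ok_ctx" and g: "computable D g" "\<And>c. c \<in> D \<Longrightarrow> good_field (cw c) (g c)"
  shows comp_resL: "computable D (resL g k)" and compM_memL: "computableM D (memL k)"
proof -
  have two: "2 \<le> cw c" if "c \<in> D" for c
    using good_field_bounds(4)[OF g(2)[OF that]] by linarith
  have w: "computable D cw" by (rule comp_cw[OF g])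
  have N: "computable D num_blocks"
    unfolding num_blocks_def by (intro comp_div comp_cn D w comp_2_3 two)
  note W = compM_cW[OF D]
  show "computable D (resL g k)"
    unfolding resL_def using comp_of_bool[OF compP_containsW[OF two w N W]]
      comp_choiceW[OF two w N g(1) W] comp_0[OF D] by (cases k) simp_all
  show "computableM D (memL k)"
    unfolding memL_def using compM_initW[OF two w N W] compM_editW[OF two w N W] W
    by (cases k) simp_all
qed

lemma implements_large:
  assumes g: "good_field w gg" and gW: "\<And>l W. g (Ctx w s n l W) = gg"
    and n: "n < 2 ^ w"
  shows "implements w s n (resL g) memL"
proof -
  define N where "N = n div w div 3"
  have w4: "4 \<le> w" using good_field_bounds(4)[OF g] g by (simp add: good_field_def)
  have w: "0 < w" using w4 by simp
  have small: "3 * N + 2 < 2 ^ w"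
  proof -
    have "16 \<le> (2::nat) ^ w" using power_increasing[OF w4, of "2::nat"] by simp
    moreover have "n div w \<le> n div 4" using w4 by (intro div_le_mono2) auto
    ultimately show ?thesis using n unfolding N_def by linarith
  qed
  note ctx = w N_def n small
  define bits where "bits W = {l \<in> {1..n}. bit (lword w n N W ((l - 1) div w)) ((l - 1) mod w)}" for W
  define Inv where "Inv S W \<longleftrightarrow> (\<exists>k. barrier_at w n N k W \<and> S = bits W)" for S W
  have num_blocks: "num_blocks (Ctx w s n l W) = N" for l W by (simp add: num_blocks_def N_def)
  have closed: "Inv S W'" if W: "\<forall>j. W j < 2 ^ w" "\<forall>j. W' j < 2 ^ w"
    and eq: "\<forall>p\<le>n. bitat w W' p = bitat w W p" and chain_inv: "Inv S W" for S W W'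
  proof -
    \<comment> \<open>Words before \<open>3 * N\<close> consist of owned bits only, so the
      environment cannot touch them.\<close>
    have word: "W' j = W j" if "j < 3 * N" for j
    proof (rule bit_eqI)
      fix b
      show "bit (W' j) b = bit (W j) b"
      proof (cases "b < w")
        case True
        have "Suc j \<le> n div w" using that N_le[OF ctx] by linarith
        then have "Suc j * w \<le> n div w * w" by (rule mult_le_mono1)
        also have "\<dots> \<le> n" by simp
        finally have "j * w + b \<le> n" using True by simp
        from eq[rule_format, OF this] show ?thesis using True by (simp add: bitat_word)
      next
        case False
        then show ?thesis using W unfolding less_pow2_iff_bits by (meson not_le)
      qed
    qed
    have blk_eq: "aW W i = aW W' i" "bW W i = bW W' i" "eW W i = eW W' i" if "i < N" for i
      using that word by (simp_all add: aW_def bW_def eW_def)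
    from chain_inv obtain k where barrier_at: "barrier_at w n N k W" and S: "S = bits W" by (auto simp: Inv_def)
    have "chain_inv N k (aW W') (bW W') (eW W')"
      by (rule chain_inv_cong[of N "aW W" _ k "bW W" _ "eW W"]) (use blk_eq barrier_at in \<open>auto simp: barrier_at_def\<close>)
    moreover have "bit (W' (n div w)) (n mod w) = bit (W (n div w)) (n mod w)"
      using eq by (auto simp: bitat_def)
    moreover have "W' (3 * (N - 1) + 1) = W (3 * (N - 1) + 1)" if "k < N"
      using that by (intro word) linarith
    ultimately have barrier_at': "barrier_at w n N k W'" using barrier_at by (simp add: barrier_at_def)
    have "block N k W' i = block N k W i" if "i < N" for i
      unfolding block_def by (rule content_cong[symmetric]) (use blk_eq that in auto)
    then have "bit (lword w n N W' (p div w)) (p mod w) = bit (lword w n N W (p div w)) (p mod w)"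
      if "p \<le> n" for p
      using eq that by (auto simp: lword[OF ctx barrier_at'] lword[OF ctx barrier_at] bitat_def)
    then have "bits W' = bits W" by (auto simp: bits_def)
    then show ?thesis using barrier_at' S by (auto simp: Inv_def)
  qed
  have edit: "Inv (if v then insert l S else S - {l}) (editW w n N v l W) \<and>
      (\<forall>p>n. bitat w (editW w n N v l W) p = bitat w W p)"
    if chain_inv: "Inv S W" and l: "l \<in> {1..n}" for S W v l
  proof -
    from chain_inv obtain k where barrier_at: "barrier_at w n N k W" and S: "S = bits W" by (auto simp: Inv_def)
    have "l - 1 < n" using l by auto
    from editW[OF ctx barrier_at this, of v] obtain k' where barrier_at': "barrier_at w n N k' (editW w n N v l W)" and
      b: "\<And>j b. (j, b) \<noteq> (n div w, n mod w) \<Longrightarrow> bit (lword w n N (editW w n N v l W) j) b =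
        (if j = (l - 1) div w \<and> b = (l - 1) mod w then v else bit (lword w n N W j) b)"
      by blast
    have pos: "bit (lword w n N (editW w n N v l W) (p div w)) (p mod w) =
        (if p = l - 1 then v else bit (lword w n N W (p div w)) (p mod w))" if "p \<noteq> n" for p
    proof -
      have "p div w = (l - 1) div w \<and> p mod w = (l - 1) mod w \<longleftrightarrow> p = l - 1"
        by (metis div_mult_mod_eq)
      then show ?thesis using b[OF pos_ne_flag[OF ctx that]] by simp
    qed
    have "x \<in> bits (editW w n N v l W) \<longleftrightarrow> x \<in> (if v then insert l S else S - {l})" for x
    proof (cases "x \<in> {1..n}")
      case True
      then have "x - 1 \<noteq> n" "x - 1 = l - 1 \<longleftrightarrow> x = l" using l by auto
      with pos[of "x - 1"] show ?thesis using True l by (simp add: bits_def S)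
    next
      case False
      then show ?thesis using l by (auto simp: bits_def S)
    qed
    then have "bits (editW w n N v l W) = (if v then insert l S else S - {l})" by blast
    with barrier_at' have 1: "Inv (if v then insert l S else S - {l}) (editW w n N v l W)"
      unfolding Inv_def by metis
    have "bitat w (editW w n N v l W) p = bitat w W p" if p: "n < p" for p
    proof -
      have "n div w \<le> p div w" using p by (intro div_le_mono) simp
      then have "\<not> p div w div 3 < N" using N_le[OF ctx] by linarith
      moreover have "p \<noteq> l - 1" "p \<noteq> n" using p l by auto
      ultimately show ?thesis using pos[of p] by (simp add: bitat_def lword[OF ctx barrier_at'] lword[OF ctx barrier_at])
    qed
    with 1 show ?thesis by blast
  qed
  show ?thesis
    unfolding implements_def
  proof (intro exI[of _ Inv] conjI allI impI)
    fix W :: "nat \<Rightarrow> nat" assume "\<forall>j. W j < 2 ^ w"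
    note i = initW[OF ctx, of W, OF this[rule_format]]
    have "bits (initW w n N W) = {}" using i(2) by (auto simp: bits_def)
    with i(1) show "Inv {} (memL Init (Ctx w s n 0 W))"
      by (auto simp: memL_def num_blocks Inv_def)
    show "bitat w (memL Init (Ctx w s n 0 W)) p = bitat w W p" if "n < p" for p
      using i(3)[OF that] by (simp add: memL_def num_blocks bitat_def)
  next
    fix S W k l assume *: "\<forall>j. W j < 2 ^ w" "Inv S W" "valid_op n k l"
    from *(2) obtain kk where barrier_at: "barrier_at w n N kk W" and S: "S = bits W" by (auto simp: Inv_def)
    show "Inv (abs_update k l S) (memL k (Ctx w s n l W))"
      using edit[OF *(2), of l True] edit[OF *(2), of l False] *(2,3)
      by (cases k) (auto simp: memL_def num_blocks valid_op_def)
    show "bitat w (memL k (Ctx w s n l W)) p = bitat w W p" if "n < p" for p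
      using edit[OF *(2), of l True] edit[OF *(2), of l False] *(3) that
      by (cases k) (auto simp: memL_def num_blocks valid_op_def)
    show "correct_result k l S (resL g k (Ctx w s n l W))"
    proof (cases "k = Ch")
      case True
      have "x < 2 ^ w \<Longrightarrow> x \<noteq> 0 \<Longrightarrow> lsbW w gg x < w \<and> bit x (lsbW w gg x)" for x
        by (rule lsbW[OF g])
      note ch = choiceW[OF ctx barrier_at *(1)[rule_format] this, folded bits_def S]
      then show ?thesis using True by (simp add: resL_def num_blocks gW)
    next
      case False
      then show ?thesis
        using *(3) S by (cases k) (auto simp: resL_def num_blocks valid_op_def bits_def containsW_def)
    qed
  qed (rule closed)
qed

text \<open>With \<open>g = s div (2 * C)\<close>, the bound
  \<open>(2 * C * g)\<^sup>2 \<le> s * s \<le> C * w\<close> gives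
  \<open>4 * C * g * g \<le> w\<close>, enough room for \<open>g * (g + 1) < w\<close>. Conversely
  \<open>s \<le> 4 * C * g\<close>, so \<open>w\<close> is at most \<open>g * (K * g)\<close> with
  \<open>K\<close> as below, and \<open>K * g\<close> falls below \<open>2 ^ g\<close> once
  \<open>g\<close> reaches \<open>G\<close>; \<open>w0\<close> is chosen to force that.\<close>

lemma good_field_eventually:
  assumes "1 \<le> C"
  shows "\<exists>w0>0. \<forall>w\<ge>w0. \<forall>s. s * s \<le> C * w \<longrightarrow> w \<le> C * (s * s) \<longrightarrow>
    good_field w (s div (2 * C)) \<and> 2 * C < 2 ^ w \<and> s < 2 ^ w"
proof -
  define K where "K = 16 * (C * C * C)"
  \<comment> \<open>Chosen so that \<open>2 ^ G\<close> is 4 times the square of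
    \<open>2 ^ K\<close>, which dominates \<open>K * G + 1\<close>.\<close>
  define G where "G = 2 * K + 2"
  \<comment> \<open>The second conjunct carries the induction: the left side grows by
    \<open>K\<close> while the right side doubles.\<close>
  have pow: "K * g + 1 \<le> 2 ^ g \<and> K \<le> 2 ^ g" if "G \<le> g" for g
    using that
  proof (induction g rule: dec_induct)
    case base
    have K: "K + 1 \<le> 2 ^ K" using less_exp[of K] by linarith
    have "K * G + 1 \<le> 4 * ((K + 1) * (K + 1))" by (simp add: G_def algebra_simps)
    also have "\<dots> \<le> 4 * (2 ^ K * 2 ^ K)" by (intro mult_le_mono K order_refl)
    also have "\<dots> = 2 ^ G" by (simp add: G_def power_add mult_2)
    finally have "K * G + 1 \<le> 2 ^ G" .
    moreover have "K \<le> K * G" by (simp add: G_def)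
    ultimately show ?case by linarith
  qed (auto simp: algebra_simps)
  define w0 where "w0 = C * ((2 * C * G) * (2 * C * G))"
  have w0: "2 * C \<le> w0" "0 < w0"
  proof -
    have "1 \<le> G * (2 * C * G)" using assms by (simp add: G_def)
    then have "2 * C * 1 \<le> 2 * C * (G * (2 * C * G))" by (rule mult_le_mono2)
    also have "\<dots> \<le> w0" using assms by (simp add: w0_def mult.assoc)
    finally show "2 * C \<le> w0" by simp
    with assms show "0 < w0" by linarith
  qed
  have "good_field w (s div (2 * C)) \<and> 2 * C < 2 ^ w \<and> s < 2 ^ w"
    if w: "w0 \<le> w" and s: "s * s \<le> C * w" "w \<le> C * (s * s)" for w s
  proof -
    define g where "g = s div (2 * C)"
    have C2: "0 < 2 * C" using assms by simp
    have g1: "2 * C * g \<le> s" "s < 2 * C * (g + 1)"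
      using times_div_less_eq_dividend[of "2 * C" s] dividend_less_times_div[OF C2, of s]
      by (simp_all add: g_def)
    have G: "G \<le> g"
    proof (rule ccontr)
      assume "\<not> G \<le> g"
      then have "2 * C * (g + 1) \<le> 2 * C * G" by (intro mult_le_mono2) simp
      with g1(2) have "s < 2 * C * G" by (rule less_le_trans)
      then have "s * s < (2 * C * G) * (2 * C * G)" by (intro mult_strict_mono') auto
      then have "C * (s * s) < w0" using assms by (simp add: w0_def)
      with w s show False by linarith
    qed
    then have g2: "2 \<le> g" by (simp add: G_def)
    have "(2 * C * g) * (2 * C * g) \<le> s * s" using g1 by (intro mult_le_mono)
    also have "(2 * C * g) * (2 * C * g) = C * (4 * (C * (g * g)))" by simp
    also note s(1)
    finally have "4 * (C * (g * g)) \<le> w" using assms by simp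
    moreover have "g * g \<le> C * (g * g)" using assms by simp
    moreover have "2 * g \<le> g * g" using g2 by simp
    ultimately have 1: "g * (g + 1) < w" using g2 unfolding distrib_left mult_1_right by linarith
    have "s \<le> 4 * C * g"
    proof -
      have "2 * C * (g + 1) \<le> 2 * C * (2 * g)" using g2 by (intro mult_le_mono2) simp
      with g1(2) have "s < 2 * C * (2 * g)" by (rule less_le_trans)
      also have "\<dots> = 4 * C * g" by simp
      finally show ?thesis by simp
    qed
    then have "s * s \<le> (4 * C * g) * (4 * C * g)" by (intro mult_le_mono)
    then have "C * (s * s) \<le> C * ((4 * C * g) * (4 * C * g))" by (rule mult_le_mono2)
    also have "\<dots> = g * (K * g)" by (simp add: K_def)
    also have "\<dots> \<le> g * (2 ^ g - 1)" using pow[OF G] by (intro mult_le_mono2) linarith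
    finally have 2: "w \<le> g * (2 ^ g - 1)" using s by linarith
    have Cw: "2 * C \<le> w" using w0 w by linarith
    then have "s * s \<le> w * w" using s(1) mult_le_mono1[of C w w] by linarith
    then have "s \<le> w" by (metis mult_strict_mono' not_le zero_le)
    then show ?thesis using 1 2 g2 Cw less_exp[of w]
      unfolding good_field_def g_def[symmetric] by linarith
  qed
  with w0 show ?thesis by blast
qed

theorem theorem1:
  fixes c :: real
  assumes "c \<ge> 1"
  shows "\<exists>(P :: prog) (T :: nat) (R :: nat).
           uses_regs_below P R \<and>
           (\<forall>(w :: nat) (n :: nat) (s :: nat \<Rightarrow> nat).
              1 \<le> n \<longrightarrow> log 2 (real n) < real w \<longrightarrow>
              real (s w) \<le> c * sqrt (real w) \<longrightarrow> sqrt (real w) \<le> c * real (s w) \<longrightarrow>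
              choice_dict_ok P T w s n)"
proof -
  \<comment> \<open>Squaring both hypotheses on \<open>s w\<close> removes the square root and
    leaves natural-number inequalities with factor \<open>C\<close>.\<close>
  define C where "C = nat \<lceil>c\<^sup>2\<rceil>"
  have c2: "c\<^sup>2 \<le> real C" by (simp add: C_def)
  have "1 \<le> c\<^sup>2" using assms by simp
  with c2 have C: "1 \<le> C" by linarith
  obtain w0 where w0: "0 < w0" "\<And>w s. w0 \<le> w \<Longrightarrow> s * s \<le> C * w \<Longrightarrow> w \<le> C * (s * s) \<Longrightarrow>
      good_field w (s div (2 * C)) \<and> 2 * C < 2 ^ w \<and> s < 2 ^ w"
    using good_field_eventually[OF C] by blast
  define D where "D = {x \<in> ok_ctx. cs x * cs x \<le> C * cw x \<and> cw x \<le> C * (cs x * cs x)}"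
  define g where "g x = cs x div (2 * C)" for x
  define res where "res k x = (if cw x < w0 then resS k x else resL g k x)" for k x
  define M where "M k x = (if cw x < w0 then memS k x else memL k x)" for k x
  have D: "D \<subseteq> ok_ctx" by (auto simp: D_def)
  \<comment> \<open>The word length is not yet available, as \<open>comp_cw\<close> presupposes a
    good field. But the constant \<open>2 ^ (w0 - 1)\<close> loads as 0 exactly if
    \<open>w < w0\<close>.\<close>
  have P: "computableP D (\<lambda>x. cw x < w0)"
  proof (rule compP_cong)
    show "computableP D (\<lambda>x. 2 ^ (w0 - 1) mod 2 ^ cw x = (0::nat))"
      using compP_eq_0[OF comp_const[OF D, of "2 ^ (w0 - 1)"]] .
    fix x assume "x \<in> D"
    show "(2 ^ (w0 - 1) mod 2 ^ cw x = (0::nat)) = (cw x < w0)"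
    proof (cases "cw x < w0")
      case True
      then have "(2::nat) ^ cw x dvd 2 ^ (w0 - 1)" by (intro le_imp_power_dvd) simp
      then show ?thesis using True by (simp add: mod_eq_0_iff_dvd)
    next
      case False
      then have "(2::nat) ^ (w0 - 1) < 2 ^ cw x" using w0(1) by (intro power_strict_increasing) auto
      then show ?thesis using False by simp
    qed
  qed
  let ?S = "{x \<in> D. cw x < w0}" and ?L = "{x \<in> D. \<not> cw x < w0}"
  have L: "?L \<subseteq> ok_ctx" and large: "x \<in> ?L \<Longrightarrow> good_field (cw x) (g x) \<and> 2 * C < 2 ^ cw x \<and> cs x < 2 ^ cw x" for x
    using D w0(2)[of "cw x" "cs x"] by (auto simp: D_def g_def)
  have g: "computable ?L g"
    by (rule comp_cong[OF comp_div[OF comp_cs[OF L] comp_const[OF L, of "2 * C"]]])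
       (use large in \<open>auto simp: g_def\<close>)
  have "computable D (res k)" for k
    unfolding res_def
    by (rule comp_split[OF P comp_resS[of ?S w0] comp_resL[OF L g]]) (use D large in auto)
  moreover have "computableM D (M k)" for k
    unfolding M_def
    by (rule compM_split[OF P compM_memS[of ?S w0] compM_memL[OF L g]]) (use D large in auto)
  ultimately obtain P T R where PTR: "uses_regs_below P R"
    "\<And>w s n. (\<forall>l W. l < 2 ^ w \<longrightarrow> (\<forall>j. W j < 2 ^ w) \<longrightarrow> Ctx w (s w) n l W \<in> D) \<Longrightarrow>
     n < 2 ^ w \<Longrightarrow> implements w (s w) n res M \<Longrightarrow> choice_dict_ok P T w s n"
    using choice_dict_of_computable[of D res M] by blast
  have "choice_dict_ok P T w s n"
    if n: "1 \<le> n" "log 2 (real n) < real w" and s: "real (s w) \<le> c * sqrt (real w)" "sqrt (real w) \<le> c * real (s w)"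
    for w n and s :: "nat \<Rightarrow> nat"
  proof -
    have nw: "n < 2 ^ w"
    proof -
      have "real n < 2 powr real w" using n by (simp add: log_less_iff)
      then show ?thesis by (simp add: powr_realpow)
    qed
    have w: "0 < w" using n nw by (cases w) auto
    have "(real (s w))\<^sup>2 \<le> (c * sqrt (real w))\<^sup>2" using s(1) by (intro power_mono) auto
    also have "\<dots> \<le> real C * real w" using c2 by (simp add: power_mult_distrib mult_right_mono)
    finally have "real (s w * s w) \<le> real (C * w)" by (simp add: power2_eq_square)
    then have s1: "s w * s w \<le> C * w" by (simp only: of_nat_le_iff)
    have "(sqrt (real w))\<^sup>2 \<le> (c * real (s w))\<^sup>2" using s(2) by (intro power_mono) auto
    also have "\<dots> \<le> real C * (real (s w))\<^sup>2" using c2 by (simp add: power_mult_distrib mult_right_mono)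
    finally have "real w \<le> real (C * (s w * s w))" by (simp add: power2_eq_square)
    then have s2: "w \<le> C * (s w * s w)" by (simp only: of_nat_le_iff)
    have "implements w (s w) n res M"
    proof (cases "w < w0")
      case True
      show ?thesis
        by (rule implements_cong[OF implements_small[OF w nw]]) (use True in \<open>auto simp: res_def M_def\<close>)
    next
      case False
      have "good_field w (s w div (2 * C))" using w0(2)[of w "s w"] False s1 s2 by auto
      then have "implements w (s w) n (resL g) memL"
        by (intro implements_large) (auto simp: g_def nw)
      then show ?thesis
        by (rule implements_cong) (use False in \<open>auto simp: res_def M_def\<close>)
    qed
    then show ?thesis
      by (intro PTR(2)) (use w nw s1 s2 in \<open>auto simp: D_def ok_ctx_def\<close>)
  qed
  with PTR(1) show ?thesis by blast
qed

end
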